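(* Let $\mathcal M$ be a proper invariant subspace of $\bigotimes_{i=1}^kF^2(H_{n_i})$. Then $\mathbf S|_{\mathcal M}\in\mathbf B_{\mathbf n}(\mathcal M)$ and $\mathrm{curv}(P_{\mathcal M^\perp}\mathbf S|_{\mathcal M^\perp})=0$ if and only if there is an inner sequence $\{\psi_s\}_{s=1}^\infty$ for $\mathcal M$, i.e., $\psi_s$ are multipliers (multi-analytic operators) of $\bigotimes_{i=1}^kF^2(H_{n_i})$, $P_{\mathcal M}=\sum_{s=1}^\infty\psi_s\psi_s^*$ with convergence in the strong operator topology, and $$\lim_{(q_1,\ldots,q_k)\in\mathbb Z_+^k}\frac1{n_1^{q_1}\cdots n_k^{q_k}}\sum_{\substack{\alpha_i\in\mathbb F_{n_i}^+,\ |\alpha_i|=q_i\\ i\in\{1,\ldots,k\}}}\ \sum_{s=1}^\infty\left\|\psi_s^*(e^1_{\alpha_1}\otimes\cdots\otimes e^k_{\alpha_k})\right\|^2=1.$$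
   Context: All Hilbert spaces are complex; $\mathbb N=\{1,2,\ldots\}$, $\mathbb Z_+=\{0,1,\ldots\}$. Fix $k\in\mathbb N$ and $\mathbf n=(n_1,\ldots,n_k)\in\mathbb N^k$. $F^2(H_{n_i})=\mathbb C1\oplus\bigoplus_{p\ge1}H_{n_i}^{\otimes p}$ is the full Fock space of an $n_i$-dimensional Hilbert space $H_{n_i}$ with orthonormal basis $e^i_1,\ldots,e^i_{n_i}$. $\mathbb F_{n_i}^+$ is the free unital semigroup on $n_i$ generators $g_1^i,\ldots,g_{n_i}^i$ with length $|\cdot|$; for $\alpha=g^i_{j_1}\cdots g^i_{j_p}$ put $e^i_\alpha=e^i_{j_1}\otimes\cdots\otimes e^i_{j_p}$, and $e^i_\alpha=1$ for the neutral element. Let $S_{i,j}e^i_\alpha=e^i_{g^i_j\alpha}$ and $\mathbf S_{i,j}=I\otimes\cdots\otimes S_{i,j}\otimes\cdots\otimes I$ ($S_{i,j}$ in position $i$) on $\bigotimes_{i=1}^kF^2(H_{n_i})$; $\mathbf S=(\mathbf S_1,\ldots,\mathbf S_k)$, $\mathbf S_i=(\mathbf S_{i,1},\ldots,\mathbf S_{i,n_i})$. Invariant subspaces of $\bigotimes_iF^2(H_{n_i})$ are closed subspaces invariant under every $\mathbf S_{i,j}$; $P_{\mathcal M}$ is the orthogonal projection onto $\mathcal M$; $\mathbf S|_{\mathcal M}$ and $P_{\mathcal M^\perp}\mathbf S|_{\mathcal M^\perp}$ are the tuples of restrictions, respectively compressions, of the $\mathbf S_{i,j}$. A multi-analytic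 operator (multiplier) is a bounded operator $\psi$ on $\bigotimes_iF^2(H_{n_i})$ with $\psi\mathbf S_{i,j}=\mathbf S_{i,j}\psi$ for all $i,j$. For $X_i=(X_{i,1},\ldots,X_{i,n_i})\in B(\mathcal H)^{n_i}$ let $\Phi_{X_i}(Y)=\sum_{j=1}^{n_i}X_{i,j}YX_{i,j}^*$. The regular polyball $\mathbf B_{\mathbf n}(\mathcal H)$ is the set of all $\mathbf X=(X_1,\ldots,X_k)$ with $X_i\in B(\mathcal H)^{n_i}$ such that every entry of $X_s$ commutes with every entry of $X_t$ whenever $s\ne t$ and $(id-\Phi_{X_1})^{p_1}\circ\cdots\circ(id-\Phi_{X_k})^{p_k}(I)\ge0$ for all $(p_1,\ldots,p_k)\in\{0,1\}^k$. Put $\mathbf\Delta_{\mathbf X}=(id-\Phi_{X_1})\circ\cdots\circ(id-\Phi_{X_k})$. With $\mathcal D_{\mathbf T}=\overline{\mathbf\Delta_{\mathbf T}(I)\mathcal H}$ and $T_{i,\alpha}=T_{i,j_1}\cdots T_{i,j_p}$ for $\alpha=g^i_{j_1}\cdots g^i_{j_p}$ ($T_{i,\alpha}=I$ for the neutral element), the Berezin kernel of $\mathbf T\in\mathbf B_{\mathbf n}(\mathcal H)$ is $\mathbf K_{\mathbf T}:\mathcal H\to\bigotimes_iF^2(H_{n_i})\otimes\mathcal D_{\mathbf T}$, $$\mathbf K_{\mathbf T}h=\sum_{\beta_i\in\mathbb F_{n_i}^+,\,i=1,\ldots,k}e^1_{\beta_1}\otimes\cdots\otimes e^k_{\beta_k}\otimes\mathbf\Delta_{\mathbf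 T}(I)^{1/2}T_{1,\beta_1}^*\cdots T_{k,\beta_k}^*h.$$ $P^{(i)}_q$ is the orthogonal projection of $F^2(H_{n_i})$ onto the span of all $e^i_\alpha$ with $|\alpha|=q$. For $\mathbf T$ with trace class $\mathbf\Delta_{\mathbf T}(I)$, $$\mathrm{curv}(\mathbf T):=\lim_{m\to\infty}\frac1{\binom{m+k}{k}}\sum_{\substack{q_1\ge0,\ldots,q_k\ge0\\ q_1+\cdots+q_k\le m}}\frac{\mathrm{trace}\left[\mathbf K_{\mathbf T}^*(P^{(1)}_{q_1}\otimes\cdots\otimes P^{(k)}_{q_k}\otimes I_{\mathcal D_{\mathbf T}})\mathbf K_{\mathbf T}\right]}{\mathrm{trace}\left[P^{(1)}_{q_1}\otimes\cdots\otimes P^{(k)}_{q_k}\right]}$$ (this limit exists); $P_{\mathcal M^\perp}\mathbf S|_{\mathcal M^\perp}$ always belongs to $\mathbf B_{\mathbf n}(\mathcal M^\perp)$ with finite rank defect. Limits over $\mathbb Z_+^k$ are limits of nets for the coordinatewise order. *)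

theory Defs
  imports "HOL-Analysis.Analysis"
begin

section \<open>Complex Hilbert spaces\<close>

text \<open>The inner product \<open>cinner\<close> is linear in the first and conjugate linear in the second argument;
  its real part is the real inner product.\<close>

class complex_hilbert = real_inner + complete_space +
  fixes scaleC :: "complex \<Rightarrow> 'a \<Rightarrow> 'a" (infixr \<open>*\<^sub>C\<close> 75)
    and cinner :: "'a \<Rightarrow> 'a \<Rightarrow> complex"
  assumes scaleC_add_right: "c *\<^sub>C (x + y) = c *\<^sub>C x + c *\<^sub>C y"
    and scaleC_add_left: "(c + d) *\<^sub>C x = c *\<^sub>C x + d *\<^sub>C x"
    and scaleC_scaleC: "c *\<^sub>C d *\<^sub>C x = (c * d) *\<^sub>C x"
    and scaleC_of_real: "complex_of_real r *\<^sub>C x = r *\<^sub>R x"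
    and cinner_commute: "cinner x y = cnj (cinner y x)"
    and cinner_add_left: "cinner (x + y) z = cinner x z + cinner y z"
    and cinner_scaleC_left: "cinner (c *\<^sub>C x) y = c * cinner x y"
    and Re_cinner: "Re (cinner x y) = inner x y"

instantiation complex :: complex_hilbert
begin
definition scaleC_complex :: "complex \<Rightarrow> complex \<Rightarrow> complex" where
  "scaleC_complex c x = c * x"
definition cinner_complex :: "complex \<Rightarrow> complex \<Rightarrow> complex" where
  "cinner_complex x y = x * cnj y"
instance
  by standard (auto simp: scaleC_complex_def cinner_complex_def algebra_simps inner_complex_def
      scaleR_conv_of_real)
end

lemma cinner_add_right: "cinner x (y + z) = cinner x y + cinner x z"
  by (metis cinner_add_left cinner_commute complex_cnj_add)

lemma cinner_scaleC_right: "cinner x (c *\<^sub>C y) = cnj c * cinner x y"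
  by (metis cinner_commute cinner_scaleC_left complex_cnj_mult)

lemma cinner_zero_left [simp]: "cinner 0 x = 0"
  using cinner_add_left [of 0 0 x] by simp

lemma cinner_zero_right [simp]: "cinner x 0 = 0"
  using cinner_add_right [of x 0 0] by simp

lemma cinner_same: "cinner x x = complex_of_real ((norm x)\<^sup>2)"
proof -
  have "Im (cinner x x) = 0"
    using arg_cong[OF cinner_commute[of x x], of Im] by simp
  then show ?thesis
    by (simp add: complex_eq_iff Re_cinner power2_norm_eq_inner)
qed

lemma norm_scaleC: "norm (c *\<^sub>C (x :: 'a :: complex_hilbert)) = cmod c * norm x"
proof -
  have "complex_of_real ((norm (c *\<^sub>C x))\<^sup>2) = (c * cnj c) * cinner x x"
    unfolding cinner_same[symmetric] by (simp add: cinner_scaleC_left cinner_scaleC_right)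
  also have "\<dots> = complex_of_real ((cmod c * norm x)\<^sup>2)"
    unfolding cinner_same complex_norm_square[symmetric] power_mult_distrib of_real_mult ..
  finally have "complex_of_real ((norm (c *\<^sub>C x))\<^sup>2) = complex_of_real ((cmod c * norm x)\<^sup>2)" .
  then have "(norm (c *\<^sub>C x))\<^sup>2 = (cmod c * norm x)\<^sup>2"
    using of_real_eq_iff by blast
  then show ?thesis by simp
qed

lemma norm_cinner_le: "cmod (cinner x y) \<le> norm x * norm (y :: 'a :: complex_hilbert)"
proof (cases "cinner x y = 0")
  case False
  define c where "c = cnj (cinner x y) / cmod (cinner x y)"
  have c: "cmod c = 1" using False by (simp add: c_def norm_divide)
  have "cinner (c *\<^sub>C x) y = cmod (cinner x y)"
    using False by (simp add: c_def cinner_scaleC_left field_simps flip: complex_norm_square power2_eq_square)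
  then have "cmod (cinner x y) = inner (c *\<^sub>C x) y"
    using Re_cinner[of "c *\<^sub>C x" y] by simp
  also have "\<dots> \<le> norm (c *\<^sub>C x) * norm y" by (rule norm_cauchy_schwarz)
  finally show ?thesis using c by (simp add: norm_scaleC)
qed simp


section \<open>Hilbert sums\<close>

text \<open>\<open>('i, 'h) hsum\<close> is the Hilbert space direct sum of copies of \<open>'h\<close> indexed by \<open>'i\<close>, that is,
  the Hilbert space tensor product of \<open>\<ell>\<^sup>2('i)\<close> and \<open>'h\<close>; in particular \<open>('i, complex) hsum\<close> is
  \<open>\<ell>\<^sup>2('i)\<close>.\<close>

typedef (overloaded) ('i, 'h :: complex_hilbert) hsum =
  "{f :: 'i \<Rightarrow> 'h. (\<lambda>i. (norm (f i))\<^sup>2) summable_on UNIV}"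
  morphisms coord Abs_hsum
  by (rule exI[of _ "\<lambda>_. 0"]) simp

setup_lifting type_definition_hsum

lemma hsum_eqI: "(\<And>i. coord x i = coord y i) \<Longrightarrow> x = y"
  by (metis coord_inject ext)

lemma summable_coord: "(\<lambda>i. (norm (coord x i))\<^sup>2) summable_on UNIV"
  using coord[of x] by simp

lemma sq_summable_add:
  fixes f g :: "'i \<Rightarrow> 'h :: real_normed_vector"
  assumes "(\<lambda>i. (norm (f i))\<^sup>2) summable_on A" "(\<lambda>i. (norm (g i))\<^sup>2) summable_on A"
  shows "(\<lambda>i. (norm (f i + g i))\<^sup>2) summable_on A"
proof (rule summable_on_comparison_test)
  show "(\<lambda>i. 2 * (norm (f i))\<^sup>2 + 2 * (norm (g i))\<^sup>2) summable_on A"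
    by (intro summable_on_add summable_on_cmult_right assms)
  fix i
  have "(norm (f i + g i))\<^sup>2 \<le> (norm (f i) + norm (g i))\<^sup>2"
    by (simp add: norm_triangle_ineq power_mono)
  also have "\<dots> \<le> 2 * (norm (f i))\<^sup>2 + 2 * (norm (g i))\<^sup>2"
    using sum_squares_bound[of "norm (f i)" "norm (g i)"] by (simp add: power2_sum)
  finally show "(norm (f i + g i))\<^sup>2 \<le> 2 * (norm (f i))\<^sup>2 + 2 * (norm (g i))\<^sup>2" .
qed simp

lemma sq_summable_prod:
  fixes f g :: "'i \<Rightarrow> 'h :: real_normed_vector"
  assumes "(\<lambda>i. (norm (f i))\<^sup>2) summable_on A" "(\<lambda>i. (norm (g i))\<^sup>2) summable_on A"
  shows "(\<lambda>i. norm (f i) * norm (g i)) summable_on A"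
proof (rule summable_on_comparison_test)
  show "(\<lambda>i. (norm (f i))\<^sup>2 + (norm (g i))\<^sup>2) summable_on A"
    by (intro summable_on_add assms)
  fix i
  have "0 \<le> norm (f i) * norm (g i)" by simp
  then show "norm (f i) * norm (g i) \<le> (norm (f i))\<^sup>2 + (norm (g i))\<^sup>2"
    using sum_squares_bound[of "norm (f i)" "norm (g i)"] by linarith
qed simp

lemma summable_cinner_coord: "(\<lambda>i. cinner (coord x i) (coord y i)) summable_on UNIV"
proof (rule abs_summable_summable, rule summable_on_comparison_test)
  show "(\<lambda>i. norm (coord x i) * norm (coord y i)) summable_on UNIV"
    by (rule sq_summable_prod[OF summable_coord summable_coord])
  show "norm (cinner (coord x i) (coord y i)) \<le> norm (coord x i) * norm (coord y i)" for i
    by (rule norm_cinner_le)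
qed (rule norm_ge_zero)

lemma summable_inner_coord: "(\<lambda>i. inner (coord x i) (coord y i)) summable_on UNIV"
  using summable_on_Re[OF summable_cinner_coord[of x y]] by (simp add: Re_cinner)

instantiation hsum :: (type, complex_hilbert) real_inner
begin

lift_definition zero_hsum :: "('a, 'b) hsum" is "\<lambda>_. 0" by simp
lift_definition plus_hsum :: "('a, 'b) hsum \<Rightarrow> ('a, 'b) hsum \<Rightarrow> ('a, 'b) hsum"
  is "\<lambda>f g i. f i + g i" by (rule sq_summable_add)
lift_definition uminus_hsum :: "('a, 'b) hsum \<Rightarrow> ('a, 'b) hsum"
  is "\<lambda>f i. - f i" by simp
lift_definition minus_hsum :: "('a, 'b) hsum \<Rightarrow> ('a, 'b) hsum \<Rightarrow> ('a, 'b) hsum"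
  is "\<lambda>f g i. f i - g i" 
  subgoal for f g using sq_summable_add[of f UNIV "\<lambda>i. - g i"] by simp
  done
lift_definition scaleR_hsum :: "real \<Rightarrow> ('a, 'b) hsum \<Rightarrow> ('a, 'b) hsum"
  is "\<lambda>r f i. r *\<^sub>R f i"
  by (simp add: power_mult_distrib summable_on_cmult_right)

definition inner_hsum :: "('a, 'b) hsum \<Rightarrow> ('a, 'b) hsum \<Rightarrow> real" where
  "inner_hsum x y = (\<Sum>\<^sub>\<infinity>i. inner (coord x i) (coord y i))"
definition norm_hsum :: "('a, 'b) hsum \<Rightarrow> real" where
  "norm_hsum x = sqrt (inner x x)"
definition dist_hsum :: "('a, 'b) hsum \<Rightarrow> ('a, 'b) hsum \<Rightarrow> real" where
  "dist_hsum x y = norm (x - y)"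
definition sgn_hsum :: "('a, 'b) hsum \<Rightarrow> ('a, 'b) hsum" where
  "sgn_hsum x = inverse (norm x) *\<^sub>R x"
definition uniformity_hsum :: "(('a, 'b) hsum \<times> ('a, 'b) hsum) filter" where
  "uniformity_hsum = (INF e\<in>{0 <..}. principal {(x, y). dist x y < e})"
definition open_hsum :: "('a, 'b) hsum set \<Rightarrow> bool" where
  "open_hsum U \<longleftrightarrow> (\<forall>x\<in>U. \<forall>\<^sub>F (x', y) in uniformity. x' = x \<longrightarrow> y \<in> U)"

instance
proof
  fix x y z :: "('a, 'b) hsum" and r s :: real and U :: "('a, 'b) hsum set"
  show "x + y + z = x + (y + z)" by transfer (simp add: add.assoc)
  show "x + y = y + x" by transfer (simp add: add.commute)
  show "0 + x = x" by transfer simp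
  show "- x + x = 0" by transfer simp
  show "x - y = x + - y" by transfer simp
  show "r *\<^sub>R (x + y) = r *\<^sub>R x + r *\<^sub>R y" by transfer (simp add: scaleR_add_right)
  show "(r + s) *\<^sub>R x = r *\<^sub>R x + s *\<^sub>R x" by transfer (simp add: scaleR_add_left)
  show "r *\<^sub>R s *\<^sub>R x = (r * s) *\<^sub>R x" by transfer simp
  show "1 *\<^sub>R x = x" by transfer simp
  show "sgn x = inverse (norm x) *\<^sub>R x" by (rule sgn_hsum_def)
  show "dist x y = norm (x - y)" by (rule dist_hsum_def)
  show "uniformity = (INF e\<in>{0 <..}. principal {(x, y :: ('a, 'b) hsum). dist x y < e})"
    by (rule uniformity_hsum_def)
  show "open U \<longleftrightarrow> (\<forall>x\<in>U. \<forall>\<^sub>F (x', y) in uniformity. x' = x \<longrightarrow> y \<in> U)"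
    by (rule open_hsum_def)
  show "inner x y = inner y x" by (simp add: inner_hsum_def inner_commute)
  show "inner (x + y) z = inner x z + inner y z"
    by (simp add: inner_hsum_def plus_hsum.rep_eq inner_add_left infsum_add summable_inner_coord)
  show "inner (r *\<^sub>R x) y = r * inner x y"
    by (simp add: inner_hsum_def scaleR_hsum.rep_eq infsum_cmult_right')
  show "0 \<le> inner x x" by (simp add: inner_hsum_def infsum_nonneg)
  show "inner x x = 0 \<longleftrightarrow> x = 0"
  proof
    assume "inner x x = 0"
    then have "inner (coord x i) (coord x i) = 0" for i
      using nonneg_infsum_le_0D[OF _ summable_inner_coord[of x x], of i] by (simp add: inner_hsum_def)
    then show "x = 0" by (intro hsum_eqI) (simp add: zero_hsum.rep_eq)
  qed (simp add: inner_hsum_def zero_hsum.rep_eq)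
  show "norm x = sqrt (inner x x)" by (rule norm_hsum_def)
qed

end

lemma norm_hsum_sq: "(norm x)\<^sup>2 = (\<Sum>\<^sub>\<infinity>i. (norm (coord x i))\<^sup>2)"
  by (simp add: power2_norm_eq_inner inner_hsum_def)

lemma sum_coord_le_norm: "finite A \<Longrightarrow> (\<Sum>i\<in>A. (norm (coord x i))\<^sup>2) \<le> (norm x)\<^sup>2"
  unfolding norm_hsum_sq by (rule finite_sum_le_infsum) (auto simp: summable_coord)

lemma norm_coord_le: "norm (coord x i) \<le> norm x"
  using sum_coord_le_norm[of "{i}" x] by simp

instance hsum :: (type, complex_hilbert) complete_space
proof
  fix X :: "nat \<Rightarrow> ('a, 'b) hsum"
  assume X: "Cauchy X"
  have "Cauchy (\<lambda>n. coord (X n) i)" for i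
    unfolding Cauchy_def
  proof (intro allI impI)
    fix e :: real assume "e > 0"
    then obtain N where N: "\<forall>m\<ge>N. \<forall>n\<ge>N. dist (X m) (X n) < e"
      using X unfolding Cauchy_def by blast
    have "dist (coord (X m) i) (coord (X n) i) \<le> dist (X m) (X n)" for m n
      using norm_coord_le[of "X m - X n" i] by (simp add: dist_norm minus_hsum.rep_eq)
    then show "\<exists>M. \<forall>m\<ge>M. \<forall>n\<ge>M. dist (coord (X m) i) (coord (X n) i) < e"
      using N by (meson order_le_less_trans)
  qed
  then have "\<exists>l. (\<lambda>n. coord (X n) i) \<longlonglongrightarrow> l" for i
    by (simp add: Cauchy_convergent convergentD)
  then obtain f where f: "\<And>i. (\<lambda>n. coord (X n) i) \<longlonglongrightarrow> f i" by metis
  have fin: "(\<Sum>i\<in>A. (norm (coord (X m) i - f i))\<^sup>2) \<le> e\<^sup>2"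
    if N: "\<forall>m\<ge>N. \<forall>n\<ge>N. dist (X m) (X n) < e" and m: "m \<ge> N" and A: "finite A" for N e m A
  proof (rule LIMSEQ_le_const2)
    show "(\<lambda>n. \<Sum>i\<in>A. (norm (coord (X m) i - coord (X n) i))\<^sup>2)
        \<longlonglongrightarrow> (\<Sum>i\<in>A. (norm (coord (X m) i - f i))\<^sup>2)"
      by (intro tendsto_intros f)
    have "(\<Sum>i\<in>A. (norm (coord (X m) i - coord (X n) i))\<^sup>2) \<le> e\<^sup>2" if "n \<ge> N" for n
    proof -
      have "(\<Sum>i\<in>A. (norm (coord (X m) i - coord (X n) i))\<^sup>2) \<le> (norm (X m - X n))\<^sup>2"
        using sum_coord_le_norm[OF A, of "X m - X n"] by (simp add: minus_hsum.rep_eq)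
      also have "\<dots> \<le> e\<^sup>2"
        using N m that by (intro power_mono) (auto simp: dist_norm intro: less_imp_le)
      finally show ?thesis .
    qed
    then show "\<exists>N. \<forall>n\<ge>N. (\<Sum>i\<in>A. (norm (coord (X m) i - coord (X n) i))\<^sup>2) \<le> e\<^sup>2" by blast
  qed
  have summ: "(\<lambda>i. (norm (coord (X m) i - f i))\<^sup>2) summable_on UNIV"
    if N: "\<forall>m\<ge>N. \<forall>n\<ge>N. dist (X m) (X n) < e" and m: "m \<ge> N" for N e m
    by (rule nonneg_bdd_above_summable_on) (use fin[OF N m] in \<open>auto intro!: bdd_aboveI2\<close>)
  obtain N1 where N1: "\<forall>m\<ge>N1. \<forall>n\<ge>N1. dist (X m) (X n) < 1"
    using X unfolding Cauchy_def by (meson zero_less_one)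
  have "(\<lambda>i. (norm (coord (X N1) i + - (coord (X N1) i - f i)))\<^sup>2) summable_on UNIV"
    by (rule sq_summable_add[OF summable_coord])
      (use summ[OF N1 order_refl] in \<open>simp add: norm_minus_commute\<close>)
  then have f': "(\<lambda>i. (norm (f i))\<^sup>2) summable_on UNIV" by simp
  define L where "L = Abs_hsum f"
  have L: "coord L = f" using f' by (simp add: L_def Abs_hsum_inverse)
  have "X \<longlonglongrightarrow> L"
  proof (rule metric_LIMSEQ_I)
    fix e :: real assume "e > 0"
    then obtain N where N: "\<forall>m\<ge>N. \<forall>n\<ge>N. dist (X m) (X n) < e / 2"
      using X unfolding Cauchy_def by (meson half_gt_zero)
    have "dist (X m) L < e" if "m \<ge> N" for m
    proof -
      have "(norm (X m - L))\<^sup>2 \<le> (e / 2)\<^sup>2"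
        unfolding norm_hsum_sq minus_hsum.rep_eq L
        by (rule infsum_le_finite_sums[OF summ[OF N that] fin[OF N that]])
      then have "norm (X m - L) \<le> e / 2"
        by (rule power2_le_imp_le) (use \<open>e > 0\<close> in simp)
      then show ?thesis using \<open>e > 0\<close> by (simp add: dist_norm)
    qed
    then show "\<exists>N. \<forall>n\<ge>N. dist (X n) L < e" by blast
  qed
  then show "convergent X" by (auto simp: convergent_def)
qed

instantiation hsum :: (type, complex_hilbert) complex_hilbert
begin

lift_definition scaleC_hsum :: "complex \<Rightarrow> ('a, 'b) hsum \<Rightarrow> ('a, 'b) hsum"
  is "\<lambda>c f i. c *\<^sub>C f i"
  by (simp add: norm_scaleC power_mult_distrib summable_on_cmult_right)

definition cinner_hsum :: "('a, 'b) hsum \<Rightarrow> ('a, 'b) hsum \<Rightarrow> complex" where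
  "cinner_hsum x y = (\<Sum>\<^sub>\<infinity>i. cinner (coord x i) (coord y i))"

instance
proof
  fix x y z :: "('a, 'b) hsum" and c d :: complex and r :: real
  show "c *\<^sub>C (x + y) = c *\<^sub>C x + c *\<^sub>C y" by transfer (simp add: scaleC_add_right)
  show "(c + d) *\<^sub>C x = c *\<^sub>C x + d *\<^sub>C x" by transfer (simp add: scaleC_add_left)
  show "c *\<^sub>C d *\<^sub>C x = (c * d) *\<^sub>C x" by transfer (simp add: scaleC_scaleC)
  show "complex_of_real r *\<^sub>C x = r *\<^sub>R x" by transfer (simp add: scaleC_of_real)
  show "cinner x y = cnj (cinner y x)"
    unfolding cinner_hsum_def infsum_cnj[symmetric] by (rule infsum_cong) (rule cinner_commute)
  show "cinner (x + y) z = cinner x z + cinner y z"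
    by (simp add: cinner_hsum_def plus_hsum.rep_eq cinner_add_left infsum_add summable_cinner_coord)
  show "cinner (c *\<^sub>C x) y = c * cinner x y"
    by (simp add: cinner_hsum_def scaleC_hsum.rep_eq cinner_scaleC_left infsum_cmult_right')
  show "Re (cinner x y) = inner x y"
    by (simp add: cinner_hsum_def inner_hsum_def Re_cinner summable_cinner_coord flip: infsum_Re)
qed

end

text \<open>\<open>single i v\<close> is \<open>e\<^sub>i \<otimes> v\<close>, where \<open>e\<^sub>i\<close> is the \<open>i\<close>-th unit vector of \<open>\<ell>\<^sup>2('i)\<close>.\<close>

lift_definition single :: "'i \<Rightarrow> 'h :: complex_hilbert \<Rightarrow> ('i, 'h) hsum"
  is "\<lambda>i v j. if j = i then v else 0"
proof -
  fix i :: 'i and v :: 'h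
  have "(\<lambda>j. (norm v)\<^sup>2) summable_on {i}" by simp
  then show "(\<lambda>j. (norm (if j = i then v else 0))\<^sup>2) summable_on UNIV"
    by (rule summable_on_cong_neutral[THEN iffD1, rotated 3]) auto
qed

lemma norm_single: "norm (single i v) = norm v"
proof -
  have "(norm (single i v))\<^sup>2 = (\<Sum>\<^sub>\<infinity>j\<in>{i}. (norm v)\<^sup>2)"
    unfolding norm_hsum_sq by (rule infsum_cong_neutral) (auto simp: single.rep_eq)
  then show ?thesis by simp
qed


section \<open>Operators on closed subspaces\<close>

text \<open>A Hilbert space is a closed subspace \<open>H\<close> of a type of class \<open>complex_hilbert\<close>, and an
  operator \<open>H \<rightarrow> K\<close> is a function on the ambient type of which only the values on \<open>H\<close> matter.\<close>

definition closed_csubspace :: "'h :: complex_hilbert set \<Rightarrow> bool" where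
  "closed_csubspace H \<longleftrightarrow> 0 \<in> H \<and> (\<forall>x\<in>H. \<forall>y\<in>H. x + y \<in> H) \<and> (\<forall>c. \<forall>x\<in>H. c *\<^sub>C x \<in> H) \<and> closed H"

definition bounded_op ::
  "'h :: complex_hilbert set \<Rightarrow> 'k :: complex_hilbert set \<Rightarrow> ('h \<Rightarrow> 'k) \<Rightarrow> bool" where
  "bounded_op H K A \<longleftrightarrow>
     (\<forall>x\<in>H. A x \<in> K) \<and>
     (\<forall>x\<in>H. \<forall>y\<in>H. A (x + y) = A x + A y) \<and>
     (\<forall>c. \<forall>x\<in>H. A (c *\<^sub>C x) = c *\<^sub>C A x) \<and>
     (\<exists>B. \<forall>x\<in>H. norm (A x) \<le> B * norm x)"

text \<open>The adjoint \<open>K \<rightarrow> H\<close> of \<open>A : H \<rightarrow> K\<close>; it does not depend on \<open>K\<close>.\<close>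

definition adj :: "'h :: complex_hilbert set \<Rightarrow> ('h \<Rightarrow> 'k :: complex_hilbert) \<Rightarrow> 'k \<Rightarrow> 'h" where
  "adj H A y = (THE x. x \<in> H \<and> (\<forall>z\<in>H. cinner (A z) y = cinner z x))"

definition positive_op :: "'h :: complex_hilbert set \<Rightarrow> ('h \<Rightarrow> 'h) \<Rightarrow> bool" where
  "positive_op H A \<longleftrightarrow> bounded_op H H A \<and>
     (\<forall>x\<in>H. Im (cinner (A x) x) = 0 \<and> 0 \<le> Re (cinner (A x) x))"

text \<open>The positive square root of a positive operator, normalized to vanish off \<open>H\<close> in order to be
  unique as a function.\<close>

definition sqrt_op :: "'h :: complex_hilbert set \<Rightarrow> ('h \<Rightarrow> 'h) \<Rightarrow> 'h \<Rightarrow> 'h" where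
  "sqrt_op H A = (THE B. positive_op H B \<and> (\<forall>x\<in>H. B (B x) = A x) \<and> (\<forall>x. x \<notin> H \<longrightarrow> B x = 0))"

definition proj :: "'h :: complex_hilbert set \<Rightarrow> 'h \<Rightarrow> 'h" where
  "proj H x = (THE y. y \<in> H \<and> (\<forall>z\<in>H. cinner (x - y) z = 0))"

definition ortho_compl :: "'h :: complex_hilbert set \<Rightarrow> 'h set \<Rightarrow> 'h set" where
  "ortho_compl H M = {x\<in>H. \<forall>y\<in>M. cinner x y = 0}"

definition orthonormal_basis :: "'h :: complex_hilbert set \<Rightarrow> 'h set \<Rightarrow> bool" where
  "orthonormal_basis H B \<longleftrightarrow> B \<subseteq> H \<and>
     (\<forall>e\<in>B. \<forall>f\<in>B. cinner e f = (if e = f then 1 else 0)) \<and>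
     (\<forall>x\<in>H. (\<forall>e\<in>B. cinner x e = 0) \<longrightarrow> x = 0)"

text \<open>The trace of a trace class operator, which does not depend on the orthonormal basis.\<close>

definition trace_op :: "'h :: complex_hilbert set \<Rightarrow> ('h \<Rightarrow> 'h) \<Rightarrow> complex" where
  "trace_op H A = (\<Sum>\<^sub>\<infinity>e\<in>(SOME B. orthonormal_basis H B). cinner (A e) e)"


section \<open>Tensor products of full Fock spaces\<close>

text \<open>Throughout, \<open>(n\<^sub>1, \<dots>, n\<^sub>k)\<close> is a list \<open>ns\<close> of length \<open>k\<close>, and the indices \<open>i\<close> and \<open>j\<close> start at \<open>0\<close>.
  A word in the free semigroup on \<open>n\<^sub>i\<close> generators is a list of numbers below \<open>n\<^sub>i\<close>.\<close>

definition multiwords :: "nat list \<Rightarrow> nat list list set" where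
  "multiwords ns = {\<alpha>. list_all2 (\<lambda>w n. set w \<subseteq> {..<n}) \<alpha> ns}"

text \<open>The Hilbert space tensor product of the full Fock spaces \<open>F\<^sup>2(H\<^bsub>n\<^sub>i\<^esub>)\<close>, realized with respect to its
  orthonormal basis: \<open>e\<^bsub>\<alpha>\<^sub>1\<^esub> \<otimes> \<dots> \<otimes> e\<^bsub>\<alpha>\<^sub>k\<^esub>\<close> is the unit vector \<open>basis_vec \<alpha>\<close> of \<open>\<ell>\<^sup>2\<close>. Likewise
  \<open>e\<^bsub>\<alpha>\<^sub>1\<^esub> \<otimes> \<dots> \<otimes> e\<^bsub>\<alpha>\<^sub>k\<^esub> \<otimes> v\<close> with \<open>v\<close> in another Hilbert space is \<open>single \<alpha> v\<close>.\<close>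

definition fock :: "nat list \<Rightarrow> (nat list list, complex) hsum set" where
  "fock ns = {x. \<forall>\<alpha>. \<alpha> \<notin> multiwords ns \<longrightarrow> coord x \<alpha> = 0}"

abbreviation basis_vec :: "nat list list \<Rightarrow> (nat list list, complex) hsum" where
  "basis_vec \<alpha> \<equiv> single \<alpha> 1"

text \<open>The operator \<open>\<^bold>S\<^bsub>i,j\<^esub>\<close>: see \<open>shift_single\<close> below for its values on the basis.\<close>

lift_definition shift ::
  "nat \<Rightarrow> nat \<Rightarrow> (nat list list, 'h :: complex_hilbert) hsum \<Rightarrow> (nat list list, 'h) hsum"
  is "\<lambda>i j f \<alpha>. if i < length \<alpha> \<and> \<alpha> ! i \<noteq> [] \<and> hd (\<alpha> ! i) = j then f (\<alpha>[i := tl (\<alpha> ! i)]) else 0"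
proof -
  fix i j and f :: "nat list list \<Rightarrow> 'h"
  assume f: "(\<lambda>\<alpha>. (norm (f \<alpha>))\<^sup>2) summable_on UNIV"
  let ?A = "{\<alpha> :: nat list list. i < length \<alpha> \<and> \<alpha> ! i \<noteq> [] \<and> hd (\<alpha> ! i) = j}"
  let ?g = "\<lambda>\<alpha>. \<alpha>[i := tl (\<alpha> ! i)]"
  have "inj_on ?g ?A"
    by (rule inj_on_inverseI[where g = "\<lambda>\<beta>. \<beta>[i := j # \<beta> ! i]"]) auto
  moreover have "(\<lambda>\<alpha>. (norm (f \<alpha>))\<^sup>2) summable_on ?g ` ?A"
    using f by (rule summable_on_subset_banach) simp
  ultimately have "(\<lambda>\<alpha>. (norm (f (?g \<alpha>)))\<^sup>2) summable_on ?A"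
    by (simp add: summable_on_reindex o_def)
  then show "(\<lambda>\<alpha>. (norm (if i < length \<alpha> \<and> \<alpha> ! i \<noteq> [] \<and> hd (\<alpha> ! i) = j
      then f (?g \<alpha>) else 0))\<^sup>2) summable_on UNIV"
    by (rule summable_on_cong_neutral[THEN iffD1, rotated 3]) auto
qed

lemma shift_single:
  "shift i j (single \<alpha> v) = (if i < length \<alpha> then single (\<alpha>[i := j # \<alpha> ! i]) v else 0)"
proof (rule hsum_eqI)
  fix \<beta>
  have "i < length \<beta> \<and> \<beta> ! i \<noteq> [] \<and> hd (\<beta> ! i) = j \<and> \<beta>[i := tl (\<beta> ! i)] = \<alpha> \<longleftrightarrow>
      i < length \<alpha> \<and> \<beta> = \<alpha>[i := j # \<alpha> ! i]"
    by (metis hd_Cons_tl length_list_update list.distinct(1) list.sel(1,3) list_update_id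
        list_update_overwrite nth_list_update_eq)
  then show "coord (shift i j (single \<alpha> v)) \<beta> =
      coord (if i < length \<alpha> then single (\<alpha>[i := j # \<alpha> ! i]) v else 0) \<beta>"
    by (auto simp: shift.rep_eq single.rep_eq zero_hsum.rep_eq)
qed

text \<open>\<open>P\<^sub>q\<^sub>1 \<otimes> \<dots> \<otimes> P\<^sub>q\<^sub>k \<otimes> I\<close>, where \<open>q = [q\<^sub>1, \<dots>, q\<^sub>k]\<close>\<close>

lift_definition degree_proj ::
  "nat list \<Rightarrow> (nat list list, 'h :: complex_hilbert) hsum \<Rightarrow> (nat list list, 'h) hsum"
  is "\<lambda>q f \<alpha>. if map length \<alpha> = q then f \<alpha> else 0"
proof -
  fix q and f :: "nat list list \<Rightarrow> 'h"
  assume "(\<lambda>\<alpha>. (norm (f \<alpha>))\<^sup>2) summable_on UNIV"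
  then show "(\<lambda>\<alpha>. (norm (if map length \<alpha> = q then f \<alpha> else 0))\<^sup>2) summable_on UNIV"
    by (rule summable_on_comparison_test) simp_all
qed


section \<open>Regular polyballs and curvature\<close>

text \<open>Tuples \<open>(X\<^sub>1, \<dots>, X\<^sub>k)\<close> are functions \<open>X\<close> of which only the entries \<open>X i j\<close> with \<open>i < k\<close> and
  \<open>j < n\<^sub>i\<close> matter.\<close>

definition Phi :: "'h :: complex_hilbert set \<Rightarrow> nat \<Rightarrow> (nat \<Rightarrow> 'h \<Rightarrow> 'h) \<Rightarrow> ('h \<Rightarrow> 'h) \<Rightarrow> 'h \<Rightarrow> 'h" where
  "Phi H n Xi Y h = (\<Sum>j<n. Xi j (Y (adj H (Xi j) h)))"

text \<open>\<open>(id - \<Phi>\<^bsub>X\<^sub>1\<^esub>)\<^bsup>p\<^sub>1\<^esup> \<circ> \<dots> \<circ> (id - \<Phi>\<^bsub>X\<^sub>k\<^esub>)\<^bsup>p\<^sub>k\<^esup>\<close>\<close>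

definition Defect ::
  "'h :: complex_hilbert set \<Rightarrow> nat list \<Rightarrow> (nat \<Rightarrow> nat \<Rightarrow> 'h \<Rightarrow> 'h) \<Rightarrow> (nat \<Rightarrow> nat) \<Rightarrow> ('h \<Rightarrow> 'h) \<Rightarrow> 'h \<Rightarrow> 'h" where
  "Defect H ns X p =
     foldr (\<lambda>i. (\<lambda>Y h. Y h - Phi H (ns ! i) (X i) Y h) ^^ p i) [0..<length ns]"

definition polyball :: "nat list \<Rightarrow> 'h :: complex_hilbert set \<Rightarrow> (nat \<Rightarrow> nat \<Rightarrow> 'h \<Rightarrow> 'h) set" where
  "polyball ns H = {X.
     (\<forall>i<length ns. \<forall>j<ns ! i. bounded_op H H (X i j)) \<and>
     (\<forall>s<length ns. \<forall>t<length ns. s \<noteq> t \<longrightarrow>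
        (\<forall>a<ns ! s. \<forall>b<ns ! t. \<forall>h\<in>H. X s a (X t b h) = X t b (X s a h))) \<and>
     (\<forall>p. (\<forall>i<length ns. p i \<in> {0, 1}) \<longrightarrow> positive_op H (Defect H ns X p (\<lambda>h. h)))}"

definition Delta :: "'h :: complex_hilbert set \<Rightarrow> nat list \<Rightarrow> (nat \<Rightarrow> nat \<Rightarrow> 'h \<Rightarrow> 'h) \<Rightarrow> 'h \<Rightarrow> 'h" where
  "Delta H ns X = Defect H ns X (\<lambda>_. 1) (\<lambda>h. h)"

definition word_op :: "(nat \<Rightarrow> 'h \<Rightarrow> 'h) \<Rightarrow> nat list \<Rightarrow> 'h \<Rightarrow> 'h" where
  "word_op Ti w = foldr Ti w"

text \<open>The values lie in the tensor product of the Fock spaces with the closure of the range of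
  \<open>Delta H ns T\<close>, a closed subspace of the type \<open>(nat list list, 'h) hsum\<close>. The codomain need not
  be specified further, since the adjoint in the definition of \<open>curv\<close> does not depend on it.\<close>

definition berezin_kernel ::
  "'h :: complex_hilbert set \<Rightarrow> nat list \<Rightarrow> (nat \<Rightarrow> nat \<Rightarrow> 'h \<Rightarrow> 'h) \<Rightarrow> 'h \<Rightarrow> (nat list list, 'h) hsum" where
  "berezin_kernel H ns T h =
     (\<Sum>\<^sub>\<infinity>\<beta>\<in>multiwords ns. single \<beta>
        (sqrt_op H (Delta H ns T)
          (foldr (\<lambda>i. adj H (word_op (T i) (\<beta> ! i))) [0..<length ns] h)))"

text \<open>The limit exists if \<open>T\<close> is in the polyball and \<open>Delta H ns T\<close> is of trace class.\<close>

definition curv :: "'h :: complex_hilbert set \<Rightarrow> nat list \<Rightarrow> (nat \<Rightarrow> nat \<Rightarrow> 'h \<Rightarrow> 'h) \<Rightarrow> complex" where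
  "curv H ns T = lim (\<lambda>m.
     1 / of_nat ((m + length ns) choose length ns) *
     (\<Sum>q | length q = length ns \<and> sum_list q \<le> m.
        trace_op H (\<lambda>h. adj H (berezin_kernel H ns T) (degree_proj q (berezin_kernel H ns T h)))
        / trace_op (fock ns) (degree_proj q)))"


section \<open>Invariant subspaces and inner sequences\<close>

definition invariant_subspace :: "nat list \<Rightarrow> (nat list list, complex) hsum set \<Rightarrow> bool" where
  "invariant_subspace ns M \<longleftrightarrow> closed_csubspace M \<and> M \<subseteq> fock ns \<and>
     (\<forall>i<length ns. \<forall>j<ns ! i. \<forall>x\<in>M. shift i j x \<in> M)"

definition multi_analytic ::
  "nat list \<Rightarrow> ((nat list list, complex) hsum \<Rightarrow> (nat list list, complex) hsum) \<Rightarrow> bool" where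
  "multi_analytic ns \<psi> \<longleftrightarrow> bounded_op (fock ns) (fock ns) \<psi> \<and>
     (\<forall>i<length ns. \<forall>j<ns ! i. \<forall>x\<in>fock ns. \<psi> (shift i j x) = shift i j (\<psi> x))"

text \<open>The tails of \<open>\<int>\<^sub>+\<^sup>k\<close> with the coordinatewise order, with elements represented by lists of length \<open>k\<close>\<close>

definition multi_at_top :: "nat \<Rightarrow> nat list filter" where
  "multi_at_top k = (INF Q\<in>{Q. length Q = k}. principal {q. list_all2 (\<le>) Q q})"

lemma eventually_multi_at_top:
  "eventually P (multi_at_top k) \<longleftrightarrow> (\<exists>Q. length Q = k \<and> (\<forall>q. list_all2 (\<le>) Q q \<longrightarrow> P q))"
proof -
  have "\<exists>R\<in>{Q. length Q = k}. principal {q. list_all2 (\<le>) R q}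
      \<le> inf (principal {q. list_all2 (\<le>) P q}) (principal {q. list_all2 (\<le>) Q q})"
    if "length P = k" "length Q = k" for P Q :: "nat list"
    by (rule bexI[of _ "map2 max P Q"]) (use that in \<open>auto simp: list_all2_conv_all_nth\<close>)
  moreover have "{Q :: nat list. length Q = k} \<noteq> {}"
    by (metis (mono_tags) empty_iff length_replicate mem_Collect_eq)
  ultimately show ?thesis
    unfolding multi_at_top_def by (subst eventually_INF_base) (auto simp: eventually_principal)
qed

end

theory Submission
  imports Defs
begin

text \<open>Let \<open>T\<close> be the compression of the shifts to \<open>M\<^sup>\<bottom>\<close>. Since \<open>T\<^sub>\<alpha>\<^sup>* = S\<^sub>\<alpha>\<^sup>*\<close> on \<open>M\<^sup>\<bottom>\<close>, its
  defect is the rank one operator \<open>h \<mapsto> \<langle>h, u\<rangle>u\<close> with \<open>u\<close> the projection of the vacuum to \<open>M\<^sup>\<bottom>\<close>, which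
  is nonzero because \<open>M\<close> is proper. Hence the curvature is the limit of the means, over growing
  simplices, of the average \<open>a\<^sub>q\<close> of \<open>\<parallel>e\<^sub>\<alpha> - P\<^sub>M e\<^sub>\<alpha>\<parallel>\<^sup>2\<close> over the words of degree \<open>q\<close>. As \<open>a\<^sub>q\<close>
  decreases in every coordinate of \<open>q\<close>, the net \<open>a\<^sub>q\<close> itself converges to the curvature; and
  \<open>\<Sum>\<^sub>s \<parallel>\<psi>\<^sub>s\<^sup>* e\<^sub>\<alpha>\<parallel>\<^sup>2 = \<parallel>P\<^sub>M e\<^sub>\<alpha>\<parallel>\<^sup>2\<close>, so the limit in the theorem is one minus the curvature.

  If \<open>P\<^sub>M = \<Sum>\<^sub>s \<psi>\<^sub>s \<psi>\<^sub>s\<^sup>*\<close> with multi-analytic \<open>\<psi>\<^sub>s\<close>, then a defect operator of the restricted shifts is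
  \<open>\<Sum>\<^sub>s \<psi>\<^sub>s Q \<psi>\<^sub>s\<^sup>* \<ge> 0\<close>, where the projection \<open>Q\<close> is the corresponding defect operator of the shifts.
  Conversely, if the full defect \<open>D\<close> of the restricted shifts is positive, inverting the maps
  \<open>id - \<Phi>\<^sub>i\<close> one after the other gives \<open>P\<^sub>M = \<Sum>\<^sub>\<beta> S\<^sub>\<beta> D S\<^sub>\<beta>\<^sup>*\<close>, and a decomposition
  \<open>D = \<Sum>\<^sub>s v\<^sub>s v\<^sub>s\<^sup>*\<close> yields the multi-analytic operators \<open>\<psi>\<^sub>s\<close> with \<open>\<psi>\<^sub>s 1 = v\<^sub>s\<close>.\<close>

section \<open>Projections and adjoints\<close>

text \<open>The adjoint of a compression to the complement of \<open>M\<close> is a plain backward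
  shift, so that side is explicit. On \<open>M\<close> the adjoint of a restricted shift is P_M S^*
  instead, and this asymmetry shapes the proof. In one direction the adjoints of the multipliers
  absorb P_M because they vanish on the complement; in the other P_M S^* P_M = P_M S^* removes the
  inner projection. Defects are compared through their forms, where
  \<open>id - \<Phi>\<^sub>i\<close> becomes a recursion over letters. Its inversion converges
  because the mass of a vector on tuples with a long i-th word tends to 0. Positivity is given for
  the full defect; that of each partial defect, which the next inversion needs, comes out of the
  previous one as a sum of nonnegative terms. The vectors v_s come from a Cholesky factorization
  along an enumeration of the word basis, each step of which stays positive by Cauchy-Schwarz. Means
  over simplices have the limit of the net because the points of a large simplex that are not above
  a fixed multi-index form a vanishing fraction.\<close>

lemma scaleC_minus_one: "(- 1) *\<^sub>C (x :: 'h :: complex_hilbert) = - x"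
  using scaleC_of_real[of "- 1" x] by simp

lemma scaleC_one: "1 *\<^sub>C (x :: 'h :: complex_hilbert) = x"
  using scaleC_of_real[of 1 x] by simp

lemma scaleC_zero_left: "0 *\<^sub>C (x :: 'h :: complex_hilbert) = 0"
  using scaleC_of_real[of 0 x] by simp

lemma scaleC_zero_right: "c *\<^sub>C (0 :: 'h :: complex_hilbert) = 0"
  using scaleC_add_right[of c 0 0] by simp

lemma scaleC_uminus_right: "c *\<^sub>C (- x :: 'h :: complex_hilbert) = - (c *\<^sub>C x)"
  using scaleC_add_right[of c x "- x"] by (simp add: scaleC_zero_right eq_neg_iff_add_eq_0 add.commute)

lemma scaleC_diff_right: "c *\<^sub>C (x - y :: 'h :: complex_hilbert) = c *\<^sub>C x - c *\<^sub>C y"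
  using scaleC_add_right[of c x "- y"] by (simp add: scaleC_uminus_right)

lemma scaleC_sum_right: "c *\<^sub>C (\<Sum>i\<in>A. f i :: 'h :: complex_hilbert) = (\<Sum>i\<in>A. c *\<^sub>C f i)"
  by (induction A rule: infinite_finite_induct) (auto simp: scaleC_zero_right scaleC_add_right)

lemma cinner_minus_left: "cinner (- x) y = - cinner x y"
  using cinner_add_left[of x "- x" y] by (simp add: eq_neg_iff_add_eq_0 add.commute)

lemma cinner_minus_right: "cinner x (- y) = - cinner x y"
  using cinner_add_right[of x y "- y"] by (simp add: eq_neg_iff_add_eq_0 add.commute)

lemma cinner_diff_left: "cinner (x - y) z = cinner x z - cinner y z"
  using cinner_add_left[of x "- y" z] by (simp add: cinner_minus_left)

lemma cinner_diff_right: "cinner x (y - z) = cinner x y - cinner x z"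
  using cinner_add_right[of x y "- z"] by (simp add: cinner_minus_right)

lemma cinner_sum_left: "cinner (\<Sum>i\<in>A. f i) y = (\<Sum>i\<in>A. cinner (f i) y)"
  by (induction A rule: infinite_finite_induct) (auto simp: cinner_add_left)

lemma cinner_sum_right: "cinner y (\<Sum>i\<in>A. f i) = (\<Sum>i\<in>A. cinner y (f i))"
  by (induction A rule: infinite_finite_induct) (auto simp: cinner_add_right)

lemmas cinner_simps = cinner_add_left cinner_add_right cinner_diff_left cinner_diff_right
  cinner_scaleC_left cinner_scaleC_right cinner_minus_left cinner_minus_right

lemma cinner_scaleR_left: "cinner (r *\<^sub>R x) y = of_real r * cinner x y"
  by (metis cinner_scaleC_left scaleC_of_real)

lemma cinner_scaleR_right: "cinner x (r *\<^sub>R y) = of_real r * cinner x y"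
  by (metis cinner_scaleC_right scaleC_of_real complex_cnj_complex_of_real)

lemma Re_cinner_same: "Re (cinner x x) = (norm x)\<^sup>2"
  by (simp add: cinner_same)

lemma bounded_bilinear_cinner: "bounded_bilinear (cinner :: 'h :: complex_hilbert \<Rightarrow> _)"
proof
  show "\<exists>K. \<forall>x y. norm (cinner x (y :: 'h)) \<le> norm x * norm y * K"
    by (rule exI[of _ 1]) (simp add: norm_cinner_le)
qed (simp_all add: cinner_simps cinner_scaleR_left cinner_scaleR_right scaleR_conv_of_real)

lemmas tendsto_cinner = bounded_bilinear.tendsto[OF bounded_bilinear_cinner]

lemma cinner_eq_zero_imp: "cinner x x = 0 \<Longrightarrow> x = (0 :: 'h :: complex_hilbert)"
  by (simp add: cinner_same)

lemma closed_csubspaceD: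
  assumes "closed_csubspace H"
  shows "0 \<in> H" "x \<in> H \<Longrightarrow> y \<in> H \<Longrightarrow> x + y \<in> H" "x \<in> H \<Longrightarrow> c *\<^sub>C x \<in> H" "closed H"
    "x \<in> H \<Longrightarrow> - x \<in> H" "x \<in> H \<Longrightarrow> y \<in> H \<Longrightarrow> x - y \<in> H" "x \<in> H \<Longrightarrow> r *\<^sub>R x \<in> H"
    "(\<And>i. i \<in> A \<Longrightarrow> f i \<in> H) \<Longrightarrow> (\<Sum>i\<in>A. f i) \<in> H"
proof -
  show *: "0 \<in> H" "\<And>x y. x \<in> H \<Longrightarrow> y \<in> H \<Longrightarrow> x + y \<in> H" "\<And>c x. x \<in> H \<Longrightarrow> c *\<^sub>C x \<in> H" "closed H"
    using assms by (auto simp: closed_csubspace_def)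
  show 1: "x \<in> H \<Longrightarrow> - x \<in> H" for x
    using *(3)[of x "- 1"] by (simp add: scaleC_minus_one)
  show "x \<in> H \<Longrightarrow> y \<in> H \<Longrightarrow> x - y \<in> H"
    using *(2)[of x "- y"] 1[of y] by simp
  show "x \<in> H \<Longrightarrow> r *\<^sub>R x \<in> H"
    using *(3)[of x "of_real r"] by (simp add: scaleC_of_real)
  show "(\<And>i. i \<in> A \<Longrightarrow> f i \<in> H) \<Longrightarrow> (\<Sum>i\<in>A. f i) \<in> H"
    by (induction A rule: infinite_finite_induct) (auto intro: *)
qed

text \<open>Variation along \<open>z\<close>: the distance from \<open>w\<close> to the real line
  through \<open>z\<close> is minimal at \<open>t\<close>, and the minimum is strictly below the
  norm of \<open>w\<close> unless the real inner product vanishes.\<close>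

lemma orthogonal_of_minimal:
  fixes w :: "'h :: complex_hilbert"
  assumes H: "closed_csubspace H" and min: "\<And>z. z \<in> H \<Longrightarrow> norm w \<le> norm (w - z)" and z: "z \<in> H"
  shows "cinner w z = 0"
proof -
  have *: "inner w z = 0" if z: "z \<in> H" for z
  proof (cases "z = 0")
    case False
    define t where "t = inner w z / (norm z)\<^sup>2"
    have "(norm w)\<^sup>2 \<le> (norm (w - t *\<^sub>R z))\<^sup>2"
      using min closed_csubspaceD(7)[OF H z] by (intro power_mono) auto
    also have "\<dots> = (norm w)\<^sup>2 - 2 * (t * inner w z) + t\<^sup>2 * (norm z)\<^sup>2"
      unfolding power2_norm_eq_inner
      by (simp add: inner_diff_left inner_diff_right inner_commute power2_eq_square algebra_simps)
    also have "\<dots> = (norm w)\<^sup>2 - (inner w z)\<^sup>2 / (norm z)\<^sup>2"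
      using False by (simp add: t_def power2_eq_square field_simps)
    finally have "(inner w z)\<^sup>2 / (norm z)\<^sup>2 \<le> 0" by simp
    with False show ?thesis
      by (smt (verit) divide_nonneg_pos norm_eq_zero zero_less_power2 zero_less_divide_iff)
  qed simp
  \<comment> \<open>Testing against \<open>\<i> *\<^sub>C z\<close> yields the imaginary
    part.\<close>
  have "Re (cinner w z) = 0" using *[OF z] by (simp add: Re_cinner)
  moreover have "Re (cinner w (\<i> *\<^sub>C z)) = 0" 
    using *[OF closed_csubspaceD(3)[OF H z]] by (simp add: Re_cinner)
  ultimately show ?thesis
    by (simp add: complex_eq_iff cinner_scaleC_right)
qed

text \<open>A minimizing sequence for the distance is Cauchy by the parallelogram law, since
  midpoints stay in \<open>H\<close>. The error is prescribed for the squares, which is how that law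
  uses it.\<close>

lemma projection_exists:
  fixes H :: "'h :: complex_hilbert set"
  assumes H: "closed_csubspace H"
  shows "\<exists>y\<in>H. \<forall>z\<in>H. cinner (x - y) z = 0"
proof -
  have ne: "H \<noteq> {}" using closed_csubspaceD(1)[OF H] by auto
  define d where "d = infdist x H"
  have d0: "d \<ge> 0" by (simp add: d_def infdist_nonneg)
  have d: "d \<le> norm (x - z)" if "z \<in> H" for z
    using infdist_le[OF that, of x] by (simp add: d_def dist_norm)
  have "\<exists>y\<in>H. (norm (x - y))\<^sup>2 < d\<^sup>2 + inverse (Suc n)" for n
  proof -
    have "d < sqrt (d\<^sup>2 + inverse (Suc n))"
      by (rule real_less_rsqrt) simp
    then obtain y where y: "y \<in> H" "dist x y < sqrt (d\<^sup>2 + inverse (Suc n))"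
      using ne cINF_less_iff[of H "dist x" "sqrt (d\<^sup>2 + inverse (Suc n))"]
      by (auto simp: d_def infdist_notempty bdd_below_image_dist)
    then have "(norm (x - y))\<^sup>2 < (sqrt (d\<^sup>2 + inverse (Suc n)))\<^sup>2"
      by (intro power_strict_mono) (auto simp: dist_norm)
    then show ?thesis using y(1) by (intro bexI[of _ y]) (auto simp: add_nonneg_nonneg)
  qed
  then obtain y where y: "\<And>n. y n \<in> H" "\<And>n. (norm (x - y n))\<^sup>2 < d\<^sup>2 + inverse (Suc n)"
    by metis
  have par: "(norm (y m - y n))\<^sup>2 \<le> 2 * inverse (Suc m) + 2 * inverse (Suc n)" for m n
  proof -
    have "(norm (y m - y n))\<^sup>2 + 4 * (norm (x - (1/2) *\<^sub>R (y m + y n)))\<^sup>2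
        = 2 * (norm (x - y m))\<^sup>2 + 2 * (norm (x - y n))\<^sup>2"
      unfolding power2_norm_eq_inner
      by (simp add: inner_diff_left inner_diff_right inner_add_left inner_add_right inner_commute
          field_simps)
    moreover have "d\<^sup>2 \<le> (norm (x - (1/2) *\<^sub>R (y m + y n)))\<^sup>2"
      by (intro power_mono d closed_csubspaceD[OF H] y d0)
    ultimately show ?thesis using y(2)[of m] y(2)[of n] by linarith
  qed
  have "Cauchy y"
    unfolding Cauchy_def
  proof (intro allI impI)
    fix e :: real assume e: "e > 0"
    then obtain N where N: "inverse (Suc N) < e\<^sup>2 / 4"
      using reals_Archimedean[of "e\<^sup>2 / 4"] by auto
    have "dist (y m) (y n) < e" if "m \<ge> N" "n \<ge> N" for m n
    proof -
      have "inverse (Suc m) \<le> inverse (real (Suc N))" "inverse (Suc n) \<le> inverse (real (Suc N))"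
        using that by auto
      then have "(norm (y m - y n))\<^sup>2 < e\<^sup>2" using par[of m n] N by linarith
      then show ?thesis using e by (simp add: dist_norm power_less_imp_less_base)
    qed
    then show "\<exists>M. \<forall>m\<ge>M. \<forall>n\<ge>M. dist (y m) (y n) < e" by blast
  qed
  then obtain l where l: "y \<longlonglongrightarrow> l"
    using Cauchy_convergent convergentD by blast
  have lH: "l \<in> H"
    using closed_sequentially[OF closed_csubspaceD(4)[OF H], of y l] y(1) l by auto
  have "(norm (x - l))\<^sup>2 \<le> d\<^sup>2"
  proof (rule LIMSEQ_le[where X = "\<lambda>n. (norm (x - y n))\<^sup>2" and Y = "\<lambda>n. d\<^sup>2 + inverse (real (Suc n))"])
    show "(\<lambda>n. (norm (x - y n))\<^sup>2) \<longlonglongrightarrow> (norm (x - l))\<^sup>2"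
      by (intro tendsto_intros l)
    show "(\<lambda>n. d\<^sup>2 + inverse (real (Suc n))) \<longlonglongrightarrow> d\<^sup>2"
      using tendsto_add[OF tendsto_const[of "d\<^sup>2"] LIMSEQ_inverse_real_of_nat] by simp
  qed (use y(2) in \<open>auto intro: less_imp_le\<close>)
  then have xl: "norm (x - l) \<le> d" using d0 by (rule power2_le_imp_le)
  have "cinner (x - l) z = 0" if "z \<in> H" for z
  proof (rule orthogonal_of_minimal[OF H _ that])
    fix z assume "z \<in> H"
    then have "d \<le> norm (x - (l + z))" by (intro d closed_csubspaceD[OF H] lH)
    then show "norm (x - l) \<le> norm (x - l - z)" using xl by (simp add: algebra_simps)
  qed
  then show ?thesis using lH by blast
qed

lemma projection_unique:
  fixes H :: "'h :: complex_hilbert set"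
  assumes H: "closed_csubspace H" and "y \<in> H" "\<forall>z\<in>H. cinner (x - y) z = 0"
    and "y' \<in> H" "\<forall>z\<in>H. cinner (x - y') z = 0"
  shows "y = y'"
proof -
  have "y - y' \<in> H" using assms closed_csubspaceD[OF H] by blast
  then have "cinner (x - y') (y - y') - cinner (x - y) (y - y') = 0" using assms by simp
  then have "cinner (y - y') (y - y') = 0" by (simp flip: cinner_diff_left)
  then show ?thesis using cinner_eq_zero_imp[of "y - y'"] by simp
qed

lemma bounded_opI:
  assumes "\<And>x. x \<in> H \<Longrightarrow> A x \<in> K"
    and "\<And>x y. x \<in> H \<Longrightarrow> y \<in> H \<Longrightarrow> A (x + y) = A x + A y"
    and "\<And>c x. x \<in> H \<Longrightarrow> A (c *\<^sub>C x) = c *\<^sub>C A x"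
    and "\<And>x. x \<in> H \<Longrightarrow> norm (A x) \<le> B * norm x"
  shows "bounded_op H K A"
  unfolding bounded_op_def by (intro conjI ballI allI exI[of _ B] assms)

lemma bounded_opD:
  assumes "bounded_op H K A"
  shows "x \<in> H \<Longrightarrow> A x \<in> K" "x \<in> H \<Longrightarrow> y \<in> H \<Longrightarrow> A (x + y) = A x + A y"
    "x \<in> H \<Longrightarrow> A (c *\<^sub>C x) = c *\<^sub>C A x"
  using assms by (simp_all add: bounded_op_def)

lemma proj_eqI:
  assumes "closed_csubspace H" and "y \<in> H" "\<And>z. z \<in> H \<Longrightarrow> cinner (x - y) z = 0"
  shows "proj H x = y"
  unfolding proj_def
proof (rule the_equality)
  show "y \<in> H \<and> (\<forall>z\<in>H. cinner (x - y) z = 0)" using assms by simp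
  show "y' = y" if "y' \<in> H \<and> (\<forall>z\<in>H. cinner (x - y') z = 0)" for y'
    using projection_unique[OF assms(1), of y' x y] assms that by simp
qed

context
  fixes H :: "'h :: complex_hilbert set"
  assumes H: "closed_csubspace H"
begin

lemma proj_in: "proj H x \<in> H"
  and proj_orth: "z \<in> H \<Longrightarrow> cinner (x - proj H x) z = 0"
proof -
  obtain y where "y \<in> H" "\<forall>z\<in>H. cinner (x - y) z = 0" using projection_exists[OF H] by blast
  then show "proj H x \<in> H" "z \<in> H \<Longrightarrow> cinner (x - proj H x) z = 0"
    using proj_eqI[OF H, of y x] by auto
qed

lemma cinner_proj_left: "z \<in> H \<Longrightarrow> cinner (proj H x) z = cinner x z"
  using proj_orth[of z x] by (simp add: cinner_simps)

lemma cinner_proj_right: "z \<in> H \<Longrightarrow> cinner z (proj H x) = cinner z x"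
  by (metis cinner_commute cinner_proj_left)

lemma proj_fixed: "x \<in> H \<Longrightarrow> proj H x = x"
  by (rule proj_eqI[OF H]) auto

lemma proj_add: "proj H (x + y) = proj H x + proj H y"
  by (rule proj_eqI[OF H]) (auto simp: closed_csubspaceD[OF H] proj_in cinner_simps cinner_proj_left)

lemma proj_scaleC: "proj H (c *\<^sub>C x) = c *\<^sub>C proj H x"
  by (rule proj_eqI[OF H]) (auto simp: closed_csubspaceD[OF H] proj_in cinner_simps cinner_proj_left)

lemma norm_proj_sq: "(norm (proj H x))\<^sup>2 = Re (cinner (proj H x) x)"
  using cinner_proj_right[OF proj_in, of x x] by (metis Re_cinner_same)

lemma norm_proj_pythagoras: "(norm x)\<^sup>2 = (norm (proj H x))\<^sup>2 + (norm (x - proj H x))\<^sup>2"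
proof -
  have "cinner (x - proj H x) (proj H x) = 0" by (simp add: proj_orth proj_in)
  then have "inner (x - proj H x) (proj H x) = 0" by (metis Re_cinner zero_complex.simps(1))
  then show ?thesis
    unfolding power2_norm_eq_inner by (simp add: inner_diff_left inner_diff_right inner_commute)
qed

lemma norm_proj_le: "norm (proj H x) \<le> norm x"
  by (rule power2_le_imp_le) (use norm_proj_pythagoras[of x] in auto)

lemma cinner_separates:
  assumes "x \<in> H" "y \<in> H" "\<And>z. z \<in> H \<Longrightarrow> cinner z x = cinner z y"
  shows "x = y"
proof -
  have "cinner (x - y) (x - y) = 0"
    using assms(3)[of "x - y"] closed_csubspaceD(6)[OF H assms(1,2)] by (simp add: cinner_diff_right)
  then show ?thesis using cinner_eq_zero_imp by fastforce
qed

lemma adj_eqI: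
  assumes "x \<in> H" "\<And>z. z \<in> H \<Longrightarrow> cinner (A z) y = cinner z x"
  shows "adj H A y = x"
  unfolding adj_def
  by (rule the_equality) (use assms in \<open>auto intro!: cinner_separates\<close>)

text \<open>Within \<open>H\<close> the complement of the kernel \<open>K\<close> of
  \<open>f\<close> is spanned by one vector \<open>w\<close>, and subtracting the right multiple of
  \<open>w\<close> from \<open>x\<close> lands in \<open>K\<close>. Boundedness makes
  \<open>K\<close> closed, so that there is a projection onto it.\<close>

lemma riesz_representation:
  assumes add: "\<And>x y. x \<in> H \<Longrightarrow> y \<in> H \<Longrightarrow> f (x + y) = f x + f y"
    and scale: "\<And>c x. x \<in> H \<Longrightarrow> f (c *\<^sub>C x) = c * f x"
    and bound: "\<And>x. x \<in> H \<Longrightarrow> cmod (f x) \<le> B * norm x"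
  shows "\<exists>v\<in>H. \<forall>x\<in>H. f x = cinner x v"
proof (cases "\<forall>x\<in>H. f x = 0")
  case True
  then show ?thesis using closed_csubspaceD(1)[OF H] by (intro bexI[of _ 0]) auto
next
  case False
  then obtain a where a: "a \<in> H" "f a \<noteq> 0" by blast
  have diff: "f (x - y) = f x - f y" if "x \<in> H" "y \<in> H" for x y
    using add[OF that(1) closed_csubspaceD(3)[OF H that(2), of "- 1"]] scale[OF that(2), of "- 1"]
    by (simp add: scaleC_minus_one)
  define K where "K = {x\<in>H. f x = 0}"
  have "closed K"
    unfolding closed_sequential_limits
  proof (intro allI impI, elim conjE)
    fix X l assume X: "\<forall>n. X n \<in> K" and l: "X \<longlonglongrightarrow> l"
    then have lH: "l \<in> H"
      using closed_sequentially[OF closed_csubspaceD(4)[OF H], of X l] by (auto simp: K_def)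
    have "(\<lambda>n. B * norm (l - X n)) \<longlonglongrightarrow> B * norm (l - l)"
      by (intro tendsto_intros l)
    moreover have "cmod (f l) \<le> B * norm (l - X n)" for n
      using bound[of "l - X n"] diff[OF lH, of "X n"] X lH closed_csubspaceD(6)[OF H lH, of "X n"]
      by (auto simp: K_def)
    ultimately have "cmod (f l) \<le> 0"
      by (intro LIMSEQ_le_const[where X = "\<lambda>n. B * norm (l - X n)"]) auto
    then show "l \<in> K" using lH by (simp add: K_def)
  qed
  then have K: "closed_csubspace K"
    using scale[OF closed_csubspaceD(1)[OF H], of 0]
    by (auto simp: closed_csubspace_def K_def add scale closed_csubspaceD[OF H] scaleC_zero_left)
  define w where "w = a - proj K a"
  have pK: "proj K a \<in> K" 
    using projection_exists[OF K, of a] proj_eqI[OF K] by metis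
  have wK: "cinner z w = 0" if "z \<in> K" for z
    using projection_exists[OF K, of a] proj_eqI[OF K] that cinner_commute[of z w]
    unfolding w_def by (metis complex_cnj_zero)
  have wH: "w \<in> H" using pK a(1) closed_csubspaceD[OF H] by (auto simp: w_def K_def)
  have fw: "f w \<noteq> 0" using a pK by (auto simp: w_def diff K_def)
  then have w0: "cinner w w \<noteq> 0" using scale[OF closed_csubspaceD(1)[OF H], of 0] cinner_eq_zero_imp[of w]
    by (auto simp: scaleC_zero_left)
  \<comment> \<open>The scalar is forced by \<open>f w = cinner w v\<close>.\<close>
  define v where "v = cnj (f w / cinner w w) *\<^sub>C w"
  have "f x = cinner x v" if x: "x \<in> H" for x
  proof -
    have "x - (f x / f w) *\<^sub>C w \<in> K"
      using x wH fw by (auto simp: K_def diff scale closed_csubspaceD[OF H])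
    then have "cinner (x - (f x / f w) *\<^sub>C w) w = 0" by (rule wK)
    then have "cinner x w = (f x / f w) * cinner w w" by (simp add: cinner_simps)
    then show ?thesis using fw w0 by (simp add: v_def cinner_scaleC_right)
  qed
  moreover have "v \<in> H" unfolding v_def by (rule closed_csubspaceD(3)[OF H wH])
  ultimately show ?thesis by blast
qed

lemma bounded_op_bound:
  assumes "bounded_op H K A"
  obtains B where "B > 0" "\<And>x. x \<in> H \<Longrightarrow> norm (A x) \<le> B * norm x"
proof -
  obtain B where B: "\<forall>x\<in>H. norm (A x) \<le> B * norm x" using assms by (auto simp: bounded_op_def)
  have "norm (A x) \<le> (\<bar>B\<bar> + 1) * norm x" if "x \<in> H" for x
    using bspec[OF B that] by (smt (verit) mult_right_mono norm_ge_zero)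
  then show ?thesis by (intro that[of "\<bar>B\<bar> + 1"]) auto
qed

text \<open>Riesz representation of the functional \<open>\<lambda>z. cinner (A z) y\<close> on
  \<open>H\<close>; it gives the definite description in \<open>adj\<close> a value for every
  \<open>y\<close> of the ambient type.\<close>

lemma
  assumes A: "bounded_op H K A"
  shows adj_in: "adj H A y \<in> H"
    and cinner_adj_right: "z \<in> H \<Longrightarrow> cinner z (adj H A y) = cinner (A z) y"
    and cinner_adj_left: "z \<in> H \<Longrightarrow> cinner (adj H A y) z = cinner y (A z)"
proof -
  obtain B where B: "B > 0" "\<And>x. x \<in> H \<Longrightarrow> norm (A x) \<le> B * norm x"
    using bounded_op_bound[OF A] by blast
  have "\<exists>v\<in>H. \<forall>x\<in>H. cinner (A x) y = cinner x v"
  proof (rule riesz_representation)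
    show "cmod (cinner (A x) y) \<le> B * norm y * norm x" if "x \<in> H" for x
      using norm_cinner_le[of "A x" y] mult_right_mono[OF B(2)[OF that] norm_ge_zero[of y]]
      by (simp add: mult_ac)
  qed (use A in \<open>auto simp: bounded_op_def cinner_simps\<close>)
  then show *: "adj H A y \<in> H" "z \<in> H \<Longrightarrow> cinner z (adj H A y) = cinner (A z) y"
    using adj_eqI[of _ A y] by auto
  then show "z \<in> H \<Longrightarrow> cinner (adj H A y) z = cinner y (A z)"
    by (metis cinner_commute)
qed

lemma bounded_op_adj:
  assumes A: "bounded_op H K A" and K: "\<And>x. x \<in> H \<Longrightarrow> A x \<in> L"
  shows "bounded_op L H (adj H A)"
proof -
  obtain B where B: "B > 0" "\<And>x. x \<in> H \<Longrightarrow> norm (A x) \<le> B * norm x"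
    using bounded_op_bound[OF A] by blast
  have bound: "norm (adj H A y) \<le> B * norm y" for y
  proof -
    let ?z = "adj H A y"
    have z: "?z \<in> H" by (rule adj_in[OF A])
    have "(norm ?z)\<^sup>2 = Re (cinner (A ?z) y)"
      using cinner_adj_right[OF A z, of y] by (metis Re_cinner_same)
    also have "\<dots> \<le> norm (A ?z) * norm y"
      using norm_cinner_le complex_Re_le_cmod order_trans by blast
    also have "\<dots> \<le> (B * norm y) * norm ?z"
      using mult_right_mono[OF B(2)[OF z] norm_ge_zero[of y]] by (simp add: mult_ac)
    finally have "norm ?z * norm ?z \<le> (B * norm y) * norm ?z" by (simp add: power2_eq_square)
    moreover have "0 \<le> B * norm y" using B by simp
    ultimately show ?thesis by (cases "norm ?z = 0") auto
  qed
  show ?thesis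
  proof (rule bounded_opI[where B = B])
    show "adj H A (x + y) = adj H A x + adj H A y" for x y
      by (rule adj_eqI) (auto simp: closed_csubspaceD[OF H] adj_in[OF A] cinner_simps cinner_adj_right[OF A])
    show "adj H A (c *\<^sub>C x) = c *\<^sub>C adj H A x" for c x
      by (rule adj_eqI) (auto simp: closed_csubspaceD[OF H] adj_in[OF A] cinner_simps cinner_adj_right[OF A])
  qed (rule adj_in[OF A], rule bound)
qed

end

lemma bounded_op_compose:
  assumes "bounded_op G H A" "bounded_op H K B"
  shows "bounded_op G K (\<lambda>x. B (A x))"
proof -
  obtain a b where a: "\<forall>x\<in>G. norm (A x) \<le> a * norm x" and b: "\<forall>x\<in>H. norm (B x) \<le> b * norm x"
    using assms unfolding bounded_op_def by blast
  have "norm (B (A x)) \<le> (\<bar>b\<bar> * a) * norm x" if "x \<in> G" for x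
  proof -
    have "norm (B (A x)) \<le> b * norm (A x)" using b assms(1) that by (simp add: bounded_op_def)
    also have "\<dots> \<le> \<bar>b\<bar> * norm (A x)" by (simp add: mult_right_mono)
    also have "\<dots> \<le> \<bar>b\<bar> * (a * norm x)" using a that by (simp add: mult_left_mono)
    finally show ?thesis by (simp add: mult_ac)
  qed
  then show ?thesis using assms by (intro bounded_opI[where B = "\<bar>b\<bar> * a"]) (simp_all add: bounded_opD)
qed

lemma bounded_op_diff:
  assumes K: "closed_csubspace K" and A: "bounded_op H K A" and B: "bounded_op H K B"
  shows "bounded_op H K (\<lambda>x. A x - B x)"
proof -
  obtain a b where a: "\<forall>x\<in>H. norm (A x) \<le> a * norm x" and b: "\<forall>x\<in>H. norm (B x) \<le> b * norm x"
    using assms unfolding bounded_op_def by blast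
  have "norm (A x - B x) \<le> (a + b) * norm x" if "x \<in> H" for x
    using norm_triangle_ineq4[of "A x" "B x"] bspec[OF a that] bspec[OF b that]
    by (simp add: distrib_right)
  then show ?thesis
    by (intro bounded_opI[where B = "a + b"])
      (simp_all add: bounded_opD[OF A] bounded_opD[OF B] closed_csubspaceD[OF K] scaleC_diff_right)
qed

lemma bounded_op_sum:
  assumes K: "closed_csubspace K" and A: "\<And>j. j \<in> J \<Longrightarrow> bounded_op H K (A j)"
  shows "bounded_op H K (\<lambda>x. \<Sum>j\<in>J. A j x)"
proof -
  have "\<exists>b. \<forall>j\<in>J. \<forall>x\<in>H. norm (A j x) \<le> b j * norm x"
    using A unfolding bounded_op_def by (intro bchoice) blast
  then obtain b where b: "\<And>j x. j \<in> J \<Longrightarrow> x \<in> H \<Longrightarrow> norm (A j x) \<le> b j * norm x" by blast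
  show ?thesis
  proof (rule bounded_opI[where B = "\<Sum>j\<in>J. b j"])
    show "norm (\<Sum>j\<in>J. A j x) \<le> (\<Sum>j\<in>J. b j) * norm x" if "x \<in> H" for x
      using b that sum_norm_le[of J "\<lambda>j. A j x" "\<lambda>j. b j * norm x"] by (simp add: sum_distrib_right)
    show "(\<Sum>j\<in>J. A j (x + y)) = (\<Sum>j\<in>J. A j x) + (\<Sum>j\<in>J. A j y)" if "x \<in> H" "y \<in> H" for x y
      unfolding sum.distrib[symmetric] using A that by (intro sum.cong) (auto simp: bounded_op_def)
    show "(\<Sum>j\<in>J. A j (c *\<^sub>C x)) = c *\<^sub>C (\<Sum>j\<in>J. A j x)" if "x \<in> H" for c x
      unfolding scaleC_sum_right using A that by (intro sum.cong) (auto simp: bounded_op_def)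
    show "(\<Sum>j\<in>J. A j x) \<in> K" if "x \<in> H" for x
      using A that by (intro closed_csubspaceD(8)[OF K]) (auto simp: bounded_op_def)
  qed
qed

lemma bounded_op_zero: "closed_csubspace H \<Longrightarrow> bounded_op H K A \<Longrightarrow> A 0 = 0"
  using closed_csubspaceD(1)[of H] unfolding bounded_op_def by (metis scaleC_zero_left)

lemma bounded_op_diff_arg:
  assumes H: "closed_csubspace H" and A: "bounded_op H K A" and xy: "x \<in> H" "y \<in> H"
  shows "A (x - y) = A x - A y"
proof -
  have "A (x - y) = A (x + (- 1) *\<^sub>C y)" by (simp add: scaleC_minus_one)
  also have "\<dots> = A x + (- 1) *\<^sub>C A y"
    using A xy closed_csubspaceD(3)[OF H] unfolding bounded_op_def by metis
  finally show ?thesis by (simp add: scaleC_minus_one)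
qed

lemma bounded_op_sum_arg:
  assumes H: "closed_csubspace H" and A: "bounded_op H K A" and f: "\<And>i. i \<in> J \<Longrightarrow> f i \<in> H"
  shows "A (\<Sum>i\<in>J. f i) = (\<Sum>i\<in>J. A (f i))"
  using f
proof (induction J rule: infinite_finite_induct)
  case (insert j J)
  then show ?case using A closed_csubspaceD(8)[OF H, of J f] by (simp add: bounded_op_def)
qed (auto simp: bounded_op_zero[OF H A])

lemma closed_csubspace_ortho_compl:
  assumes H: "closed_csubspace H"
  shows "closed_csubspace (ortho_compl H M)"
proof -
  have "closed (ortho_compl H M)"
    unfolding closed_sequential_limits
  proof (intro allI impI, elim conjE)
    fix X l assume X: "\<forall>n. X n \<in> ortho_compl H M" and l: "X \<longlonglongrightarrow> l"
    have "l \<in> H" using closed_sequentially[OF closed_csubspaceD(4)[OF H], of X l] X l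
      by (auto simp: ortho_compl_def)
    moreover have "cinner l y = 0" if "y \<in> M" for y
    proof (rule LIMSEQ_unique)
      show "(\<lambda>n. cinner (X n) y) \<longlonglongrightarrow> cinner l y" by (intro tendsto_cinner l tendsto_const)
      show "(\<lambda>n. cinner (X n) y) \<longlonglongrightarrow> 0" using X that by (auto simp: ortho_compl_def)
    qed
    ultimately show "l \<in> ortho_compl H M" by (simp add: ortho_compl_def)
  qed
  then show ?thesis
    using closed_csubspaceD[OF H] by (auto simp: closed_csubspace_def ortho_compl_def cinner_simps)
qed

lemma proj_ortho_compl:
  assumes H: "closed_csubspace H" and M: "closed_csubspace M" "M \<subseteq> H" and x: "x \<in> H"
  shows "proj (ortho_compl H M) x = x - proj M x"
proof (rule proj_eqI[OF closed_csubspace_ortho_compl[OF H]])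
  show "x - proj M x \<in> ortho_compl H M"
    using x proj_in[OF M(1), of x] M(2) closed_csubspaceD(6)[OF H] by (auto simp: ortho_compl_def proj_orth[OF M(1)])
  fix z assume z: "z \<in> ortho_compl H M"
  then have "cinner z (proj M x) = 0" using proj_in[OF M(1), of x] by (auto simp: ortho_compl_def)
  then have "cinner (proj M x) z = 0" by (metis cinner_commute complex_cnj_zero)
  then show "cinner (x - (x - proj M x)) z = 0" by simp
qed

section \<open>Positive operators\<close>

lemma positive_op_bounded: "positive_op H A \<Longrightarrow> bounded_op H H A"
  by (simp add: positive_op_def)

lemma positive_op_nonneg: "positive_op H A \<Longrightarrow> x \<in> H \<Longrightarrow> 0 \<le> Re (cinner (A x) x)"
  by (simp add: positive_op_def)

lemma positive_op_same:
  "positive_op H A \<Longrightarrow> x \<in> H \<Longrightarrow> cinner (A x) x = of_real (Re (cinner (A x) x))"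
  by (simp add: positive_op_def complex_eq_iff)

text \<open>Polarization: realness of the form at \<open>x + y\<close> relates the imaginary parts
  of the two mixed terms, realness at \<open>x + \<i> *\<^sub>C y\<close> their real parts.\<close>

lemma positive_op_hermitian:
  assumes H: "closed_csubspace H" and A: "positive_op H A" and x: "x \<in> H" and y: "y \<in> H"
  shows "cinner (A x) y = cinner x (A y)"
proof -
  note bA = bounded_opD[OF positive_op_bounded[OF A]]
  have iy: "\<i> *\<^sub>C y \<in> H" by (rule closed_csubspaceD(3)[OF H y])
  have im: "Im (cinner (A z) z) = 0" if "z \<in> H" for z
    using A that by (simp add: positive_op_def)
  have "Im (cinner (A (x + y)) (x + y)) = 0" "Im (cinner (A (x + \<i> *\<^sub>C y)) (x + \<i> *\<^sub>C y)) = 0"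
    by (intro im closed_csubspaceD(2)[OF H] x y iy)+
  then have "Im (cinner (A x) y) + Im (cinner (A y) x) = 0" "Re (cinner (A y) x) = Re (cinner (A x) y)"
    using im[OF x] im[OF y] by (simp_all add: bA x y iy cinner_simps)
  then have "cinner (A x) y = cnj (cinner (A y) x)"
    by (simp add: complex_eq_iff)
  then show ?thesis by (metis cinner_commute)
qed

text \<open>The form is nonnegative at \<open>x - t *\<^sub>C y\<close>. Taking \<open>t\<close> to
  be a real multiple \<open>r\<close> of \<open>c\<close> makes it a real quadratic polynomial in
  \<open>r\<close>.\<close>

lemma positive_op_cauchy_schwarz:
  assumes H: "closed_csubspace H" and A: "positive_op H A" and x: "x \<in> H" and y: "y \<in> H"
  shows "(cmod (cinner (A x) y))\<^sup>2 \<le> Re (cinner (A x) x) * Re (cinner (A y) y)"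
proof -
  note bA = bounded_opD[OF positive_op_bounded[OF A]]
  define c where "c = cinner (A x) y"
  define a where "a = Re (cinner (A x) x)"
  define b where "b = Re (cinner (A y) y)"
  have ab: "cinner (A x) x = of_real a" "cinner (A y) y = of_real b" "0 \<le> b"
    using positive_op_same[OF A] positive_op_nonneg[OF A] x y by (simp_all add: a_def b_def)
  have yx: "cinner (A y) x = cnj c"
    unfolding c_def using positive_op_hermitian[OF H A y x] cinner_commute[of y "A x"] by simp
  have quad: "0 \<le> a - 2 * r * (cmod c)\<^sup>2 + r\<^sup>2 * (cmod c)\<^sup>2 * b" for r :: real
  proof -
    define t where "t = of_real r * c"
    have ty: "t *\<^sub>C y \<in> H" by (rule closed_csubspaceD(3)[OF H y])
    have Axt: "A (x - t *\<^sub>C y) = A x - t *\<^sub>C A y"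
      using bounded_op_diff_arg[OF H positive_op_bounded[OF A] x ty] bA(3)[OF y] by simp
    have "cinner (A (x - t *\<^sub>C y)) (x - t *\<^sub>C y) = a - cnj t * c - t * cnj c + t * cnj t * b"
      unfolding Axt by (simp add: cinner_simps ab yx c_def[symmetric] algebra_simps)
    also have "\<dots> = of_real a - 2 * of_real r * (c * cnj c) + (of_real r)\<^sup>2 * (c * cnj c) * of_real b"
      by (simp add: t_def power2_eq_square algebra_simps)
    also have "\<dots> = of_real (a - 2 * r * (cmod c)\<^sup>2 + r\<^sup>2 * (cmod c)\<^sup>2 * b)"
      by (simp flip: complex_norm_square)
    finally show ?thesis
      using positive_op_nonneg[OF A closed_csubspaceD(6)[OF H x ty]] by simp
  qed
  have "(cmod c)\<^sup>2 \<le> a * b"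
  proof (cases "b = 0")
    case True
    have "c = 0"
    proof (rule ccontr)
      assume "c \<noteq> 0"
      \<comment> \<open>For \<open>b = 0\<close> the polynomial is affine in \<open>r\<close>, and
        this \<open>r\<close> gives it the value -1.\<close>
      then show False using quad[of "(a + 1) / (2 * (cmod c)\<^sup>2)"] True by (simp add: field_simps)
    qed
    then show ?thesis using True by simp
  next
    case False
    \<comment> \<open>\<open>1 / b\<close> minimizes the polynomial.\<close>
    then show ?thesis using quad[of "1 / b"] ab(3) by (simp add: field_simps power2_eq_square)
  qed
  then show ?thesis by (simp add: a_def b_def c_def)
qed

text \<open>Cauchy-Schwarz applied to \<open>x\<close> and \<open>A x\<close>: a positive operator
  below the identity dominates its square. This later upgrades convergence of quadratic forms to
  strong convergence.\<close>

lemma positive_op_norm_sq_le: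
  assumes H: "closed_csubspace H" and A: "positive_op H A"
    and le: "\<And>y. y \<in> H \<Longrightarrow> Re (cinner (A y) y) \<le> (norm y)\<^sup>2" and x: "x \<in> H"
  shows "(norm (A x))\<^sup>2 \<le> Re (cinner (A x) x)"
proof (cases "A x = 0")
  case False
  have Ax: "A x \<in> H" using bounded_opD(1)[OF positive_op_bounded[OF A]] x .
  have "((norm (A x))\<^sup>2)\<^sup>2 = (cmod (cinner (A x) (A x)))\<^sup>2"
    by (simp add: cinner_same norm_power)
  also have "\<dots> \<le> Re (cinner (A x) x) * Re (cinner (A (A x)) (A x))"
    by (rule positive_op_cauchy_schwarz[OF H A x Ax])
  also have "\<dots> \<le> Re (cinner (A x) x) * (norm (A x))\<^sup>2"
    by (intro mult_left_mono le Ax positive_op_nonneg[OF A x])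
  finally show ?thesis using False by (simp add: power2_eq_square)
qed (simp add: cinner_same)

lemma bounded_op_rank_one:
  fixes v :: "'h :: complex_hilbert" and w :: "'k :: complex_hilbert"
  assumes K: "closed_csubspace K" and w: "w \<in> K"
  shows "bounded_op H K (\<lambda>x. (cinner x v * c) *\<^sub>C w)"
proof (rule bounded_opI[where B = "norm v * cmod c * norm w"])
  show "norm ((cinner x v * c) *\<^sub>C w) \<le> norm v * cmod c * norm w * norm x" for x
    using mult_right_mono[OF norm_cinner_le[of x v], of "cmod c * norm w"]
    by (simp add: norm_scaleC norm_mult mult_ac)
qed (auto simp: closed_csubspaceD[OF K] w cinner_simps distrib_right scaleC_add_left scaleC_scaleC mult.assoc)

text \<open>A Cholesky decomposition: each step subtracts the rank one operator which annihilates the next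
  vector of the sequence.\<close>

primrec cholesky_rest :: "('h :: complex_hilbert \<Rightarrow> 'h) \<Rightarrow> (nat \<Rightarrow> 'h) \<Rightarrow> nat \<Rightarrow> 'h \<Rightarrow> 'h" where
  "cholesky_rest A e 0 = A"
| "cholesky_rest A e (Suc s) = (\<lambda>x. cholesky_rest A e s x -
     (cinner x (cholesky_rest A e s (e s)) * inverse (cinner (cholesky_rest A e s (e s)) (e s))) *\<^sub>C
       cholesky_rest A e s (e s))"

text \<open>For a zero pivot this is the zero vector, because division by 0 gives 0. That is
  consistent: by Cauchy-Schwarz the remainder then already vanishes at \<open>e s\<close>.\<close>

definition cholesky_vec :: "('h :: complex_hilbert \<Rightarrow> 'h) \<Rightarrow> (nat \<Rightarrow> 'h) \<Rightarrow> nat \<Rightarrow> 'h" where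
  "cholesky_vec A e s = (1 / sqrt (Re (cinner (cholesky_rest A e s (e s)) (e s)))) *\<^sub>R
     cholesky_rest A e s (e s)"

lemma cholesky_step:
  assumes "0 \<le> d"
  shows "cinner (y - (cinner x w * inverse (complex_of_real d)) *\<^sub>C w) x =
    cinner y x - of_real ((cmod (cinner x ((1 / sqrt d) *\<^sub>R w)))\<^sup>2)"
proof -
  have "cinner x w * inverse (complex_of_real d) * cinner w x = of_real ((cmod (cinner x w))\<^sup>2 / d)"
    using complex_norm_square[of "cinner x w"] cinner_commute[of w x]
    by (simp add: field_simps)
  also have "(cmod (cinner x w))\<^sup>2 / d = (cmod (cinner x ((1 / sqrt d) *\<^sub>R w)))\<^sup>2"
    using assms by (simp add: cinner_scaleR_right norm_mult norm_divide power_divide)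
  finally show ?thesis by (simp add: cinner_simps)
qed

context
  fixes H :: "'h :: complex_hilbert set" and A and e :: "nat \<Rightarrow> 'h"
  assumes H: "closed_csubspace H" and A: "positive_op H A" and e: "\<And>s. e s \<in> H"
begin

text \<open>Subtracting the rank one operator of \<open>w = R (e s)\<close>, divided by the pivot
  \<open>d\<close>, preserves positivity because Cauchy-Schwarz for \<open>R\<close> bounds the
  square of the modulus of \<open>cinner w x\<close> by
  \<open>d * Re (cinner (R x) x)\<close>.\<close>

lemma cholesky_rest_positive:
  "positive_op H (cholesky_rest A e s) \<and> (\<forall>j<s. cholesky_rest A e s (e j) = 0)"
proof (induction s)
  case 0
  then show ?case using A by simp
next
  case (Suc s)
  define R where "R = cholesky_rest A e s"
  define w where "w = R (e s)"
  define d where "d = Re (cinner w (e s))"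
  have R: "positive_op H R" and Re: "\<And>j. j < s \<Longrightarrow> R (e j) = 0" using Suc by (auto simp: R_def)
  have wH: "w \<in> H" using bounded_opD(1)[OF positive_op_bounded[OF R] e] by (simp add: w_def)
  have d: "cinner w (e s) = of_real d" "0 \<le> d"
    using positive_op_same[OF R e] positive_op_nonneg[OF R e] by (simp_all add: d_def w_def)
  have cs: "(cmod (cinner w x))\<^sup>2 \<le> d * Re (cinner (R x) x)" if "x \<in> H" for x
    using positive_op_cauchy_schwarz[OF H R e that] by (simp add: w_def d_def)
  have w0: "w = 0" if "d = 0"
    using cs[OF wH] that by (simp add: cinner_same)
  have step: "cholesky_rest A e (Suc s) = (\<lambda>x. R x - (cinner x w * inverse (of_real d)) *\<^sub>C w)"
    by (simp add: R_def[symmetric] w_def[symmetric] d(1))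
  have form: "cinner (cholesky_rest A e (Suc s) x) x =
      cinner (R x) x - of_real ((cmod (cinner x ((1 / sqrt d) *\<^sub>R w)))\<^sup>2)" for x
    unfolding step by (rule cholesky_step[OF d(2)])
  have "0 \<le> Re (cinner (cholesky_rest A e (Suc s) x) x)" if x: "x \<in> H" for x
  proof (cases "d = 0")
    case True
    then show ?thesis unfolding form using w0 positive_op_nonneg[OF R x] by simp
  next
    case False
    have "(cmod (cinner x ((1 / sqrt d) *\<^sub>R w)))\<^sup>2 = (cmod (cinner w x))\<^sup>2 / d"
      using d(2) complex_mod_cnj[of "cinner w x"] cinner_commute[of x w]
      by (simp add: cinner_scaleR_right norm_mult norm_divide power_divide)
    also have "\<dots> \<le> Re (cinner (R x) x)"
      using cs[OF x] False d(2) by (simp add: field_simps)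
    finally show ?thesis unfolding form by simp
  qed
  moreover have "Im (cinner (cholesky_rest A e (Suc s) x) x) = 0" if x: "x \<in> H" for x
    unfolding form using R x by (simp add: positive_op_def)
  moreover have "bounded_op H H (cholesky_rest A e (Suc s))"
    unfolding step by (intro bounded_op_diff[OF H] positive_op_bounded[OF R] bounded_op_rank_one[OF H wH])
  moreover have "cholesky_rest A e (Suc s) (e j) = 0" if "j < Suc s" for j
  proof (cases "j = s")
    case True
    have "cinner (e s) w = of_real d" by (metis d(1) cinner_commute complex_cnj_complex_of_real)
    moreover have "R (e j) = w" using True by (simp add: w_def)
    ultimately show ?thesis unfolding step
      using True w0 by (cases "d = 0") (simp_all add: scaleC_one scaleC_zero_right)
  next
    case False
    then have j: "R (e j) = 0" using Re that by simp
    \<comment> \<open>Vectors annihilated earlier stay annihilated, since the subtracted operator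
      sees \<open>e j\<close> only through its inner product with \<open>w\<close>.\<close>
    have "cinner (e j) w = cinner (R (e j)) (e s)"
      unfolding w_def by (rule positive_op_hermitian[OF H R e e, symmetric])
    then show ?thesis unfolding step by (simp add: j scaleC_zero_left)
  qed
  ultimately show ?case by (simp add: positive_op_def del: cholesky_rest.simps)
qed

lemma cholesky_vec_in: "cholesky_vec A e s \<in> H"
  unfolding cholesky_vec_def
  using cholesky_rest_positive[of s] by (intro closed_csubspaceD(7)[OF H]) (simp add: positive_op_def bounded_op_def e)

lemma cholesky_partial_sum:
  assumes x: "x \<in> H"
  shows "(\<Sum>s<n. (cmod (cinner x (cholesky_vec A e s)))\<^sup>2) =
    Re (cinner (A x) x) - Re (cinner (cholesky_rest A e n x) x)"
proof (induction n)
  case (Suc n)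
  let ?R = "cholesky_rest A e n"
  have R: "positive_op H ?R" using cholesky_rest_positive by simp
  have "cinner (?R (e n)) (e n) = of_real (Re (cinner (?R (e n)) (e n)))"
    by (rule positive_op_same[OF R e])
  then have "cinner (cholesky_rest A e (Suc n) x) x =
      cinner (?R x) x - of_real ((cmod (cinner x (cholesky_vec A e n)))\<^sup>2)"
    using cholesky_step[OF positive_op_nonneg[OF R e[of n]], of "?R x" x "?R (e n)"]
    by (simp add: cholesky_vec_def)
  then have "Re (cinner (cholesky_rest A e (Suc n) x) x) =
      Re (cinner (?R x) x) - (cmod (cinner x (cholesky_vec A e n)))\<^sup>2"
    by (metis Re_complex_of_real minus_complex.simps(1))
  then show ?case using Suc by (simp del: cholesky_rest.simps)
qed simp

text \<open>The n-th remainder annihilates \<open>e 0, ..., e (n - 1)\<close>, so its form at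
  \<open>x\<close> does not change when a combination of these vectors is subtracted from
  \<open>x\<close>. By totality the difference can be made small, and all remainders have forms
  bounded by that of \<open>A\<close>.\<close>

lemma cholesky_sums:
  assumes total: "\<And>\<epsilon>. 0 < \<epsilon> \<Longrightarrow> \<exists>n c. norm (x - (\<Sum>s<n. c s *\<^sub>C e s)) < \<epsilon>" and x: "x \<in> H"
  shows "(\<lambda>s. (cmod (cinner x (cholesky_vec A e s)))\<^sup>2) sums Re (cinner (A x) x)"
proof -
  let ?q = "\<lambda>n x. Re (cinner (cholesky_rest A e n x) x)"
  have pos: "positive_op H (cholesky_rest A e n)" for n using cholesky_rest_positive by simp
  obtain B where B: "B > 0" "\<And>x. x \<in> H \<Longrightarrow> norm (A x) \<le> B * norm x"
    using bounded_op_bound[OF H positive_op_bounded[OF A]] by blast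
  have qB: "?q n z \<le> B * (norm z)\<^sup>2" if z: "z \<in> H" for n z
  proof -
    have "0 \<le> (\<Sum>s<n. (cmod (cinner z (cholesky_vec A e s)))\<^sup>2)" by (intro sum_nonneg) simp
    then have "?q n z \<le> Re (cinner (A z) z)" using cholesky_partial_sum[OF z, of n] by simp
    also have "\<dots> \<le> norm (A z) * norm z" using norm_cinner_le complex_Re_le_cmod order_trans by blast
    also have "\<dots> \<le> B * norm z * norm z" using B(2)[OF z] by (simp add: mult_right_mono)
    finally show ?thesis by (simp add: power2_eq_square mult_ac)
  qed
  have "(\<lambda>n. ?q n x) \<longlonglongrightarrow> 0"
  proof (rule LIMSEQ_I)
    fix r :: real assume r: "r > 0"
    obtain n c where nc: "norm (x - (\<Sum>s<n. c s *\<^sub>C e s)) < sqrt (r / B)"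
      using total[of "sqrt (r / B)"] r B(1) by auto
    define y where "y = (\<Sum>s<n. c s *\<^sub>C e s)"
    have y: "y \<in> H" unfolding y_def by (intro closed_csubspaceD[OF H] e)
    have xy: "x - y \<in> H" by (rule closed_csubspaceD(6)[OF H x y])
    have "norm (?q m x - 0) < r" if m: "m \<ge> n" for m
    proof -
      let ?R = "cholesky_rest A e m"
      note R = pos[of m]
      have "?R y = (\<Sum>s<n. ?R (c s *\<^sub>C e s))"
        unfolding y_def by (intro bounded_op_sum_arg[OF H positive_op_bounded[OF R]] closed_csubspaceD[OF H] e)
      also have "\<dots> = 0"
        using cholesky_rest_positive[of m] m
        by (intro sum.neutral) (auto simp: bounded_opD[OF positive_op_bounded[OF R]] e scaleC_zero_right)
      finally have Ry: "?R y = 0" .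
      then have Rxy: "?R (x - y) = ?R x"
        using bounded_op_diff_arg[OF H positive_op_bounded[OF R] x y] by simp
      have "cinner (?R x) y = cinner x (?R y)" by (rule positive_op_hermitian[OF H R x y])
      then have "cinner (?R (x - y)) (x - y) = cinner (?R x) x"
        unfolding Rxy by (simp add: cinner_diff_right Ry)
      then have "?q m x \<le> B * (norm (x - y))\<^sup>2" using qB[OF xy, of m] by simp
      also have "\<dots> < B * (sqrt (r / B))\<^sup>2"
        using nc B(1) by (intro mult_strict_left_mono power_strict_mono) (simp_all add: y_def)
      also have "\<dots> = r" using r B(1) by simp
      finally show ?thesis using positive_op_nonneg[OF R x] by simp
    qed
    then show "\<exists>no. \<forall>m\<ge>no. norm (?q m x - 0) < r" by blast
  qed
  then have "(\<lambda>n. Re (cinner (A x) x) - ?q n x) \<longlonglongrightarrow> Re (cinner (A x) x) - 0"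
    by (intro tendsto_intros)
  then show ?thesis unfolding sums_def cholesky_partial_sum[OF x] by simp
qed

end

section \<open>Orthonormal bases and traces\<close>

text \<open>Zorn: a nonzero vector orthogonal to a maximal orthonormal set could be normalized and
  added. Existence gives meaning to the \<open>SOME\<close> in \<open>trace_op\<close>.\<close>

lemma orthonormal_basis_exists:
  assumes H: "closed_csubspace H"
  shows "\<exists>B. orthonormal_basis H B"
proof -
  define \<A> where "\<A> = {B. B \<subseteq> H \<and> (\<forall>e\<in>B. \<forall>f\<in>B. cinner e f = (if e = f then 1 else 0))}"
  have "\<exists>M\<in>\<A>. \<forall>X\<in>\<A>. M \<subseteq> X \<longrightarrow> X = M"
  proof (rule subset_Zorn_nonempty)
    show "\<A> \<noteq> {}" unfolding \<A>_def by blast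
    fix \<C> assume "\<C> \<noteq> {}" and C: "subset.chain \<A> \<C>"
    have sub: "\<C> \<subseteq> \<A>" using C by (simp add: subset_chain_def)
    have "cinner e f = (if e = f then 1 else 0)" if ef: "e \<in> \<Union>\<C>" "f \<in> \<Union>\<C>" for e f
    proof -
      obtain X Y where "X \<in> \<C>" "e \<in> X" "Y \<in> \<C>" "f \<in> Y" using ef by blast
      moreover from this have "X \<subseteq> Y \<or> Y \<subseteq> X" using C by (auto simp: subset_chain_def)
      ultimately obtain Z where "Z \<in> \<C>" "e \<in> Z" "f \<in> Z" by blast
      then show ?thesis using sub unfolding \<A>_def by blast
    qed
    then show "\<Union>\<C> \<in> \<A>" using sub unfolding \<A>_def by blast
  qed
  then obtain B where B: "B \<in> \<A>" and max: "\<And>X. X \<in> \<A> \<Longrightarrow> B \<subseteq> X \<Longrightarrow> X = B" by blast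
  have "x = 0" if x: "x \<in> H" "\<forall>e\<in>B. cinner x e = 0" for x
  proof (rule ccontr)
    assume x0: "x \<noteq> 0"
    define u where "u = (1 / norm x) *\<^sub>R x"
    have u: "u \<in> H" "cinner u u = 1"
      using x0 closed_csubspaceD(7)[OF H x(1)] by (simp_all add: u_def cinner_same)
    have ue: "cinner u e = 0" "cinner e u = 0" if "e \<in> B" for e
      using x(2) that cinner_commute[of e x] by (simp_all add: u_def cinner_scaleR_left cinner_scaleR_right)
    have "insert u B \<in> \<A>" using B u ue unfolding \<A>_def by auto
    then have "u \<in> B" using max[of "insert u B"] by blast
    then show False using ue(1)[of u] u(2) by simp
  qed
  then have "orthonormal_basis H B" using B by (auto simp: orthonormal_basis_def \<A>_def)
  then show ?thesis ..
qed

context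
  fixes H B :: "'h :: complex_hilbert set"
  assumes H: "closed_csubspace H" and B: "orthonormal_basis H B"
begin

lemma orthonormal_basis_in: "e \<in> B \<Longrightarrow> e \<in> H"
  using B by (auto simp: orthonormal_basis_def)

lemma orthonormal_basis_cinner: "e \<in> B \<Longrightarrow> f \<in> B \<Longrightarrow> cinner e f = (if e = f then 1 else 0)"
  using B by (simp add: orthonormal_basis_def)

lemma norm_diff_partial_expansion:
  assumes F: "finite F" "F \<subseteq> B"
  shows "(norm (x - (\<Sum>e\<in>F. cinner x e *\<^sub>C e)))\<^sup>2 = (norm x)\<^sup>2 - (\<Sum>e\<in>F. (cmod (cinner x e))\<^sup>2)"
proof -
  define y where "y = (\<Sum>e\<in>F. cinner x e *\<^sub>C e)"
  have s: "(\<Sum>e\<in>F. cinner x e * cnj (cinner x e)) = of_real (\<Sum>e\<in>F. (cmod (cinner x e))\<^sup>2)"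
    by (simp flip: complex_norm_square)
  have xy: "cinner x y = of_real (\<Sum>e\<in>F. (cmod (cinner x e))\<^sup>2)"
    unfolding y_def cinner_sum_right cinner_scaleC_right s[symmetric] by (simp add: mult.commute)
  have yf: "cinner y f = cinner x f" if f: "f \<in> F" for f
  proof -
    have "cinner y f = (\<Sum>e\<in>F. cinner x e * (if e = f then 1 else 0))"
      unfolding y_def cinner_sum_left cinner_scaleC_left
      using F f by (intro sum.cong refl arg_cong2[where f = times] orthonormal_basis_cinner) auto
    also have "\<dots> = cinner x f" using F(1) f by (simp add: if_distrib sum.delta cong: if_cong)
    finally show ?thesis .
  qed
  have "cinner z y = (\<Sum>e\<in>F. cnj (cinner x e) * cinner z e)" for z
    unfolding y_def by (simp add: cinner_sum_right cinner_scaleC_right)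
  then have yy: "cinner y y = cinner x y" by (simp add: yf)
  have "Re (cinner (x - y) (x - y)) = Re (cinner x x) - Re (cinner x y)"
    using xy cinner_commute[of y x] yy by (simp add: cinner_simps)
  then show ?thesis
    unfolding y_def[symmetric] Re_cinner_same xy by simp
qed

text \<open>The vectors approximated by their own finite expansions form a closed subspace
  \<open>K\<close> containing \<open>B\<close>. What is orthogonal to \<open>K\<close> is orthogonal
  to \<open>B\<close>, hence 0, so \<open>K\<close> is all of \<open>H\<close>; on \<open>K\<close>
  the remainder in Bessel's identity tends to 0.\<close>

lemma parseval:
  assumes x: "x \<in> H"
  shows "((\<lambda>e. (cmod (cinner x e))\<^sup>2) has_sum (norm x)\<^sup>2) B"
proof -
  define r where "r F x = x - (\<Sum>e\<in>F. cinner x e *\<^sub>C e)" for F and x :: 'h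
  have r_sq: "(norm (r F x))\<^sup>2 = (norm x)\<^sup>2 - (\<Sum>e\<in>F. (cmod (cinner x e))\<^sup>2)" 
    if "finite F" "F \<subseteq> B" for F x
    using norm_diff_partial_expansion[OF that] by (simp add: r_def)
  \<comment> \<open>Remainders shrink as the index set grows, so approximations along two finite
    sets merge into one along their union.\<close>
  have r_le: "norm (r F x) \<le> norm (r G x)" if "finite F" "F \<subseteq> B" "G \<subseteq> F" for F G x
  proof (rule power2_le_imp_le)
    have "(\<Sum>e\<in>G. (cmod (cinner x e))\<^sup>2) \<le> (\<Sum>e\<in>F. (cmod (cinner x e))\<^sup>2)"
      using that by (intro sum_mono2) auto
    then show "(norm (r F x))\<^sup>2 \<le> (norm (r G x))\<^sup>2"
      using that finite_subset[OF that(3)] by (simp add: r_sq)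
  qed simp
  have r_le_norm: "norm (r F x) \<le> norm x" if "finite F" "F \<subseteq> B" for F x
    using r_le[OF that, of "{}" x] by (simp add: r_def)
  have r_add: "r F (x + y) = r F x + r F y" for F x y
    by (simp add: r_def cinner_add_left scaleC_add_left sum.distrib)
  have r_scale: "r F (c *\<^sub>C x) = c *\<^sub>C r F x" for F c x
    by (simp add: r_def cinner_scaleC_left scaleC_diff_right scaleC_sum_right scaleC_scaleC)
  define K where "K = {x\<in>H. \<forall>\<epsilon>>0. \<exists>F. finite F \<and> F \<subseteq> B \<and> norm (r F x) < \<epsilon>}"
  have "closed_csubspace K"
    unfolding closed_csubspace_def
  proof (intro conjI ballI allI)
    show "0 \<in> K"
      using closed_csubspaceD(1)[OF H] by (auto simp: K_def r_def intro!: exI[of _ "{}"])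
    show "x + y \<in> K" if "x \<in> K" "y \<in> K" for x y
    proof -
      have "\<exists>F. finite F \<and> F \<subseteq> B \<and> norm (r F (x + y)) < \<epsilon>" if \<epsilon>: "\<epsilon> > 0" for \<epsilon>
      proof -
        obtain F G where F: "finite F" "F \<subseteq> B" "norm (r F x) < \<epsilon> / 2"
          and G: "finite G" "G \<subseteq> B" "norm (r G y) < \<epsilon> / 2"
          using \<open>x \<in> K\<close> \<open>y \<in> K\<close> half_gt_zero[OF \<epsilon>] unfolding K_def by blast
        have "norm (r (F \<union> G) (x + y)) \<le> norm (r (F \<union> G) x) + norm (r (F \<union> G) y)"
          unfolding r_add by (rule norm_triangle_ineq)
        also have "\<dots> \<le> norm (r F x) + norm (r G y)" using F G by (intro add_mono r_le) auto
        finally show ?thesis using F G by (intro exI[of _ "F \<union> G"]) auto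
      qed
      then show ?thesis using that closed_csubspaceD(2)[OF H] by (auto simp: K_def)
    qed
    show "c *\<^sub>C x \<in> K" if "x \<in> K" for c x
    proof -
      have "\<exists>F. finite F \<and> F \<subseteq> B \<and> norm (r F (c *\<^sub>C x)) < \<epsilon>" if \<epsilon>: "\<epsilon> > 0" for \<epsilon>
      proof -
        have "0 < \<epsilon> / (cmod c + 1)" using \<epsilon> by (simp add: add_nonneg_pos)
        then obtain F where F: "finite F" "F \<subseteq> B" "norm (r F x) < \<epsilon> / (cmod c + 1)"
          using \<open>x \<in> K\<close> unfolding K_def by blast
        have "cmod c * norm (r F x) \<le> (cmod c + 1) * norm (r F x)" by (simp add: mult_right_mono)
        also have "\<dots> < \<epsilon>" using F(3) by (simp add: pos_less_divide_eq add_nonneg_pos mult.commute)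
        finally show ?thesis using F by (intro exI[of _ F]) (simp add: r_scale norm_scaleC)
      qed
      then show ?thesis using that closed_csubspaceD(3)[OF H] by (auto simp: K_def)
    qed
    show "closed K"
      unfolding closed_sequential_limits
    proof (intro allI impI, elim conjE)
      fix X l assume X: "\<forall>n. X n \<in> K" and l: "X \<longlonglongrightarrow> l"
      have "l \<in> H"
        using closed_sequentially[OF closed_csubspaceD(4)[OF H], of X l] X l by (auto simp: K_def)
      moreover have "\<exists>F. finite F \<and> F \<subseteq> B \<and> norm (r F l) < \<epsilon>" if \<epsilon>: "\<epsilon> > 0" for \<epsilon>
      proof -
        obtain n where n: "norm (X n - l) < \<epsilon> / 2"
          using LIMSEQ_D[OF l half_gt_zero[OF \<epsilon>]] by blast
        obtain F where F: "finite F" "F \<subseteq> B" "norm (r F (X n)) < \<epsilon> / 2"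
          using X half_gt_zero[OF \<epsilon>] unfolding K_def by blast
        have "norm (r F l) = norm (r F (X n) + r F (l - X n))" by (simp flip: r_add)
        also have "\<dots> \<le> norm (r F (X n)) + norm (l - X n)"
          using norm_triangle_ineq r_le_norm[OF F(1,2)] by (meson add_left_mono order_trans)
        finally show ?thesis using F n by (intro exI[of _ F]) (simp add: norm_minus_commute)
      qed
      ultimately show "l \<in> K" by (simp add: K_def)
    qed
  qed
  have BK: "e \<in> K" if e: "e \<in> B" for e
  proof -
    have "r {e} e = 0" by (simp add: r_def orthonormal_basis_cinner[OF e e] scaleC_one)
    then show ?thesis using e orthonormal_basis_in[OF e] unfolding K_def
      by (auto intro!: exI[of _ "{e}"])
  qed
  have pK: "proj K x \<in> K" by (rule proj_in[OF \<open>closed_csubspace K\<close>])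
  then have "x - proj K x \<in> H" using x closed_csubspaceD(6)[OF H] by (simp add: K_def)
  moreover have "cinner (x - proj K x) e = 0" if "e \<in> B" for e
    by (rule proj_orth[OF \<open>closed_csubspace K\<close> BK[OF that]])
  ultimately have "x - proj K x = 0" using B unfolding orthonormal_basis_def by blast
  then have xK: "x \<in> K" using pK by simp
  show ?thesis
    unfolding has_sum_def
  proof (rule tendstoI)
    fix \<epsilon> :: real assume \<epsilon>: "\<epsilon> > 0"
    obtain F where F: "finite F" "F \<subseteq> B" "norm (r F x) < sqrt \<epsilon>"
      using xK \<epsilon> unfolding K_def by (auto dest!: spec[of _ "sqrt \<epsilon>"])
    show "\<forall>\<^sub>F G in finite_subsets_at_top B. dist (\<Sum>e\<in>G. (cmod (cinner x e))\<^sup>2) ((norm x)\<^sup>2) < \<epsilon>"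
      unfolding eventually_finite_subsets_at_top
    proof (intro exI[of _ F] conjI allI impI F(1,2), elim conjE)
      fix G assume G: "finite G" "F \<subseteq> G" "G \<subseteq> B"
      have "(norm (r G x))\<^sup>2 < (sqrt \<epsilon>)\<^sup>2"
        using r_le[OF G(1,3,2), of x] F(3) by (intro power_strict_mono) auto
      then show "dist (\<Sum>e\<in>G. (cmod (cinner x e))\<^sup>2) ((norm x)\<^sup>2) < \<epsilon>"
        using \<epsilon> r_sq[OF G(1,3), of x] zero_le_power2[of "norm (r G x)"] real_sqrt_pow2[of \<epsilon>]
        unfolding dist_real_def by linarith
    qed
  qed
qed

end

lemma has_sum_finite_sum:
  fixes f :: "'b \<Rightarrow> 'a \<Rightarrow> 'c :: topological_comm_monoid_add"
  assumes "\<And>j. j \<in> J \<Longrightarrow> (f j has_sum s j) A"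
  shows "((\<lambda>x. \<Sum>j\<in>J. f j x) has_sum (\<Sum>j\<in>J. s j)) A"
  using assms by (induction J rule: infinite_finite_induct) (auto intro!: has_sum_add)

text \<open>Parseval evaluates the trace summand by summand in whichever basis \<open>SOME\<close>
  picks. Both traces in the curvature have this shape, with vectors \<open>u b\<close> that are in
  general not orthogonal.\<close>

lemma trace_op_finite_rank:
  fixes H :: "'h :: complex_hilbert set"
  assumes H: "closed_csubspace H" and u: "\<And>b. b \<in> F \<Longrightarrow> u b \<in> H"
    and A: "\<And>h. h \<in> H \<Longrightarrow> A h = (\<Sum>b\<in>F. cinner h (u b) *\<^sub>C u b)"
  shows "trace_op H A = of_real (\<Sum>b\<in>F. (norm (u b))\<^sup>2)"
proof -
  define B where "B = (SOME B. orthonormal_basis H B)"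
  have B: "orthonormal_basis H B"
    unfolding B_def by (rule someI_ex[OF orthonormal_basis_exists[OF H]])
  have "((\<lambda>e. \<Sum>b\<in>F. complex_of_real ((cmod (cinner (u b) e))\<^sup>2)) has_sum
      (\<Sum>b\<in>F. of_real ((norm (u b))\<^sup>2))) B"
    by (intro has_sum_finite_sum has_sum_of_real parseval[OF H B] u)
  moreover have "cinner (A e) e = (\<Sum>b\<in>F. of_real ((cmod (cinner (u b) e))\<^sup>2))" if "e \<in> B" for e
  proof -
    have "cinner e (u b) * cinner (u b) e = of_real ((cmod (cinner (u b) e))\<^sup>2)" for b
      using complex_norm_square[of "cinner (u b) e"] cinner_commute[of e "u b"] by (simp add: mult.commute)
    then show ?thesis
      by (simp add: A[OF orthonormal_basis_in[OF H B that]] cinner_sum_left cinner_scaleC_left)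
  qed
  ultimately have "((\<lambda>e. cinner (A e) e) has_sum (\<Sum>b\<in>F. of_real ((norm (u b))\<^sup>2))) B"
    by (subst has_sum_cong) auto
  then have "((\<lambda>e. cinner (A e) e) has_sum of_real (\<Sum>b\<in>F. (norm (u b))\<^sup>2)) B"
    by (simp only: of_real_sum)
  then show ?thesis unfolding trace_op_def B_def[symmetric] by (rule infsumI)
qed

section \<open>Backward shifts on tensor products of Fock spaces\<close>

text \<open>The shorter of two tuples of words is padded with empty words.\<close>

fun mult_words :: "'a list list \<Rightarrow> 'a list list \<Rightarrow> 'a list list" where
  "mult_words [] \<gamma> = \<gamma>"
| "mult_words (w # \<beta>) [] = w # \<beta>"
| "mult_words (w # \<beta>) (v # \<gamma>) = (w @ v) # mult_words \<beta> \<gamma>"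

text \<open>The empty words after place \<open>i\<close> are left out, so the encoding does not
  depend on the number of factors; the padding in \<open>mult_words\<close> supplies them.\<close>

definition word_at :: "nat \<Rightarrow> 'a list \<Rightarrow> 'a list list" where
  "word_at i w = replicate i [] @ [w]"

lemma length_word_at [simp]: "length (word_at i w) = Suc i"
  by (simp add: word_at_def)

lemma mult_words_Nil_right [simp]: "mult_words \<beta> [] = \<beta>"
  by (cases \<beta>) auto

lemma length_mult_words [simp]: "length (mult_words \<beta> \<gamma>) = max (length \<beta>) (length \<gamma>)"
  by (induction \<beta> \<gamma> rule: mult_words.induct) auto

lemma mult_words_assoc: "mult_words (mult_words a b) c = mult_words a (mult_words b c)"
proof (induction a b arbitrary: c rule: mult_words.induct)
  case (3 w \<beta> v \<gamma>)
  then show ?case by (cases c) auto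
qed auto

lemma nth_mult_words:
  "length \<beta> \<le> length \<gamma> \<Longrightarrow> i < length \<gamma> \<Longrightarrow>
    mult_words \<beta> \<gamma> ! i = (if i < length \<beta> then \<beta> ! i else []) @ \<gamma> ! i"
  by (induction \<beta> \<gamma> arbitrary: i rule: mult_words.induct) (auto simp: nth_Cons split: nat.splits)

text \<open>Left cancellation in each component. The length conditions matter: by padding,
  \<open>[[]]\<close> times \<open>[]\<close> equals \<open>[[]]\<close> times
  \<open>[[]]\<close>.\<close>

lemma mult_words_inject:
  assumes "length \<beta> \<le> length \<gamma>" "length \<beta> \<le> length \<delta>" "mult_words \<beta> \<gamma> = mult_words \<beta> \<delta>"
  shows "\<gamma> = \<delta>"
proof (rule nth_equalityI)
  show len: "length \<gamma> = length \<delta>"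
    using assms(1,2) arg_cong[OF assms(3), of length] by simp
  show "\<gamma> ! i = \<delta> ! i" if "i < length \<gamma>" for i
    using arg_cong[OF assms(3), of "\<lambda>\<alpha>. \<alpha> ! i"] that len assms(1,2) by (simp add: nth_mult_words)
qed

lemma mult_words_word_at:
  "i < length \<gamma> \<Longrightarrow> mult_words (word_at i w) \<gamma> = \<gamma>[i := w @ \<gamma> ! i]"
  unfolding word_at_def
proof (induction i arbitrary: \<gamma>)
  case 0
  then show ?case by (cases \<gamma>) auto
next
  case (Suc i)
  then show ?case by (cases \<gamma>) auto
qed

lemma mult_words_word_at_word_at:
  "mult_words (word_at i v) (word_at i w) = word_at i (v @ w)"
  by (subst mult_words_word_at) (auto simp: word_at_def list_update_append nth_append)

lemma mult_words_replicate_left: "i \<le> length \<gamma> \<Longrightarrow> mult_words (replicate i []) \<gamma> = \<gamma>"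
proof (induction i arbitrary: \<gamma>)
  case (Suc i)
  then show ?case by (cases \<gamma>) auto
qed simp

lemma mult_words_replicate_right: "i \<le> length \<beta> \<Longrightarrow> mult_words \<beta> (replicate i []) = \<beta>"
proof (induction i arbitrary: \<beta>)
  case (Suc i)
  then show ?case by (cases \<beta>) auto
qed simp

lemma multiwords_iff:
  "\<alpha> \<in> multiwords ns \<longleftrightarrow> length \<alpha> = length ns \<and> (\<forall>i<length ns. set (\<alpha> ! i) \<subseteq> {..<ns ! i})"
  by (auto simp: multiwords_def list_all2_conv_all_nth)

lemma length_multiwords: "\<alpha> \<in> multiwords ns \<Longrightarrow> length \<alpha> = length ns"
  by (simp add: multiwords_iff)

lemma vacuum_in_multiwords: "replicate (length ns) [] \<in> multiwords ns"
  by (simp add: multiwords_iff)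

lemma mult_words_in_multiwordsD:
  assumes "mult_words \<beta> \<gamma> \<in> multiwords ns" "length \<beta> \<le> length \<gamma>"
  shows "\<gamma> \<in> multiwords ns"
proof -
  have len: "length \<gamma> = length ns" using assms by (simp add: multiwords_iff)
  have "set (\<gamma> ! i) \<subseteq> {..<ns ! i}" if i: "i < length ns" for i
  proof -
    have "set (mult_words \<beta> \<gamma> ! i) \<subseteq> {..<ns ! i}" using assms(1) i by (simp add: multiwords_iff)
    then show ?thesis using nth_mult_words[OF assms(2), of i] i len by simp
  qed
  then show ?thesis using len by (simp add: multiwords_iff)
qed

lemma word_at_multiwords:
  "i < length ns \<Longrightarrow> set w \<subseteq> {..<ns ! i} \<Longrightarrow> \<gamma> \<in> multiwords ns \<Longrightarrow>
    mult_words (word_at i w) \<gamma> \<in> multiwords ns"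
  by (auto simp: mult_words_word_at multiwords_iff nth_list_update)

text \<open>\<open>backshift \<beta>\<close> is the adjoint of the product of the shifts along the words of \<open>\<beta>\<close>.\<close>

lift_definition backshift ::
  "nat list list \<Rightarrow> (nat list list, 'h :: complex_hilbert) hsum \<Rightarrow> (nat list list, 'h) hsum"
  is "\<lambda>\<beta> f \<gamma>. if length \<beta> \<le> length \<gamma> then f (mult_words \<beta> \<gamma>) else 0"
proof -
  fix \<beta> :: "nat list list" and f :: "nat list list \<Rightarrow> 'h"
  assume f: "(\<lambda>\<alpha>. (norm (f \<alpha>))\<^sup>2) summable_on UNIV"
  let ?A = "{\<gamma> :: nat list list. length \<beta> \<le> length \<gamma>}"
  have inj: "inj_on (mult_words \<beta>) ?A"
    by (rule inj_onI) (auto dest: mult_words_inject)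
  have "(\<lambda>\<alpha>. (norm (f \<alpha>))\<^sup>2) summable_on mult_words \<beta> ` ?A"
    using f by (rule summable_on_subset_banach) simp
  then have "(\<lambda>\<gamma>. (norm (f (mult_words \<beta> \<gamma>)))\<^sup>2) summable_on ?A"
    using inj by (simp add: summable_on_reindex o_def)
  also have "?this \<longleftrightarrow> (\<lambda>\<gamma>. (norm (if length \<beta> \<le> length \<gamma> then f (mult_words \<beta> \<gamma>) else 0))\<^sup>2) summable_on UNIV"
    by (rule summable_on_cong_neutral) auto
  finally show "(\<lambda>\<gamma>. (norm (if length \<beta> \<le> length \<gamma> then f (mult_words \<beta> \<gamma>) else 0))\<^sup>2) summable_on UNIV" .
qed

lemma backshift_add: "backshift \<beta> (x + y) = backshift \<beta> x + backshift \<beta> y"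
  by (rule hsum_eqI) (simp add: backshift.rep_eq plus_hsum.rep_eq)

lemma backshift_scaleC: "backshift \<beta> (c *\<^sub>C x) = c *\<^sub>C backshift \<beta> x"
  by (rule hsum_eqI) (simp add: backshift.rep_eq scaleC_hsum.rep_eq scaleC_zero_right)

text \<open>Adjoints reverse products, so the word that acts first ends up on the left.\<close>

lemma backshift_backshift: "backshift \<beta> (backshift \<alpha> x) = backshift (mult_words \<alpha> \<beta>) x"
  by (rule hsum_eqI) (auto simp: backshift.rep_eq mult_words_assoc)

text \<open>The index set is the cylinder of tuples beginning with \<beta> componentwise. Different
  words of equal length in one place thus see disjoint parts of \<open>x\<close>.\<close>

lemma norm_backshift_sq:
  "(norm (backshift \<beta> x))\<^sup>2 =
    (\<Sum>\<^sub>\<infinity>\<alpha>\<in>mult_words \<beta> ` {\<gamma>. length \<beta> \<le> length \<gamma>}. (norm (coord x \<alpha>))\<^sup>2)"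
proof -
  have inj: "inj_on (mult_words \<beta>) {\<gamma>. length \<beta> \<le> length \<gamma>}"
    by (rule inj_onI) (auto dest: mult_words_inject)
  have "(norm (backshift \<beta> x))\<^sup>2 = (\<Sum>\<^sub>\<infinity>\<gamma>\<in>{\<gamma>. length \<beta> \<le> length \<gamma>}. (norm (coord x (mult_words \<beta> \<gamma>)))\<^sup>2)"
    unfolding norm_hsum_sq by (rule infsum_cong_neutral) (auto simp: backshift.rep_eq)
  then show ?thesis by (simp add: infsum_reindex[OF inj] o_def)
qed

lemma norm_backshift_le: "norm (backshift \<beta> x) \<le> norm x"
proof (rule power2_le_imp_le)
  show "(norm (backshift \<beta> x))\<^sup>2 \<le> (norm x)\<^sup>2"
    unfolding norm_backshift_sq
    by (subst norm_hsum_sq, rule infsum_mono2)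
      (auto intro: summable_coord summable_on_subset_banach[OF summable_coord])
qed simp

lemma cinner_basis_vec: "cinner x (basis_vec \<alpha>) = coord x \<alpha>"
proof -
  have "cinner x (basis_vec \<alpha>) = (\<Sum>\<^sub>\<infinity>\<beta>\<in>{\<alpha>}. coord x \<beta>)"
    unfolding cinner_hsum_def
    by (rule infsum_cong_neutral) (auto simp: single.rep_eq cinner_complex_def)
  then show ?thesis by simp
qed

lemma cinner_shift:
  fixes x y :: "(nat list list, 'h :: complex_hilbert) hsum"
  shows "cinner (shift i j x) y = cinner x (backshift (word_at i [j]) y)"
proof -
  let ?A = "{\<alpha> :: nat list list. i < length \<alpha> \<and> \<alpha> ! i \<noteq> [] \<and> hd (\<alpha> ! i) = j}"
  let ?B = "{\<gamma> :: nat list list. i < length \<gamma>}"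
  have bij: "bij_betw (\<lambda>\<gamma>. \<gamma>[i := j # \<gamma> ! i]) ?B ?A"
    by (rule bij_betw_byWitness[where f' = "\<lambda>\<alpha>. \<alpha>[i := tl (\<alpha> ! i)]"]) auto
  have "cinner (shift i j x) y = (\<Sum>\<^sub>\<infinity>\<alpha>\<in>?A. cinner (coord x (\<alpha>[i := tl (\<alpha> ! i)])) (coord y \<alpha>))"
    unfolding cinner_hsum_def by (rule infsum_cong_neutral) (auto simp: shift.rep_eq)
  also have "\<dots> = (\<Sum>\<^sub>\<infinity>\<gamma>\<in>?B. cinner (coord x \<gamma>) (coord y (\<gamma>[i := j # \<gamma> ! i])))"
    by (subst infsum_reindex_bij_betw[OF bij, symmetric]) (auto intro!: infsum_cong)
  also have "\<dots> = cinner x (backshift (word_at i [j]) y)"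
    unfolding cinner_hsum_def
    by (rule infsum_cong_neutral) (auto simp: backshift.rep_eq mult_words_word_at)
  finally show ?thesis .
qed

lemma shift_add: "shift i j (x + y) = shift i j x + shift i j y"
  by (rule hsum_eqI) (simp add: shift.rep_eq plus_hsum.rep_eq)

lemma shift_scaleC: "shift i j (c *\<^sub>C x) = c *\<^sub>C shift i j x"
  by (rule hsum_eqI) (simp add: shift.rep_eq scaleC_hsum.rep_eq scaleC_zero_right)

lemma norm_shift_le: "norm (shift i j x) \<le> norm x"
proof (cases "shift i j x = 0")
  case False
  have "(norm (shift i j x))\<^sup>2 = Re (cinner x (backshift (word_at i [j]) (shift i j x)))"
    by (simp flip: Re_cinner_same add: cinner_shift)
  also have "\<dots> \<le> norm x * norm (backshift (word_at i [j]) (shift i j x))"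
    using norm_cinner_le complex_Re_le_cmod order_trans by blast
  also have "\<dots> \<le> norm x * norm (shift i j x)"
    by (intro mult_left_mono norm_backshift_le) auto
  finally show ?thesis using False by (simp add: power2_eq_square)
qed simp

lemma shift_commute:
  assumes "s \<noteq> t"
  shows "shift s a (shift t b x) = shift t b (shift s a x)"
  by (rule hsum_eqI) (use assms in \<open>auto simp: shift.rep_eq list_update_swap\<close>)

lemma closed_csubspace_fock: "closed_csubspace (fock ns)"
proof -
  have "closed (fock ns)"
    unfolding closed_sequential_limits
  proof (intro allI impI, elim conjE)
    fix X l assume X: "\<forall>n. X n \<in> fock ns" and l: "X \<longlonglongrightarrow> l"
    have "coord l \<alpha> = 0" if "\<alpha> \<notin> multiwords ns" for \<alpha>
    proof (rule LIMSEQ_unique)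
      show "(\<lambda>n. cinner (X n) (basis_vec \<alpha>)) \<longlonglongrightarrow> coord l \<alpha>"
        unfolding cinner_basis_vec[symmetric] by (intro tendsto_cinner l tendsto_const)
      show "(\<lambda>n. cinner (X n) (basis_vec \<alpha>)) \<longlonglongrightarrow> 0"
        using X that by (simp add: cinner_basis_vec fock_def)
    qed
    then show "l \<in> fock ns" by (simp add: fock_def)
  qed
  then show ?thesis
    by (auto simp: closed_csubspace_def fock_def zero_hsum.rep_eq plus_hsum.rep_eq
        scaleC_hsum.rep_eq scaleC_complex_def)
qed

lemma fock_coord_zero: "x \<in> fock ns \<Longrightarrow> \<alpha> \<notin> multiwords ns \<Longrightarrow> coord x \<alpha> = 0"
  by (simp add: fock_def)

lemma basis_vec_in_fock: "\<alpha> \<in> multiwords ns \<Longrightarrow> basis_vec \<alpha> \<in> fock ns"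
  by (auto simp: fock_def single.rep_eq)

lemma backshift_in_fock: "x \<in> fock ns \<Longrightarrow> backshift \<beta> x \<in> fock ns"
  using mult_words_in_multiwordsD[of \<beta> _ ns] by (auto simp: fock_def backshift.rep_eq)

lemma shift_in_fock:
  assumes "x \<in> fock ns" and ij: "i < length ns" "j < ns ! i"
  shows "shift i j x \<in> fock ns"
proof -
  have "\<alpha> \<in> multiwords ns"
    if "i < length \<alpha>" "\<alpha> ! i \<noteq> []" "hd (\<alpha> ! i) = j" "\<alpha>[i := tl (\<alpha> ! i)] \<in> multiwords ns" for \<alpha>
  proof -
    have "mult_words (word_at i [j]) (\<alpha>[i := tl (\<alpha> ! i)]) \<in> multiwords ns"
      by (rule word_at_multiwords) (use ij that in auto)
    moreover have "mult_words (word_at i [j]) (\<alpha>[i := tl (\<alpha> ! i)]) = \<alpha>"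
    proof (subst mult_words_word_at)
      have "[j] @ tl (\<alpha> ! i) = \<alpha> ! i" using that by (cases "\<alpha> ! i") auto
      then show "\<alpha>[i := tl (\<alpha> ! i), i := [j] @ \<alpha>[i := tl (\<alpha> ! i)] ! i] = \<alpha>"
        using that(1) by (simp only: nth_list_update_eq list_update_overwrite list_update_id)
    qed (use that in simp)
    ultimately show ?thesis by simp
  qed
  then show ?thesis using assms by (auto simp: fock_def shift.rep_eq)
qed

lemma backshift_vacuum:
  assumes "x \<in> fock ns" shows "backshift (replicate (length ns) []) x = x"
  by (rule hsum_eqI)
    (use assms in \<open>auto simp: backshift.rep_eq mult_words_replicate_left fock_def multiwords_iff\<close>)

section \<open>Tails of sums, totality of the word basis, and decay along long words\<close>

lemma summable_tail:
  fixes f :: "'a \<Rightarrow> real"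
  assumes f: "f summable_on A" and pos: "\<And>x. x \<in> A \<Longrightarrow> 0 \<le> f x" and "0 < \<epsilon>"
  obtains F where "finite F" "F \<subseteq> A" "\<And>B. B \<subseteq> A \<Longrightarrow> B \<inter> F = {} \<Longrightarrow> infsum f B < \<epsilon>"
proof -
  obtain F where F: "finite F" "F \<subseteq> A" "dist (sum f F) (infsum f A) \<le> \<epsilon> / 2"
    using infsum_finite_approximation[OF f, of "\<epsilon> / 2"] \<open>0 < \<epsilon>\<close> by auto
  have "infsum f B < \<epsilon>" if B: "B \<subseteq> A" "B \<inter> F = {}" for B
  proof -
    have fB: "f summable_on B" by (rule summable_on_subset_banach[OF f B(1)])
    have "infsum f B + sum f F = infsum f (B \<union> F)"
      using infsum_Un_disjoint[OF fB summable_on_finite[OF F(1), of f] B(2)] F(1) by simp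
    also have "\<dots> \<le> infsum f A"
      using B F pos by (intro infsum_mono2 f summable_on_subset_banach[OF f]) auto
    also have "\<dots> \<le> sum f F + \<epsilon> / 2"
      using F(3) unfolding dist_real_def by linarith
    finally show ?thesis using \<open>0 < \<epsilon>\<close> by simp
  qed
  then show ?thesis using that F by blast
qed

lemma coord_sum: "coord (\<Sum>s\<in>I. f s) \<alpha> = (\<Sum>s\<in>I. coord (f s) \<alpha>)"
  by (induction I rule: infinite_finite_induct) (simp_all add: zero_hsum.rep_eq plus_hsum.rep_eq)

text \<open>Totality in the form required of the pivot sequence in the Cholesky decomposition: an
  enumeration by all natural numbers, with 0 at codes of inadmissible tuples.\<close>

lemma fock_total:
  assumes x: "x \<in> fock ns" and \<epsilon>: "0 < \<epsilon>"
  shows "\<exists>n c. norm (x - (\<Sum>s<n. c s *\<^sub>C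
    (if from_nat s \<in> multiwords ns then basis_vec (from_nat s) else 0))) < \<epsilon>"
proof -
  define e :: "nat \<Rightarrow> (nat list list, complex) hsum"
    where "e s = (if from_nat s \<in> multiwords ns then basis_vec (from_nat s) else 0)" for s
  obtain F where F: "finite F"
    "\<And>B. B \<inter> F = {} \<Longrightarrow> (\<Sum>\<^sub>\<infinity>\<alpha>\<in>B. (norm (coord x \<alpha>))\<^sup>2) < \<epsilon>\<^sup>2"
    using summable_tail[OF summable_coord[of x], of "\<epsilon>\<^sup>2"] \<epsilon> by auto
  define n where "n = Suc (Max (to_nat ` F))"
  \<comment> \<open>\<open>from_nat\<close> may decode several numbers to the same tuple; keeping
    only the canonical code counts every basis vector once.\<close>
  define c where "c s = (if s = to_nat (from_nat s :: nat list list) then coord x (from_nat s) else 0)" for s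
  define y where "y = (\<Sum>s<n. c s *\<^sub>C e s)"
  have coord_e: "coord (c s *\<^sub>C e s) \<alpha> = (if s = to_nat \<alpha> then coord x \<alpha> else 0)" for s \<alpha>
    using x by (auto simp: scaleC_hsum.rep_eq scaleC_complex_def e_def c_def single.rep_eq
        zero_hsum.rep_eq fock_def)
  have coord_y: "coord y \<alpha> = (if to_nat \<alpha> < n then coord x \<alpha> else 0)" for \<alpha>
    unfolding y_def coord_sum coord_e by simp
  have "{\<alpha>. n \<le> to_nat \<alpha>} \<inter> F = {}"
  proof (intro equals0I, elim IntE CollectE)
    fix \<alpha> assume "\<alpha> \<in> F" "n \<le> to_nat \<alpha>"
    moreover from this have "to_nat \<alpha> \<le> Max (to_nat ` F)" using F(1) by simp
    ultimately show False by (simp add: n_def)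
  qed
  have "(norm (x - y))\<^sup>2 = (\<Sum>\<^sub>\<infinity>\<alpha>\<in>{\<alpha>. n \<le> to_nat \<alpha>}. (norm (coord x \<alpha>))\<^sup>2)"
    unfolding norm_hsum_sq
    by (rule infsum_cong_neutral) (auto simp: minus_hsum.rep_eq coord_y)
  also have "\<dots> < \<epsilon>\<^sup>2"
    by (rule F(2)) fact
  finally have "norm (x - y) < \<epsilon>" using \<epsilon> by (simp add: power_less_imp_less_base)
  then show ?thesis unfolding y_def e_def by blast
qed

text \<open>For nonnegative terms, convergence along one exhausting chain of finite sets is
  unconditional convergence.\<close>

lemma has_sum_exhaustion:
  fixes g :: "'a \<Rightarrow> real"
  assumes pos: "\<And>x. x \<in> (\<Union>m. A m) \<Longrightarrow> 0 \<le> g x" and fin: "\<And>m. finite (A m)" and inc: "incseq A"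
    and lim: "(\<lambda>m. sum g (A m)) \<longlonglongrightarrow> l"
  shows "(g has_sum l) (\<Union>m. A m)"
  unfolding has_sum_def
proof (rule increasing_tendsto)
  have mono: "sum g (A m) \<le> sum g (A n)" if "m \<le> n" for m n
    using that inc pos by (intro sum_mono2 fin) (auto simp: incseq_def)
  then have le: "sum g (A m) \<le> l" for m
    by (intro incseq_le[OF _ lim]) (simp add: incseq_def)
  have ub: "sum g F \<le> l" if F: "finite F" "F \<subseteq> (\<Union>m. A m)" for F
  proof -
    have "\<exists>m. F \<subseteq> A m"
      using F
    proof (induction F rule: finite_induct)
      case (insert a F)
      then obtain m n where "F \<subseteq> A m" "a \<in> A n" by auto
      moreover have "A m \<subseteq> A (max m n)" "A n \<subseteq> A (max m n)" using inc by (simp_all add: incseq_def)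
      ultimately have "insert a F \<subseteq> A (max m n)" by auto
      then show ?case ..
    qed simp
    then obtain m where "F \<subseteq> A m" ..
    then have "sum g F \<le> sum g (A m)" using pos by (intro sum_mono2 fin) auto
    then show ?thesis using le[of m] by simp
  qed
  show "\<forall>\<^sub>F F in finite_subsets_at_top (\<Union>m. A m). sum g F \<le> l"
    by (rule eventually_finite_subsets_at_top_weakI) (rule ub)
  fix r assume "r < l"
  then obtain m where m: "r < sum g (A m)"
    using order_tendstoD(1)[OF lim] by (auto simp: eventually_sequentially)
  show "\<forall>\<^sub>F F in finite_subsets_at_top (\<Union>m. A m). r < sum g F"
    unfolding eventually_finite_subsets_at_top
  proof (intro exI[of _ "A m"] conjI allI impI)
    fix F assume F: "finite F \<and> A m \<subseteq> F \<and> F \<subseteq> (\<Union>m. A m)"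
    have "0 \<le> g x" if "x \<in> F" for x
      by (rule pos) (rule subsetD[OF conjunct2[OF conjunct2[OF F]] that])
    then have "sum g (A m) \<le> sum g F" using F by (intro sum_mono2) auto
    then show "r < sum g F" using m by simp
  qed (use fin in auto)
qed

text \<open>The cylinders of distinct words of length m are disjoint, so the sum is at most the mass
  of \<open>x\<close> on tuples whose i-th word has length at least m, a tail of a convergent sum.
  This is purity of the shifts.\<close>

lemma sum_norm_backshift_tendsto_0:
  shows "(\<lambda>m. \<Sum>w | set w \<subseteq> {..<n} \<and> length w = m. (norm (backshift (word_at i w) x))\<^sup>2) \<longlonglongrightarrow> 0"
proof (rule LIMSEQ_I)
  fix \<epsilon> :: real assume \<epsilon>: "0 < \<epsilon>"
  let ?h = "\<lambda>\<alpha>. (norm (coord x \<alpha>))\<^sup>2"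
  let ?C = "\<lambda>w. mult_words (word_at i w) ` {\<gamma>. length (word_at i w) \<le> length \<gamma>}"
  obtain F where F: "finite F" "\<And>B. B \<inter> F = {} \<Longrightarrow> infsum ?h B < \<epsilon>"
    using summable_tail[OF summable_coord[of x], of \<epsilon>] \<epsilon> by auto
  \<comment> \<open>\<open>N\<close> exceeds the length of the i-th word of every tuple in
    \<open>F\<close>, so cylinders over words of length at least \<open>N\<close> miss
    \<open>F\<close>.\<close>
  define N where "N = Suc (Max ((\<lambda>\<alpha>. length (\<alpha> ! i)) ` F))"
  have "norm ((\<Sum>w | set w \<subseteq> {..<n} \<and> length w = m. (norm (backshift (word_at i w) x))\<^sup>2) - 0) < \<epsilon>"
    if m: "m \<ge> N" for m
  proof -
    let ?W = "{w. set w \<subseteq> {..<n} \<and> length w = m}"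
    have fin: "finite ?W" by (rule finite_lists_length_eq) simp
    have C: "i < length \<alpha> \<and> (\<exists>v. \<alpha> ! i = w @ v)" if "\<alpha> \<in> ?C w" for \<alpha> w
      using that by (auto simp: mult_words_word_at)
    have "(\<Sum>w\<in>?W. (norm (backshift (word_at i w) x))\<^sup>2) = (\<Sum>w\<in>?W. infsum ?h (?C w))"
      by (simp add: norm_backshift_sq)
    also have "\<dots> = infsum ?h (\<Union>w\<in>?W. ?C w)"
    proof (rule sum_infsum[OF fin])
      show "?h summable_on ?C w" for w
        by (rule summable_on_subset_banach[OF summable_coord]) simp
      show "?C v \<inter> ?C w = {}" if vw: "v \<in> ?W" "w \<in> ?W" "v \<noteq> w" for v w
      proof (rule ccontr)
        assume "?C v \<inter> ?C w \<noteq> {}"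
        then obtain \<alpha> where "\<alpha> \<in> ?C v" "\<alpha> \<in> ?C w" by blast
        then obtain a b where "\<alpha> ! i = v @ a" "\<alpha> ! i = w @ b" using C by metis
        then show False using vw by (metis (mono_tags, lifting) append_eq_append_conv mem_Collect_eq)
      qed
    qed
    also have "\<dots> < \<epsilon>"
    proof (rule F(2), rule ccontr)
      assume "(\<Union>w\<in>?W. ?C w) \<inter> F \<noteq> {}"
      then obtain w \<alpha> where w: "w \<in> ?W" "\<alpha> \<in> ?C w" "\<alpha> \<in> F" by blast
      then obtain v where "\<alpha> ! i = w @ v" using C by blast
      then have "m \<le> length (\<alpha> ! i)" using w(1) by auto
      moreover have "length (\<alpha> ! i) < N" using w(3) F(1) by (simp add: N_def less_Suc_eq_le)
      ultimately show False using m by simp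
    qed
    finally show ?thesis by (simp add: sum_nonneg)
  qed
  then show "\<exists>no. \<forall>m\<ge>no. norm ((\<Sum>w | set w \<subseteq> {..<n} \<and> length w = m. (norm (backshift (word_at i w) x))\<^sup>2) - 0) < \<epsilon>"
    by blast
qed

text \<open>Inverting \<open>id - \<Phi>\<close>: summing \<open>f(S\<^sub>w\<^sup>* x) - \<Sum>\<^sub>j f(S\<^sub>w\<^sub>j\<^sup>* x)\<close> over all words \<open>w\<close> telescopes.\<close>

lemma has_sum_telescope_words:
  fixes f g :: "(nat list list, complex) hsum \<Rightarrow> real"
  assumes g: "\<And>x. x \<in> fock ns \<Longrightarrow> g x = f x - (\<Sum>j<n. f (backshift (word_at i [j]) x))"
    and pos: "\<And>x. x \<in> fock ns \<Longrightarrow> 0 \<le> g x"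
    and bound: "\<And>x. x \<in> fock ns \<Longrightarrow> \<bar>f x\<bar> \<le> C * (norm x)\<^sup>2"
    and i: "i < length ns" and x: "x \<in> fock ns"
  shows "((\<lambda>w. g (backshift (word_at i w) x)) has_sum f x) {w. set w \<subseteq> {..<n}}"
proof -
  define W where "W m = {w :: nat list. set w \<subseteq> {..<n} \<and> length w = m}" for m
  define G where "G m = (\<Sum>w\<in>W m. f (backshift (word_at i w) x))" for m
  have finW: "finite (W m)" for m unfolding W_def by (rule finite_lists_length_eq) simp
  \<comment> \<open>Words grow on the right because the backward shift by the new letter acts after
    that of the word, and adjoints reverse products.\<close>
  have W_Suc: "W (Suc m) = (\<lambda>(w, j). w @ [j]) ` (W m \<times> {..<n})" for m
  proof (intro equalityI subsetI)
    fix v assume "v \<in> W (Suc m)"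
    then show "v \<in> (\<lambda>(w, j). w @ [j]) ` (W m \<times> {..<n})"
      by (cases v rule: rev_cases) (auto simp: W_def)
  qed (auto simp: W_def)
  have G_Suc: "G (Suc m) = (\<Sum>w\<in>W m. \<Sum>j<n. f (backshift (word_at i [j]) (backshift (word_at i w) x)))" for m
  proof -
    have inj: "inj_on (\<lambda>(w, j). w @ [j]) (W m \<times> {..<n})" by (auto simp: inj_on_def)
    show ?thesis
      unfolding G_def W_Suc sum.reindex[OF inj] sum.cartesian_product
      by (simp add: case_prod_unfold backshift_backshift mult_words_word_at_word_at)
  qed
  have layer: "(\<Sum>w\<in>W m. g (backshift (word_at i w) x)) = G m - G (Suc m)" for m
    unfolding G_Suc unfolding G_def sum_subtractf[symmetric]
    by (intro sum.cong refl g backshift_in_fock x)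
  have G0: "G 0 = f x"
  proof -
    have "W 0 = {[]}" by (auto simp: W_def)
    moreover have "backshift (word_at i []) x = x"
      by (rule hsum_eqI)
        (use x i in \<open>auto simp: backshift.rep_eq mult_words_word_at fock_def multiwords_iff\<close>)
    ultimately show ?thesis by (simp add: G_def)
  qed
  have "(\<lambda>m. C * (\<Sum>w\<in>W m. (norm (backshift (word_at i w) x))\<^sup>2)) \<longlonglongrightarrow> C * 0"
    unfolding W_def by (intro tendsto_intros sum_norm_backshift_tendsto_0)
  then have lim0: "(\<lambda>m. C * (\<Sum>w\<in>W m. (norm (backshift (word_at i w) x))\<^sup>2)) \<longlonglongrightarrow> 0" by simp
  \<comment> \<open>The telescoping remainder is controlled by the quadratic bound on
    \<open>f\<close> and the purity of the shifts.\<close>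
  have "G \<longlonglongrightarrow> 0"
  proof (rule Lim_null_comparison[OF _ lim0], intro always_eventually allI)
    fix m
    have "norm (G m) \<le> (\<Sum>w\<in>W m. C * (norm (backshift (word_at i w) x))\<^sup>2)"
      unfolding G_def by (intro sum_norm_le) (simp add: bound backshift_in_fock x)
    then show "norm (G m) \<le> C * (\<Sum>w\<in>W m. (norm (backshift (word_at i w) x))\<^sup>2)"
      by (simp add: sum_distrib_left)
  qed
  then have lim: "(\<lambda>m. f x - G m) \<longlonglongrightarrow> f x - 0" by (intro tendsto_intros)
  define A where "A m = (\<Union>l<m. W l)" for m
  have "((\<lambda>w. g (backshift (word_at i w) x)) has_sum f x) (\<Union>m. A m)"
  proof (rule has_sum_exhaustion)
    have "(\<Sum>w\<in>A m. g (backshift (word_at i w) x)) = (\<Sum>l<m. \<Sum>w\<in>W l. g (backshift (word_at i w) x))" for m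
      unfolding A_def by (rule sum.UNION_disjoint) (use finW in \<open>auto simp: W_def\<close>)
    also have "\<dots> m = f x - G m" for m
      unfolding layer by (simp add: sum_lessThan_telescope' G0)
    finally show "(\<lambda>m. \<Sum>w\<in>A m. g (backshift (word_at i w) x)) \<longlonglongrightarrow> f x"
      using lim by simp
    show "incseq A" by (auto simp: A_def incseq_def intro: order_less_le_trans)
  qed (use finW in \<open>auto simp: A_def pos backshift_in_fock x\<close>)
  moreover have "(\<Union>m. A m) = {w. set w \<subseteq> {..<n}}" by (auto simp: A_def W_def)
  ultimately show ?thesis by simp
qed

section \<open>Defect operators as sesquilinear forms\<close>

text \<open>The form of the operator obtained from \<open>I\<close> by applying \<open>id - \<Phi>\<^sub>i\<close> for all \<open>i \<in> L\<close>, where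
  \<open>\<Phi>\<^sub>i\<close> belongs to the shifts on the whole space.\<close>

definition vac_form ::
  "nat list \<Rightarrow> nat set \<Rightarrow> (nat list list, complex) hsum \<Rightarrow> (nat list list, complex) hsum \<Rightarrow> complex" where
  "vac_form ns L x y =
     (\<Sum>\<^sub>\<infinity>\<beta> | \<beta> \<in> multiwords ns \<and> (\<forall>i\<in>L. \<beta> ! i = []). coord x \<beta> * cnj (coord y \<beta>))"

lemma summable_coord_mult: "(\<lambda>\<beta>. coord x \<beta> * cnj (coord y \<beta>)) summable_on A"
  for x y :: "('i, complex) hsum"
  using summable_on_subset_banach[OF summable_cinner_coord[of x y], of A] by (simp add: cinner_complex_def)

lemma vac_form_empty: "x \<in> fock ns \<Longrightarrow> vac_form ns {} x y = cinner x y"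
  unfolding vac_form_def cinner_hsum_def
  by (rule infsum_cong_neutral) (auto simp: cinner_complex_def fock_def)

lemma multiwords_update:
  assumes "\<beta> \<in> multiwords ns" "i < length ns" "set w \<subseteq> {..<ns ! i}"
  shows "\<beta>[i := w] \<in> multiwords ns"
  unfolding multiwords_iff
proof (intro conjI allI impI)
  show "set (\<beta>[i := w] ! l) \<subseteq> {..<ns ! l}" if "l < length ns" for l
    using assms that by (cases "l = i") (simp_all add: multiwords_iff)
qed (use assms in \<open>simp add: multiwords_iff\<close>)

text \<open>Split the tuples with empty words over \<open>L\<close> by their i-th word: it is empty,
  or it begins with a letter j. The second class arises by prepending j to all tuples of the
  original class; these stay in the class because i is not in \<open>L\<close>.\<close>

lemma vac_form_insert:
  assumes i: "i < length ns" "i \<notin> L"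
  shows "vac_form ns (insert i L) x y = vac_form ns L x y -
    (\<Sum>j<ns ! i. vac_form ns L (backshift (word_at i [j]) x) (backshift (word_at i [j]) y))"
proof -
  let ?f = "\<lambda>\<beta>. coord x \<beta> * cnj (coord y \<beta>)"
  let ?W = "\<lambda>L. {\<beta>. \<beta> \<in> multiwords ns \<and> (\<forall>i\<in>L. \<beta> ! i = [])}"
  let ?g = "\<lambda>j \<gamma>. \<gamma>[i := j # \<gamma> ! i]"
  have 1: "vac_form ns L (backshift (word_at i [j]) x) (backshift (word_at i [j]) y) = infsum ?f (?g j ` ?W L)" for j
  proof -
    have "inj_on (?g j) (?W L)"
      by (rule inj_on_inverseI[where g = "\<lambda>\<alpha>. \<alpha>[i := tl (\<alpha> ! i)]"]) (use i in \<open>auto simp: multiwords_iff\<close>)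
    then have "infsum ?f (?g j ` ?W L) = (\<Sum>\<^sub>\<infinity>\<gamma>\<in>?W L. ?f (?g j \<gamma>))"
      by (simp add: infsum_reindex o_def)
    also have "\<dots> = vac_form ns L (backshift (word_at i [j]) x) (backshift (word_at i [j]) y)"
      unfolding vac_form_def
      by (rule infsum_cong) (use i in \<open>auto simp: backshift.rep_eq mult_words_word_at multiwords_iff\<close>)
    finally show ?thesis ..
  qed
  have 2: "?W L = ?W (insert i L) \<union> (\<Union>j<ns ! i. ?g j ` ?W L)"
  proof (intro equalityI subsetI)
    fix \<beta> assume \<beta>: "\<beta> \<in> ?W L"
    show "\<beta> \<in> ?W (insert i L) \<union> (\<Union>j<ns ! i. ?g j ` ?W L)"
    proof (cases "\<beta> ! i")
      case Nil
      then show ?thesis using \<beta> by auto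
    next
      case (Cons j w)
      have "set (\<beta> ! i) \<subseteq> {..<ns ! i}" using \<beta> i by (simp add: multiwords_iff)
      then have j: "j < ns ! i" "set w \<subseteq> {..<ns ! i}" using Cons by auto
      have "\<beta> = ?g j (\<beta>[i := w])"
        using Cons \<beta> i list_update_id[of \<beta> i] by (simp add: multiwords_iff)
      moreover have "\<beta>[i := w] \<in> ?W L"
      proof (intro CollectI conjI ballI)
        show "\<beta>[i := w] \<in> multiwords ns" using multiwords_update \<beta> i(1) j(2) by simp
        show "\<beta>[i := w] ! l = []" if "l \<in> L" for l
          using that \<beta> i(2) by (cases "l = i") simp_all
      qed
      ultimately show ?thesis using j(1) by blast
    qed
  next
    fix \<beta> assume "\<beta> \<in> ?W (insert i L) \<union> (\<Union>j<ns ! i. ?g j ` ?W L)"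
    then show "\<beta> \<in> ?W L"
    proof (elim UnE UN_E imageE)
      fix j \<gamma> assume j: "j \<in> {..<ns ! i}" and \<beta>: "\<beta> = ?g j \<gamma>" and \<gamma>: "\<gamma> \<in> ?W L"
      have "set (\<gamma> ! i) \<subseteq> {..<ns ! i}" using \<gamma> i(1) by (simp add: multiwords_iff)
      then have "\<beta> \<in> multiwords ns" unfolding \<beta> using \<gamma> i(1) j by (intro multiwords_update) auto
      moreover have "\<beta> ! l = []" if "l \<in> L" for l
        using that \<gamma> i(2) unfolding \<beta> by (cases "l = i") simp_all
      ultimately show "\<beta> \<in> ?W L" by simp
    qed auto
  qed
  have disj: "?W (insert i L) \<inter> (\<Union>j<ns ! i. ?g j ` ?W L) = {}"
    using i by (auto simp: multiwords_iff)
  have "vac_form ns L x y = infsum ?f (?W (insert i L)) + infsum ?f (\<Union>j<ns ! i. ?g j ` ?W L)"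
    unfolding vac_form_def
    by (subst 2, rule infsum_Un_disjoint[OF summable_coord_mult summable_coord_mult disj])
  also have "infsum ?f (\<Union>j<ns ! i. ?g j ` ?W L) = (\<Sum>j<ns ! i. infsum ?f (?g j ` ?W L))"
  proof (rule sum_infsum[symmetric])
    show "?g j ` ?W L \<inter> ?g j' ` ?W L = {}" if "j \<noteq> j'" for j j'
    proof (intro equals0I, elim IntE imageE)
      fix \<beta> \<gamma> \<gamma>' assume \<beta>: "\<beta> = ?g j \<gamma>" "\<beta> = ?g j' \<gamma>'" and "\<gamma> \<in> ?W L" "\<gamma>' \<in> ?W L"
      then have "i < length \<gamma>" "i < length \<gamma>'" using i by (auto simp: multiwords_iff)
      then have "\<beta> ! i = j # \<gamma> ! i" "\<beta> ! i = j' # \<gamma>' ! i" by (subst \<beta>, simp)+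
      then show False using that by simp
    qed
  qed (auto intro: summable_coord_mult)
  also have "infsum ?f (?W (insert i L)) = vac_form ns (insert i L) x y"
    by (simp add: vac_form_def)
  finally show ?thesis by (simp add: 1)
qed

text \<open>Only the vacuum coordinate survives, which is the source of the rank one defect of the
  compression.\<close>

lemma vac_form_full:
  "vac_form ns {..<length ns} x y =
    coord x (replicate (length ns) []) * cnj (coord y (replicate (length ns) []))"
proof -
  have "{\<beta>. \<beta> \<in> multiwords ns \<and> (\<forall>i\<in>{..<length ns}. \<beta> ! i = [])} = {replicate (length ns) []}"
    using vacuum_in_multiwords[of ns] by (auto simp: multiwords_iff intro: nth_equalityI)
  then show ?thesis by (simp add: vac_form_def)
qed

lemma vac_form_same: "\<exists>r\<ge>0. vac_form ns L x x = of_real r"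
proof (intro exI conjI)
  show "0 \<le> (\<Sum>\<^sub>\<infinity>\<beta> | \<beta> \<in> multiwords ns \<and> (\<forall>i\<in>L. \<beta> ! i = []). (norm (coord x \<beta>))\<^sup>2)"
    by (rule infsum_nonneg) simp
  have "((\<lambda>\<beta>. complex_of_real ((norm (coord x \<beta>))\<^sup>2)) has_sum
      of_real (\<Sum>\<^sub>\<infinity>\<beta> | \<beta> \<in> multiwords ns \<and> (\<forall>i\<in>L. \<beta> ! i = []). (norm (coord x \<beta>))\<^sup>2))
      {\<beta>. \<beta> \<in> multiwords ns \<and> (\<forall>i\<in>L. \<beta> ! i = [])}"
    by (intro has_sum_of_real has_sum_infsum summable_on_subset_banach[OF summable_coord]) simp
  then show "vac_form ns L x x =
      of_real (\<Sum>\<^sub>\<infinity>\<beta> | \<beta> \<in> multiwords ns \<and> (\<forall>i\<in>L. \<beta> ! i = []). (norm (coord x \<beta>))\<^sup>2)"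
    unfolding vac_form_def by (simp add: infsumI flip: complex_norm_square)
qed

text \<open>A crude bound that reduces summability of form values along an inner sequence to that of
  squared norms.\<close>

lemma cmod_vac_form_le: "cmod (vac_form ns L x y) \<le> (norm x)\<^sup>2 + (norm y)\<^sup>2"
proof -
  let ?A = "{\<beta>. \<beta> \<in> multiwords ns \<and> (\<forall>i\<in>L. \<beta> ! i = [])}"
  have s: "(\<lambda>\<beta>. (norm (coord x \<beta>))\<^sup>2 + (norm (coord y \<beta>))\<^sup>2) summable_on B" for B
    by (intro summable_on_add summable_on_subset_banach[OF summable_coord]) auto
  have "cmod (vac_form ns L x y) \<le> (\<Sum>\<^sub>\<infinity>\<beta>\<in>?A. (norm (coord x \<beta>))\<^sup>2 + (norm (coord y \<beta>))\<^sup>2)"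
    unfolding vac_form_def
  proof (rule norm_infsum_le)
    show "((\<lambda>\<beta>. coord x \<beta> * cnj (coord y \<beta>)) has_sum (\<Sum>\<^sub>\<infinity>\<beta>\<in>?A. coord x \<beta> * cnj (coord y \<beta>))) ?A"
      by (intro has_sum_infsum summable_coord_mult)
    show "((\<lambda>\<beta>. (norm (coord x \<beta>))\<^sup>2 + (norm (coord y \<beta>))\<^sup>2) has_sum
        (\<Sum>\<^sub>\<infinity>\<beta>\<in>?A. (norm (coord x \<beta>))\<^sup>2 + (norm (coord y \<beta>))\<^sup>2)) ?A"
      by (intro has_sum_infsum s)
    show "norm (coord x \<beta> * cnj (coord y \<beta>)) \<le> (norm (coord x \<beta>))\<^sup>2 + (norm (coord y \<beta>))\<^sup>2" for \<beta>
      using sum_squares_bound[of "norm (coord x \<beta>)" "norm (coord y \<beta>)"]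
        mult_nonneg_nonneg[OF norm_ge_zero[of "coord x \<beta>"] norm_ge_zero[of "coord y \<beta>"]]
      unfolding norm_mult complex_mod_cnj by linarith
  qed
  also have "\<dots> \<le> (\<Sum>\<^sub>\<infinity>\<beta>. (norm (coord x \<beta>))\<^sup>2 + (norm (coord y \<beta>))\<^sup>2)"
    by (rule infsum_mono2[OF s s]) auto
  also have "\<dots> = (norm x)\<^sup>2 + (norm y)\<^sup>2"
    unfolding norm_hsum_sq by (rule infsum_add[OF summable_coord summable_coord])
  finally show ?thesis .
qed

section \<open>Defect operators of a general tuple and their forms\<close>

definition defect_step ::
  "'h :: complex_hilbert set \<Rightarrow> nat list \<Rightarrow> (nat \<Rightarrow> nat \<Rightarrow> 'h \<Rightarrow> 'h) \<Rightarrow> nat \<Rightarrow> ('h \<Rightarrow> 'h) \<Rightarrow> 'h \<Rightarrow> 'h" where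
  "defect_step H ns X i Y = (\<lambda>h. Y h - Phi H (ns ! i) (X i) Y h)"

lemma Defect_eq_foldr: "Defect H ns X p = foldr (\<lambda>i. defect_step H ns X i ^^ p i) [0..<length ns]"
  unfolding Defect_def defect_step_def ..

context
  fixes H :: "'h :: complex_hilbert set" and ns and X :: "nat \<Rightarrow> nat \<Rightarrow> 'h \<Rightarrow> 'h"
  assumes H: "closed_csubspace H"
    and X: "\<And>i j. i < length ns \<Longrightarrow> j < ns ! i \<Longrightarrow> bounded_op H H (X i j)"
begin

lemma bounded_op_defect_step:
  assumes i: "i < length ns" and Y: "bounded_op H H Y"
  shows "bounded_op H H (defect_step H ns X i Y)"
  unfolding defect_step_def Phi_def
proof (intro bounded_op_diff[OF H Y] bounded_op_sum[OF H])
  fix j assume "j \<in> {..<ns ! i}"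
  then have Xj: "bounded_op H H (X i j)" using X i by simp
  show "bounded_op H H (\<lambda>h. X i j (Y (adj H (X i j) h)))"
    by (rule bounded_op_compose[OF bounded_op_compose[OF bounded_op_adj[OF H Xj] Y] Xj])
      (rule bounded_opD(1)[OF Xj])
qed

lemma cinner_defect_step:
  assumes i: "i < length ns" and Y: "bounded_op H H Y" and h: "h \<in> H" and g: "g \<in> H"
  shows "cinner (defect_step H ns X i Y h) g =
    cinner (Y h) g - (\<Sum>j<ns ! i. cinner (Y (adj H (X i j) h)) (adj H (X i j) g))"
proof -
  have "cinner (X i j (Y (adj H (X i j) h))) g = cinner (Y (adj H (X i j) h)) (adj H (X i j) g)"
    if "j < ns ! i" for j
    using cinner_adj_right[OF H X[OF i that], of "Y (adj H (X i j) h)" g]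
      bounded_opD(1)[OF Y adj_in[OF H X[OF i that]]] by simp
  then show ?thesis by (simp add: defect_step_def Phi_def cinner_diff_left cinner_sum_left)
qed

text \<open>A recognition principle: a family of forms that starts at the inner product and obeys
  the recursion of \<open>id - Phi\<close> computes all defects. It is applied to
  \<open>vac_form\<close> on the complement of \<open>M\<close> and to a series of such forms on
  \<open>M\<close>.\<close>

lemma Defect_form:
  assumes p: "\<And>i. i < length ns \<Longrightarrow> p i \<in> {0, 1}"
    and B0: "\<And>h g. h \<in> H \<Longrightarrow> g \<in> H \<Longrightarrow> B {} h g = cinner h g"
    and B: "\<And>i L h g. i < length ns \<Longrightarrow> i \<notin> L \<Longrightarrow> h \<in> H \<Longrightarrow> g \<in> H \<Longrightarrow>
      B (insert i L) h g = B L h g - (\<Sum>j<ns ! i. B L (adj H (X i j) h) (adj H (X i j) g))"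
  shows "bounded_op H H (Defect H ns X p (\<lambda>h. h))"
    and "h \<in> H \<Longrightarrow> g \<in> H \<Longrightarrow>
      cinner (Defect H ns X p (\<lambda>h. h) h) g = B {i. i < length ns \<and> p i = 1} h g"
proof -
  \<comment> \<open>The induction runs over lists with distinct entries, so each processed index is
    new to the index set of the form.\<close>
  have *: "bounded_op H H (foldr (\<lambda>i. defect_step H ns X i ^^ p i) l (\<lambda>h. h)) \<and>
      (\<forall>h\<in>H. \<forall>g\<in>H. cinner (foldr (\<lambda>i. defect_step H ns X i ^^ p i) l (\<lambda>h. h) h) g =
        B {i\<in>set l. p i = 1} h g)" (is "bounded_op H H (?Y l) \<and> _")
    if "distinct l" "set l \<subseteq> {..<length ns}" for l
    using that
  proof (induction l)
    case Nil
    then show ?case by (auto simp: B0 intro: bounded_opI[where B = 1])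
  next
    case (Cons i l)
    then have IH: "bounded_op H H (?Y l)" "\<And>h g. h \<in> H \<Longrightarrow> g \<in> H \<Longrightarrow> cinner (?Y l h) g = B {i\<in>set l. p i = 1} h g"
      and i: "i < length ns" "i \<notin> {i\<in>set l. p i = 1}" by auto
    show ?case
    proof (cases "p i = 0")
      case True
      then have Y: "?Y (i # l) = ?Y l" and L: "{j \<in> set (i # l). p j = 1} = {j\<in>set l. p j = 1}" by auto
      show ?thesis unfolding Y L by (intro conjI ballI IH)
    next
      case False
      then have pi: "p i = 1" using p[OF i(1)] by simp
      have Y: "?Y (i # l) = defect_step H ns X i (?Y l)" by (simp add: pi)
      have L: "{j \<in> set (i # l). p j = 1} = insert i {j\<in>set l. p j = 1}" using pi by auto
      have adjH: "adj H (X i j) h \<in> H" if "j < ns ! i" for j h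
        by (rule adj_in[OF H X[OF i(1) that]])
      have "cinner (defect_step H ns X i (?Y l) h) g = B (insert i {j\<in>set l. p j = 1}) h g"
        if hg: "h \<in> H" "g \<in> H" for h g
        unfolding cinner_defect_step[OF i(1) IH(1) hg] B[OF i hg]
        by (intro arg_cong2[where f = "(-)"] sum.cong IH hg adjH) auto
      then show ?thesis
        using bounded_op_defect_step[OF i(1) IH(1)] unfolding Y L by simp
    qed
  qed
  have set_eq: "{i \<in> set [0..<length ns]. p i = 1} = {i. i < length ns \<and> p i = 1}" by auto
  have sub: "set [0..<length ns] \<subseteq> {..<length ns}" by auto
  note ** = *[OF distinct_upt sub, folded Defect_eq_foldr, unfolded set_eq]
  show "bounded_op H H (Defect H ns X p (\<lambda>h. h))" using ** by simp
  show "cinner (Defect H ns X p (\<lambda>h. h) h) g = B {i. i < length ns \<and> p i = 1} h g"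
    if "h \<in> H" "g \<in> H" using ** that by simp
qed

end

text \<open>As \<open>sqrt_op\<close> is a definite description, uniqueness has to be shown. A
  positive root \<open>B\<close> kills the complement of \<open>u\<close> and maps \<open>u\<close>
  to a multiple of itself; the factor is nonnegative and its square is the squared norm of
  \<open>u\<close>.\<close>

lemma sqrt_op_rank_one:
  fixes H :: "'h :: complex_hilbert set"
  assumes H: "closed_csubspace H" and u: "u \<in> H" "u \<noteq> 0"
    and A: "\<And>h. h \<in> H \<Longrightarrow> A h = cinner h u *\<^sub>C u"
  shows "sqrt_op H A = (\<lambda>h. if h \<in> H then (cinner h u / of_real (norm u)) *\<^sub>C u else 0)"
    (is "_ = ?S")
proof -
  have uu: "cinner u u = of_real (norm u) * of_real (norm u)" by (simp add: cinner_same power2_eq_square)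
  have n0: "complex_of_real (norm u) \<noteq> 0" using u(2) by simp
  have "bounded_op H H (\<lambda>h. (cinner h u * (1 / of_real (norm u))) *\<^sub>C u)"
    by (rule bounded_op_rank_one[OF H u(1)])
  then have "bounded_op H H ?S"
    unfolding bounded_op_def using closed_csubspaceD(2,3)[OF H] by auto
  moreover have "Im (cinner (?S x) x) = 0 \<and> 0 \<le> Re (cinner (?S x) x)" if "x \<in> H" for x
  proof -
    have "cinner (?S x) x = of_real ((cmod (cinner x u))\<^sup>2 / norm u)"
      using that complex_norm_square[of "cinner x u"] cinner_commute[of u x]
      by (simp add: cinner_scaleC_left)
    then show ?thesis by simp
  qed
  ultimately have pos: "positive_op H ?S" by (simp add: positive_op_def)
  show ?thesis
    unfolding sqrt_op_def
  proof (rule the_equality)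
    show "positive_op H ?S \<and> (\<forall>x\<in>H. ?S (?S x) = A x) \<and> (\<forall>x. x \<notin> H \<longrightarrow> ?S x = 0)"
      using pos n0 by (auto simp: A u closed_csubspaceD(3)[OF H] cinner_scaleC_left uu)
    fix B assume B: "positive_op H B \<and> (\<forall>x\<in>H. B (B x) = A x) \<and> (\<forall>x. x \<notin> H \<longrightarrow> B x = 0)"
    then have Bpos: "positive_op H B" and BB: "\<And>x. x \<in> H \<Longrightarrow> B (B x) = A x" by auto
    note bB = bounded_opD[OF positive_op_bounded[OF Bpos]]
    \<comment> \<open>\<open>B\<close> is hermitian, so the squared norm of \<open>B z\<close> is
      the form of \<open>A\<close> at \<open>z\<close>.\<close>
    have kill: "B z = 0" if z: "z \<in> H" "cinner z u = 0" for z
    proof -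
      have "cinner (B z) (B z) = cinner (B (B z)) z"
        by (rule positive_op_hermitian[OF H Bpos bB(1)[OF z(1)] z(1), symmetric])
      also have "\<dots> = 0" by (simp add: BB A z scaleC_zero_left)
      finally show ?thesis by (rule cinner_eq_zero_imp)
    qed
    define c where "c = cinner (B u) u / cinner u u"
    define z where "z = B u - c *\<^sub>C u"
    have z: "z \<in> H" "cinner z u = 0" "cinner u z = 0"
    proof -
      show "z \<in> H" unfolding z_def by (intro closed_csubspaceD[OF H] bB u)
      show zu: "cinner z u = 0" using uu n0 by (simp add: z_def cinner_simps c_def)
      show "cinner u z = 0" using zu cinner_commute[of u z] by simp
    qed
    have "cinner (B u) z = cinner u (B z)" by (rule positive_op_hermitian[OF H Bpos u(1) z(1)])
    then have "cinner z z = 0" using z kill[OF z(1,2)] by (subst (1) z_def) (simp add: cinner_simps)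
    then have "z = 0" by (rule cinner_eq_zero_imp)
    then have Bu: "B u = c *\<^sub>C u" by (simp add: z_def)
    have "c = of_real (Re (cinner (B u) u) / (norm u)\<^sup>2)"
      using positive_op_same[OF Bpos u(1)] by (simp add: c_def cinner_same)
    then obtain r where r: "c = of_real r" "r \<ge> 0"
      using positive_op_nonneg[OF Bpos u(1)] by (metis divide_nonneg_nonneg zero_le_power2)
    have "B (B u) = (c * c) *\<^sub>C u" by (simp add: Bu bB(3)[OF u(1)] scaleC_scaleC)
    then have "(c * c) *\<^sub>C u = cinner u u *\<^sub>C u" using BB[OF u(1)] A[OF u(1)] by simp
    then have "cinner ((c * c) *\<^sub>C u) u = cinner (cinner u u *\<^sub>C u) u" by simp
    then have "c * c = cinner u u" using n0 uu by (simp add: cinner_scaleC_left)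
    then have "r * r = norm u * norm u" unfolding uu r(1) by (metis of_real_eq_iff of_real_mult)
    then have "r = norm u" using r(2) by (simp add: power2_eq_iff_nonneg flip: power2_eq_square)
    then have Bu: "B u = of_real (norm u) *\<^sub>C u" using Bu r(1) by simp
    show "B = ?S"
    proof
      fix h show "B h = ?S h"
      proof (cases "h \<in> H")
        case h: True
        define a where "a = cinner h u / cinner u u"
        have au: "a *\<^sub>C u \<in> H" by (rule closed_csubspaceD(3)[OF H u(1)])
        have "B (h - a *\<^sub>C u) = 0"
          using uu n0 by (intro kill closed_csubspaceD(6)[OF H] h au) (simp add: cinner_simps a_def)
        then have "B h = a *\<^sub>C B u"
          using bounded_op_diff_arg[OF H positive_op_bounded[OF Bpos] h au] bB(3)[OF u(1)] by simp
        then show ?thesis using h n0 by (simp add: Bu scaleC_scaleC a_def uu)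
      qed (use B in simp)
    qed
  qed
qed

section \<open>The compression to a coinvariant subspace\<close>

locale invariant_fock_subspace =
  fixes ns :: "nat list" and M :: "(nat list list, complex) hsum set"
  assumes M: "invariant_subspace ns M"
begin

lemma invariant_closed: "closed_csubspace M"
  and invariant_subset: "M \<subseteq> fock ns"
  and invariant_shift: "i < length ns \<Longrightarrow> j < ns ! i \<Longrightarrow> x \<in> M \<Longrightarrow> shift i j x \<in> M"
  using M by (auto simp: invariant_subspace_def)

abbreviation coinv :: "(nat list list, complex) hsum set" where
  "coinv \<equiv> ortho_compl (fock ns) M"

abbreviation compr :: "nat \<Rightarrow> nat \<Rightarrow> (nat list list, complex) hsum \<Rightarrow> (nat list list, complex) hsum" where
  "compr \<equiv> \<lambda>i j x. proj (ortho_compl (fock ns) M) (shift i j x)"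

abbreviation coinv_vec :: "nat list list \<Rightarrow> (nat list list, complex) hsum" where
  "coinv_vec \<beta> \<equiv> proj (ortho_compl (fock ns) M) (basis_vec \<beta>)"

lemma coinv_closed: "closed_csubspace coinv"
  by (rule closed_csubspace_ortho_compl[OF closed_csubspace_fock])

lemma coinv_subset: "coinv \<subseteq> fock ns"
  by (auto simp: ortho_compl_def)

lemma backshift_letter_in_coinv:
  assumes ij: "i < length ns" "j < ns ! i" and h: "h \<in> coinv"
  shows "backshift (word_at i [j]) h \<in> coinv"
proof -
  have "cinner (backshift (word_at i [j]) h) y = 0" if y: "y \<in> M" for y
  proof -
    have "cinner (shift i j y) h = 0"
      using h invariant_shift[OF ij y] cinner_commute[of "shift i j y" h] by (simp add: ortho_compl_def)
    then have "cinner y (backshift (word_at i [j]) h) = 0" by (simp add: cinner_shift)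
    then show ?thesis by (metis cinner_commute complex_cnj_zero)
  qed
  then show ?thesis using h by (simp add: ortho_compl_def backshift_in_fock)
qed

lemma backshift_word_in_coinv:
  assumes i: "i < length ns" and "set w \<subseteq> {..<ns ! i}" and h: "h \<in> coinv"
  shows "backshift (word_at i w) h \<in> coinv"
  using assms(2)
proof (induction w rule: rev_induct)
  case Nil
  have "mult_words (word_at i []) \<gamma> = \<gamma>" if "i < length \<gamma>" for \<gamma> :: "nat list list"
    using that by (simp add: mult_words_word_at)
  then have "backshift (word_at i []) h = h"
    using i h coinv_subset by (intro hsum_eqI) (auto simp: backshift.rep_eq fock_def multiwords_iff)
  then show ?case using h by simp
next
  case (snoc j w)
  have "backshift (word_at i (w @ [j])) h = backshift (word_at i [j]) (backshift (word_at i w) h)"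
    by (simp add: backshift_backshift mult_words_word_at_word_at)
  then show ?case using snoc backshift_letter_in_coinv[OF i] by simp
qed

lemma bounded_op_shift_invariant: "i < length ns \<Longrightarrow> j < ns ! i \<Longrightarrow> bounded_op M M (shift i j)"
  by (rule bounded_opI[where B = 1]) (simp_all add: invariant_shift shift_add shift_scaleC norm_shift_le)

lemma bounded_op_compr: "bounded_op H coinv (compr i j)"
proof (rule bounded_opI[where B = 1])
  show "norm (compr i j x) \<le> 1 * norm x" for x
    using order_trans[OF norm_proj_le[OF coinv_closed] norm_shift_le] by simp
qed (simp_all add: proj_in proj_add proj_scaleC shift_add shift_scaleC coinv_closed)

lemma adj_compr:
  assumes "i < length ns" "j < ns ! i" "h \<in> coinv"
  shows "adj coinv (compr i j) h = backshift (word_at i [j]) h"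
  by (rule adj_eqI[OF coinv_closed backshift_letter_in_coinv[OF assms]])
    (simp add: cinner_proj_left[OF coinv_closed assms(3)] cinner_shift)

text \<open>Backward shifts need not preserve \<open>M\<close>, so the projection stays, unlike in
  \<open>adj_compr\<close>.\<close>

lemma adj_shift_invariant:
  "adj M (shift i j) h = proj M (backshift (word_at i [j]) h)"
  by (rule adj_eqI[OF invariant_closed proj_in[OF invariant_closed]])
    (simp add: cinner_proj_right[OF invariant_closed] cinner_shift)

lemma adj_word_op_compr:
  assumes i: "i < length ns" and w: "set w \<subseteq> {..<ns ! i}" and h: "h \<in> coinv"
  shows "adj coinv (word_op (compr i) w) h = backshift (word_at i w) h"
proof (rule adj_eqI[OF coinv_closed backshift_word_in_coinv[OF assms]])
  fix z assume z: "z \<in> coinv"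
  \<comment> \<open>Letters cross the inner product one at a time. Each move replaces
    \<open>h\<close> by a backward shift of it, so \<open>h\<close> has to vary in the
    induction.\<close>
  have "word_op (compr i) w z \<in> coinv \<and>
      cinner (word_op (compr i) w z) h = cinner z (backshift (word_at i w) h)"
    using w h
  proof (induction w arbitrary: h)
    case Nil
    have "backshift (word_at i []) h = h"
      using i Nil coinv_subset
      by (intro hsum_eqI) (auto simp: backshift.rep_eq mult_words_word_at fock_def multiwords_iff)
    then show ?case using z by (simp add: word_op_def)
  next
    case (Cons j w)
    let ?y = "word_op (compr i) w z"
    have j: "j < ns ! i" and w: "set w \<subseteq> {..<ns ! i}" using Cons.prems by auto
    have Cons_eq: "word_op (compr i) (j # w) z = compr i j ?y" by (simp add: word_op_def)
    have h': "backshift (word_at i [j]) h \<in> coinv"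
      by (rule backshift_letter_in_coinv[OF i j Cons.prems(2)])
    have "cinner (compr i j ?y) h = cinner ?y (backshift (word_at i [j]) h)"
      by (simp add: cinner_proj_left[OF coinv_closed Cons.prems(2)] cinner_shift)
    also have "\<dots> = cinner z (backshift (word_at i (j # w)) h)"
      using Cons.IH[OF w h'] by (simp add: backshift_backshift mult_words_word_at_word_at)
    finally show ?case unfolding Cons_eq by (simp add: proj_in coinv_closed)
  qed
  then show "cinner (word_op (compr i) w z) h = cinner z (backshift (word_at i w) h)" ..
qed

text \<open>\<open>foldr\<close> lets the last index act first. Downward induction on
  \<open>i\<close> collects the words in the places from \<open>i\<close> on, each new word filling
  a place that was empty before.\<close>

lemma foldr_adj_word_op_compr:
  assumes \<beta>: "\<beta> \<in> multiwords ns" and h: "h \<in> coinv"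
  shows "foldr (\<lambda>i. adj coinv (word_op (compr i) (\<beta> ! i))) [0..<length ns] h = backshift \<beta> h"
    and "backshift \<beta> h \<in> coinv"
proof -
  have len: "length \<beta> = length ns" by (rule length_multiwords[OF \<beta>])
  have "foldr (\<lambda>i. adj coinv (word_op (compr i) (\<beta> ! i))) [i..<length ns] h =
      backshift (replicate i [] @ drop i \<beta>) h \<and> backshift (replicate i [] @ drop i \<beta>) h \<in> coinv"
    if "i \<le> length ns" for i
    using that
  proof (induction i rule: inc_induct)
    case base
    then show ?case using h coinv_subset by (simp add: len backshift_vacuum subset_iff)
  next
    case (step i)
    let ?x = "backshift (replicate (Suc i) [] @ drop (Suc i) \<beta>) h"
    have x: "?x \<in> coinv" using step.IH by simp
    have w: "set (\<beta> ! i) \<subseteq> {..<ns ! i}" using \<beta> step.hyps by (simp add: multiwords_iff)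
    have "mult_words (replicate (Suc i) [] @ drop (Suc i) \<beta>) (word_at i (\<beta> ! i)) = replicate i [] @ drop i \<beta>"
    proof -
      have "mult_words (replicate i [] @ [] # \<delta>) (replicate i [] @ [w]) = replicate i [] @ w # \<delta>"
        for \<delta> and w :: "nat list"
        by (induction i) auto
      moreover have "replicate (Suc i) [] @ \<delta> = replicate i [] @ [] # \<delta>" for \<delta> :: "nat list list"
        by (simp add: replicate_app_Cons_same)
      ultimately show ?thesis
        using Cons_nth_drop_Suc[of i \<beta>] step.hyps len by (simp only: word_at_def)
    qed
    then have *: "backshift (word_at i (\<beta> ! i)) ?x = backshift (replicate i [] @ drop i \<beta>) h"
      by (simp add: backshift_backshift)
    have "foldr (\<lambda>i. adj coinv (word_op (compr i) (\<beta> ! i))) [i..<length ns] h =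
        adj coinv (word_op (compr i) (\<beta> ! i)) ?x"
      using step by (simp add: upt_conv_Cons)
    also have "\<dots> = backshift (replicate i [] @ drop i \<beta>) h"
      unfolding adj_word_op_compr[OF step.hyps(2) w x] * ..
    finally show ?case
      using backshift_word_in_coinv[OF step.hyps(2) w x] * by simp
  qed
  from this[of 0] show "foldr (\<lambda>i. adj coinv (word_op (compr i) (\<beta> ! i))) [0..<length ns] h = backshift \<beta> h"
    "backshift \<beta> h \<in> coinv" by simp_all
qed

lemma cinner_coinv_vec: "h \<in> coinv \<Longrightarrow> cinner h (coinv_vec \<beta>) = coord h \<beta>"
  by (simp add: cinner_proj_right[OF coinv_closed] cinner_basis_vec)

text \<open>With Q the projection onto \<open>coinv\<close>, coinvariance gives Q S_\<gamma> = Q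
  S_\<gamma> Q, so the longer vector is the image of \<open>coinv_vec \<beta>\<close> under a
  contraction. The calculation tests this on the longer vector itself.\<close>

lemma norm_coinv_vec_mult_le:
  assumes \<gamma>: "\<gamma> \<in> multiwords ns" and \<beta>: "\<beta> \<in> multiwords ns"
  shows "norm (coinv_vec (mult_words \<gamma> \<beta>)) \<le> norm (coinv_vec \<beta>)"
proof -
  define h where "h = coinv_vec (mult_words \<gamma> \<beta>)"
  have h: "h \<in> coinv" by (simp add: h_def proj_in coinv_closed)
  have "(norm h)\<^sup>2 = Re (coord h (mult_words \<gamma> \<beta>))"
    using cinner_coinv_vec[OF h, of "mult_words \<gamma> \<beta>"] by (simp add: h_def flip: Re_cinner_same)
  also have "\<dots> = Re (cinner (backshift \<gamma> h) (coinv_vec \<beta>))"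
    by (simp add: cinner_coinv_vec foldr_adj_word_op_compr(2)[OF \<gamma> h] backshift.rep_eq
        length_multiwords[OF \<gamma>] length_multiwords[OF \<beta>])
  also have "\<dots> \<le> norm (backshift \<gamma> h) * norm (coinv_vec \<beta>)"
    using norm_cinner_le complex_Re_le_cmod order_trans by blast
  also have "\<dots> \<le> norm h * norm (coinv_vec \<beta>)"
    by (intro mult_right_mono norm_backshift_le) auto
  finally show ?thesis by (cases "h = 0") (simp_all add: power2_eq_square flip: h_def)
qed

abbreviation vac_vec :: "(nat list list, complex) hsum" where
  "vac_vec \<equiv> proj (ortho_compl (fock ns) M) (basis_vec (replicate (length ns) []))"

text \<open>The vacuum is cyclic: if \<open>vac_vec\<close> vanished, so would every
  \<open>coinv_vec\<close> by the preceding estimate, and these give the coordinates of all vectors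
  in \<open>coinv\<close>.\<close>

lemma vac_vec_nonzero:
  assumes "M \<noteq> fock ns" shows "vac_vec \<noteq> 0"
proof
  assume 0: "vac_vec = 0"
  have "coinv_vec \<beta> = 0" if "\<beta> \<in> multiwords ns" for \<beta>
    using norm_coinv_vec_mult_le[OF that vacuum_in_multiwords] 0
    by (simp add: mult_words_replicate_right length_multiwords[OF that])
  then have c0: "coord h \<beta> = 0" if "h \<in> coinv" for h \<beta>
    using cinner_coinv_vec[OF that, of \<beta>] fock_coord_zero[of h ns \<beta>] that coinv_subset
    by (cases "\<beta> \<in> multiwords ns") auto
  have coinv0: "h = 0" if "h \<in> coinv" for h
    by (rule hsum_eqI) (simp add: c0[OF that] zero_hsum.rep_eq)
  have "x \<in> M" if x: "x \<in> fock ns" for x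
  proof -
    have "proj coinv x = 0" by (rule coinv0) (simp add: proj_in coinv_closed)
    then have "x = proj M x"
      using proj_ortho_compl[OF closed_csubspace_fock invariant_closed invariant_subset x] by simp
    then show ?thesis by (metis proj_in invariant_closed)
  qed
  then show False using assms invariant_subset by blast
qed

text \<open>The adjoints on \<open>coinv\<close> are backward shifts, so \<open>vac_form\<close>
  obeys the recursion of the defects. At the full index set it is a product of vacuum coordinates,
  that is, of inner products with \<open>vac_vec\<close>.\<close>

lemma Delta_compr:
  assumes h: "h \<in> coinv"
  shows "Delta coinv ns compr h = cinner h vac_vec *\<^sub>C vac_vec"
proof -
  have X: "\<And>i j. bounded_op coinv coinv (compr i j)" by (rule bounded_op_compr)
  have fock: "x \<in> coinv \<Longrightarrow> x \<in> fock ns" for x using coinv_subset by blast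
  have p: "(1::nat) \<in> {0, 1}" by simp
  have B0: "vac_form ns {} h g = cinner h g" if "h \<in> coinv" for h g
    by (rule vac_form_empty[OF fock[OF that]])
  have B: "vac_form ns (insert i L) h g = vac_form ns L h g -
      (\<Sum>j<ns ! i. vac_form ns L (adj coinv (compr i j) h) (adj coinv (compr i j) g))"
    if "i < length ns" "i \<notin> L" "h \<in> coinv" "g \<in> coinv" for i L h g
    using that by (simp add: vac_form_insert adj_compr)
  have form: "bounded_op coinv coinv (Delta coinv ns compr)"
    "\<And>h g. h \<in> coinv \<Longrightarrow> g \<in> coinv \<Longrightarrow>
      cinner (Delta coinv ns compr h) g = vac_form ns {i. i < length ns \<and> (1::nat) = 1} h g"
    unfolding Delta_def
    by (rule Defect_form[where B = "vac_form ns", OF coinv_closed X p B0 B]; assumption)+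
  show ?thesis
  proof (rule cinner_separates[OF coinv_closed])
    show "Delta coinv ns compr h \<in> coinv" by (rule bounded_opD(1)[OF form(1) h])
    show "cinner h vac_vec *\<^sub>C vac_vec \<in> coinv"
      by (intro closed_csubspaceD(3)[OF coinv_closed] proj_in[OF coinv_closed])
    fix z assume z: "z \<in> coinv"
    have "{i. i < length ns \<and> (1::nat) = 1} = {..<length ns}" by auto
    then have "cinner (Delta coinv ns compr h) z = cinner h vac_vec * cnj (cinner z vac_vec)"
      using form(2)[OF h z] by (simp add: vac_form_full cinner_coinv_vec h z)
    then show "cinner z (Delta coinv ns compr h) = cinner z (cinner h vac_vec *\<^sub>C vac_vec)"
      using cinner_commute[of z "Delta coinv ns compr h"] by (simp add: cinner_scaleC_right)
  qed
qed

end

section \<open>Means over simplices\<close>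

text \<open>A slack coordinate turns the inequality into an equation, counted by stars and
  bars.\<close>

lemma card_simplex: "card {q :: nat list. length q = k \<and> sum_list q \<le> m} = (m + k) choose k"
proof -
  have "bij_betw (\<lambda>q. (m - sum_list q) # q) {q. length q = k \<and> sum_list q \<le> m}
      {l. length l = Suc k \<and> sum_list l = m}"
    by (rule bij_betw_byWitness[where f' = tl]) (auto simp: length_Suc_conv)
  then have "card {q. length q = k \<and> sum_list q \<le> m} = card {l :: nat list. length l = Suc k \<and> sum_list l = m}"
    by (rule bij_betw_same_card)
  also have "\<dots> = (m + k) choose m" by (simp add: card_length_sum_list)
  finally show ?thesis using binomial_symmetric[of k "m + k"] by simp
qed

lemma finite_simplex: "finite {q :: nat list. length q = k \<and> sum_list q \<le> m}"
proof (rule finite_subset)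
  show "{q :: nat list. length q = k \<and> sum_list q \<le> m} \<subseteq> {q. set q \<subseteq> {..m} \<and> length q = k}"
    using member_le_sum_list order_trans by fastforce
qed (rule finite_lists_length_eq, simp)

text \<open>Enlarging a simplex by a fixed amount does not change its size asymptotically; the ratio
  is a product of \<open>s\<close> one-step ratios, each tending to 1.\<close>

lemma binomial_ratio_tendsto_1:
  "(\<lambda>m. real ((m + k) choose k) / real ((m + s + k) choose k)) \<longlonglongrightarrow> 1"
proof (induction s)
  case 0
  have "(m + k) choose k \<noteq> 0" for m by simp
  then show ?case by simp
next
  case (Suc s)
  have pos: "(n + k) choose k > 0" for n by simp
  have "real ((m + s + k) choose k) / real ((m + Suc s + k) choose k) = real (m + s + 1) / real (m + s + 1 + k)" for m
  proof -
    have "(m + s + 1) * ((m + Suc s + k) choose k) = (m + s + 1 + k) * ((m + s + k) choose k)"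
      using binomial_absorb_comp[of "m + s + 1 + k" k] by simp
    then have "real (m + s + 1) * real ((m + Suc s + k) choose k) = real (m + s + 1 + k) * real ((m + s + k) choose k)"
      by (metis of_nat_mult)
    then show ?thesis using pos[of "m + Suc s"] by (simp add: field_simps)
  qed
  moreover have "(\<lambda>m. real (m + s + 1) / real (m + s + 1 + k)) \<longlonglongrightarrow> 1"
  proof -
    have "(\<lambda>m. real k / real (m + (s + 1 + k))) \<longlonglongrightarrow> 0"
      by (rule LIMSEQ_ignore_initial_segment[OF lim_const_over_n])
    then have "(\<lambda>m. 1 - real k / real (m + (s + 1 + k))) \<longlonglongrightarrow> 1 - 0" by (intro tendsto_intros)
    moreover have "1 - real k / real (m + (s + 1 + k)) = real (m + s + 1) / real (m + s + 1 + k)" for m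
      by (simp add: field_simps)
    ultimately show ?thesis by simp
  qed
  ultimately have "(\<lambda>m. real ((m + s + k) choose k) / real ((m + Suc s + k) choose k)) \<longlonglongrightarrow> 1"
    by simp
  then have "(\<lambda>m. (real ((m + k) choose k) / real ((m + s + k) choose k)) *
      (real ((m + s + k) choose k) / real ((m + Suc s + k) choose k))) \<longlonglongrightarrow> 1 * 1"
    by (intro tendsto_mult Suc)
  then show ?case using pos[of "_ + s"] by simp
qed

text \<open>Above a suitable \<open>Q\<close> the values are close to \<open>L\<close>. The
  remaining points of the simplex are a vanishing fraction, and on them the deviation is at most
  \<open>D\<close>.\<close>

lemma simplex_mean_tendsto:
  fixes a :: "nat list \<Rightarrow> real"
  assumes a: "(a \<longlongrightarrow> L) (multi_at_top k)" and bound: "\<And>q. length q = k \<Longrightarrow> \<bar>a q\<bar> \<le> B"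
  shows "(\<lambda>m. (\<Sum>q | length q = k \<and> sum_list q \<le> m. a q) / real ((m + k) choose k)) \<longlonglongrightarrow> L"
proof (rule LIMSEQ_I)
  fix \<epsilon> :: real assume \<epsilon>: "0 < \<epsilon>"
  define D where "D = B + \<bar>L\<bar> + 1"
  have "\<bar>a (replicate k 0)\<bar> \<le> B" by (rule bound) simp
  then have D: "0 < D" by (simp add: D_def)
  define S where "S m = {q :: nat list. length q = k \<and> sum_list q \<le> m}" for m
  define c where "c m = real ((m + k) choose k)" for m
  have c: "c m > 0" for m by (simp add: c_def)
  have card: "real (card (S m)) = c m" for m by (simp add: S_def c_def card_simplex)
  have fin: "finite (S m)" for m unfolding S_def by (rule finite_simplex)
  obtain Q where Q: "length Q = k" "\<And>q. list_all2 (\<le>) Q q \<Longrightarrow> \<bar>a q - L\<bar> < \<epsilon> / 2"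
    using tendstoD[OF a half_gt_zero[OF \<epsilon>]] unfolding eventually_multi_at_top dist_real_def by blast
  define s where "s = sum_list Q"
  have est: "\<bar>(\<Sum>q\<in>S (m + s). a q) / c (m + s) - L\<bar> \<le> \<epsilon> / 2 + D * (1 - c m / c (m + s))" for m
  proof -
    let ?G = "{q\<in>S (m + s). list_all2 (\<le>) Q q}"
    \<comment> \<open>Translation by \<open>Q\<close> moves the simplex of size m into the good part
      of the simplex of size m + s, so at most c (m + s) - c m points are bad.\<close>
    have "map2 (+) Q ` S m \<subseteq> ?G"
    proof (intro image_subsetI CollectI conjI)
      fix q assume q: "q \<in> S m"
      have "length l = length l' \<Longrightarrow> sum_list (map2 (+) l l') = sum_list l + sum_list l'" for l l' :: "nat list"
        by (induction l l' rule: list_induct2) auto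
      then show "map2 (+) Q q \<in> S (m + s)" using q Q(1) by (simp add: S_def s_def)
      show "list_all2 (\<le>) Q (map2 (+) Q q)" using q Q(1) by (simp add: S_def list_all2_conv_all_nth)
    qed
    moreover have "inj_on (map2 (+) Q) (S m)"
    proof (rule inj_onI)
      fix q r assume "q \<in> S m" "r \<in> S m" and eq: "map2 (+) Q q = map2 (+) Q r"
      then have len: "length q = k" "length r = k" by (simp_all add: S_def)
      show "q = r"
      proof (rule nth_equalityI)
        show "q ! i = r ! i" if "i < length q" for i
          using arg_cong[OF eq, of "\<lambda>l. l ! i"] that len Q(1) by simp
      qed (simp add: len)
    qed
    ultimately have "card (S m) \<le> card ?G" using fin by (intro card_inj_on_le) auto
    then have "real (card (S m)) \<le> real (card ?G)" by simp
    moreover have "real (card (S (m + s))) = real (card ?G) + real (card (S (m + s) - ?G))"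
      using card_Un_disjoint[of ?G "S (m + s) - ?G"] fin[of "m + s"]
      by (simp add: Un_absorb1 flip: of_nat_add)
    ultimately have bad: "real (card (S (m + s) - ?G)) \<le> c (m + s) - c m" by (simp add: card)
    have "\<bar>(\<Sum>q\<in>S (m + s). a q) - c (m + s) * L\<bar> = \<bar>\<Sum>q\<in>S (m + s). (a q - L)\<bar>"
      by (simp add: sum_subtractf card)
    also have "\<dots> \<le> (\<Sum>q\<in>S (m + s). \<bar>a q - L\<bar>)" by (rule sum_abs)
    also have "\<dots> = (\<Sum>q\<in>?G. \<bar>a q - L\<bar>) + (\<Sum>q\<in>S (m + s) - ?G. \<bar>a q - L\<bar>)"
      by (subst sum.subset_diff[of ?G]) (auto simp: fin)
    also have "\<dots> \<le> real (card ?G) * (\<epsilon> / 2) + real (card (S (m + s) - ?G)) * D"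
    proof (intro add_mono sum_bounded_above)
      show "\<bar>a q - L\<bar> \<le> \<epsilon> / 2" if "q \<in> ?G" for q using Q(2)[of q] that by auto
      show "\<bar>a q - L\<bar> \<le> D" if "q \<in> S (m + s) - ?G" for q
        using bound[of q] that by (auto simp: S_def D_def)
    qed
    also have "\<dots> \<le> c (m + s) * (\<epsilon> / 2) + (c (m + s) - c m) * D"
      using bad D \<epsilon> card_mono[OF fin[of "m + s"], of ?G] card[of "m + s"]
      by (intro add_mono mult_right_mono) auto
    finally have "\<bar>(\<Sum>q\<in>S (m + s). a q) - c (m + s) * L\<bar> / c (m + s) \<le>
        (c (m + s) * (\<epsilon> / 2) + (c (m + s) - c m) * D) / c (m + s)"
      using c[of "m + s"] by (simp add: divide_right_mono)
    also have "\<bar>(\<Sum>q\<in>S (m + s). a q) - c (m + s) * L\<bar> / c (m + s) = \<bar>((\<Sum>q\<in>S (m + s). a q) - c (m + s) * L) / c (m + s)\<bar>"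
      using c[of "m + s"] by simp
    also have "((\<Sum>q\<in>S (m + s). a q) - c (m + s) * L) / c (m + s) = (\<Sum>q\<in>S (m + s). a q) / c (m + s) - L"
      using c[of "m + s"] by (simp add: field_simps)
    also have "(c (m + s) * (\<epsilon> / 2) + (c (m + s) - c m) * D) / c (m + s) = \<epsilon> / 2 + D * (1 - c m / c (m + s))"
      using c[of "m + s"] by (simp add: field_simps)
    finally show ?thesis .
  qed
  have "(\<lambda>m. D * (1 - c m / c (m + s))) \<longlonglongrightarrow> D * (1 - 1)"
    using binomial_ratio_tendsto_1[of k s] unfolding c_def by (intro tendsto_intros)
  then have "\<forall>\<^sub>F m in sequentially. D * (1 - c m / c (m + s)) < \<epsilon> / 2"
    using \<epsilon> by (intro order_tendstoD(2)) auto
  then obtain N where N: "\<And>m. m \<ge> N \<Longrightarrow> D * (1 - c m / c (m + s)) < \<epsilon> / 2"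
    by (auto simp: eventually_sequentially)
  have "norm ((\<Sum>q\<in>S m. a q) / c m - L) < \<epsilon>" if m: "m \<ge> N + s" for m
  proof -
    have ms: "m - s + s = m" "N \<le> m - s" using m by simp_all
    show ?thesis
      using est[of "m - s", unfolded ms(1)] N[OF ms(2), unfolded ms(1)] unfolding real_norm_def by linarith
  qed
  then show "\<exists>no. \<forall>m\<ge>no. norm ((\<Sum>q | length q = k \<and> sum_list q \<le> m. a q) / real ((m + k) choose k) - L) < \<epsilon>"
    unfolding S_def c_def by blast
qed

lemma multi_at_top_neq_bot: "multi_at_top k \<noteq> bot"
proof
  assume "multi_at_top k = bot"
  then have "eventually (\<lambda>_. False) (multi_at_top k)" by simp
  then obtain Q :: "nat list" where "length Q = k" "\<And>q. \<not> list_all2 (\<le>) Q q"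
    unfolding eventually_multi_at_top by blast
  then show False using list_all2_refl[of "(\<le>)" Q] by simp
qed

text \<open>Monotone convergence for nets; the limit is the infimum.\<close>

lemma antimono_tendsto_multi_at_top:
  fixes a :: "nat list \<Rightarrow> real"
  assumes pos: "\<And>q. length q = k \<Longrightarrow> 0 \<le> a q"
    and anti: "\<And>Q q. length Q = k \<Longrightarrow> list_all2 (\<le>) Q q \<Longrightarrow> a q \<le> a Q"
  shows "\<exists>L. (a \<longlongrightarrow> L) (multi_at_top k)"
proof
  define L where "L = (INF q\<in>{q. length q = k}. a q)"
  have bdd: "bdd_below (a ` {q. length q = k})" using pos by (auto intro!: bdd_belowI2)
  have ne: "{q :: nat list. length q = k} \<noteq> {}" by (metis (mono_tags) empty_iff length_replicate mem_Collect_eq)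
  show "(a \<longlongrightarrow> L) (multi_at_top k)"
  proof (rule tendstoI)
    fix \<epsilon> :: real assume "0 < \<epsilon>"
    then obtain Q where Q: "length Q = k" "a Q < L + \<epsilon>"
      using cINF_less_iff[OF ne bdd, of "L + \<epsilon>"] by (auto simp: L_def)
    have "dist (a q) L < \<epsilon>" if q: "list_all2 (\<le>) Q q" for q
    proof -
      have "L \<le> a q" unfolding L_def
        by (rule cINF_lower[OF bdd]) (use list_all2_lengthD[OF q] Q in simp)
      then show ?thesis using anti[OF Q(1) q] Q(2) by (simp add: dist_real_def)
    qed
    then show "\<forall>\<^sub>F q in multi_at_top k. dist (a q) L < \<epsilon>"
      unfolding eventually_multi_at_top using Q(1) by blast
  qed
qed

section \<open>Words of a given degree\<close>

definition multiwords_deg :: "nat list \<Rightarrow> nat list \<Rightarrow> nat list list set" where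
  "multiwords_deg ns q = {\<alpha>. \<alpha> \<in> multiwords ns \<and> map length \<alpha> = q}"

lemma multiwords_deg_Cons:
  "multiwords_deg (n # ns) (d # q) =
    (\<lambda>(w, \<alpha>). w # \<alpha>) ` ({w. set w \<subseteq> {..<n} \<and> length w = d} \<times> multiwords_deg ns q)"
proof (intro equalityI subsetI)
  fix \<alpha> assume "\<alpha> \<in> multiwords_deg (n # ns) (d # q)"
  then show "\<alpha> \<in> (\<lambda>(w, \<alpha>). w # \<alpha>) ` ({w. set w \<subseteq> {..<n} \<and> length w = d} \<times> multiwords_deg ns q)"
    by (cases \<alpha>) (auto simp: multiwords_deg_def multiwords_def)
qed (auto simp: multiwords_deg_def multiwords_def)

lemma finite_card_multiwords_deg:
  "length q = length ns \<Longrightarrow>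
    finite (multiwords_deg ns q) \<and> card (multiwords_deg ns q) = (\<Prod>i<length ns. ns ! i ^ (q ! i))"
proof (induction q ns rule: list_induct2)
  case Nil
  have "multiwords_deg [] [] = {[]}" by (auto simp: multiwords_deg_def multiwords_def)
  then show ?case by simp
next
  case (Cons d q n ns)
  have "inj_on (\<lambda>(w, \<alpha>). w # \<alpha>) A" for A :: "(nat list \<times> nat list list) set" by (auto simp: inj_on_def)
  then show ?case
    using Cons finite_lists_length_eq[of "{..<n}" d] card_lists_length_eq[of "{..<n}" d]
    unfolding multiwords_deg_Cons
    by (simp add: card_image card_cartesian_product prod.lessThan_Suc_shift del: prod.lessThan_Suc)
qed

lemma finite_multiwords_deg: "finite (multiwords_deg ns q)"
proof (cases "length q = length ns")
  case False
  then have "multiwords_deg ns q = {}" by (auto simp: multiwords_deg_def multiwords_iff)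
  then show ?thesis by simp
qed (simp add: finite_card_multiwords_deg)

text \<open>The excess letters are split off as prefixes, because
  \<open>norm_coinv_vec_mult_le\<close> compares a product with its right factor.\<close>

lemma multiwords_deg_split:
  assumes q: "list_all2 (\<le>) Q q" and \<beta>: "\<beta> \<in> multiwords_deg ns q"
  shows "\<exists>\<gamma>\<in>multiwords_deg ns (map2 (-) q Q). \<exists>\<alpha>\<in>multiwords_deg ns Q. \<beta> = mult_words \<gamma> \<alpha>"
proof -
  have \<beta>': "length \<beta> = length ns" "map length \<beta> = q"
    and set_\<beta>: "\<And>i. i < length ns \<Longrightarrow> set (\<beta> ! i) \<subseteq> {..<ns ! i}"
    using \<beta> by (simp_all add: multiwords_deg_def multiwords_iff)
  have len: "length \<beta> = length ns" "length q = length ns" "length Q = length ns"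
    using \<beta>' list_all2_lengthD[OF q] by auto
  have lenq: "length (\<beta> ! i) = q ! i" "Q ! i \<le> q ! i" if "i < length ns" for i
    using that len list_all2_nthD[OF q, of i] unfolding \<beta>'(2)[symmetric] by simp_all
  define \<gamma> where "\<gamma> = map (\<lambda>i. take (q ! i - Q ! i) (\<beta> ! i)) [0..<length ns]"
  define \<alpha> where "\<alpha> = map (\<lambda>i. drop (q ! i - Q ! i) (\<beta> ! i)) [0..<length ns]"
  have "\<gamma> \<in> multiwords_deg ns (map2 (-) q Q)"
    unfolding multiwords_deg_def multiwords_iff
  proof (intro CollectI conjI allI impI)
    show "map length \<gamma> = map2 (-) q Q"
      by (rule nth_equalityI) (simp_all add: \<gamma>_def len lenq)
    show "set (\<gamma> ! i) \<subseteq> {..<ns ! i}" if "i < length ns" for i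
      using subset_trans[OF set_take_subset set_\<beta>[OF that]] that by (simp add: \<gamma>_def)
  qed (simp add: \<gamma>_def)
  moreover have "\<alpha> \<in> multiwords_deg ns Q"
    unfolding multiwords_deg_def multiwords_iff
  proof (intro CollectI conjI allI impI)
    show "map length \<alpha> = Q"
      by (rule nth_equalityI) (simp_all add: \<alpha>_def len lenq)
    show "set (\<alpha> ! i) \<subseteq> {..<ns ! i}" if "i < length ns" for i
      using subset_trans[OF set_drop_subset set_\<beta>[OF that]] that by (simp add: \<alpha>_def)
  qed (simp add: \<alpha>_def)
  moreover have "\<beta> = mult_words \<gamma> \<alpha>"
    by (rule nth_equalityI) (simp_all add: \<gamma>_def \<alpha>_def len nth_mult_words)
  ultimately show ?thesis by blast
qed

section \<open>Curvature of the compression\<close>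

text \<open>The Berezin kernel of the compression takes values of this form, since its defect has
  rank one.\<close>

lift_definition tensor_vec :: "('i, complex) hsum \<Rightarrow> 'h :: complex_hilbert \<Rightarrow> ('i, 'h) hsum"
  is "\<lambda>f v i. f i *\<^sub>C v"
  by (simp add: norm_scaleC power_mult_distrib summable_on_cmult_left)

lemma cinner_tensor_vec: "cinner (tensor_vec x v) (tensor_vec y w) = cinner x y * cinner v w"
proof -
  have "cinner (coord (tensor_vec x v) i) (coord (tensor_vec y w) i) =
      cinner (coord x i) (coord y i) * cinner v w" for i
    by (simp add: tensor_vec.rep_eq cinner_scaleC_left cinner_scaleC_right cinner_complex_def)
  then show ?thesis by (simp add: cinner_hsum_def infsum_cmult_left')
qed

lemma degree_proj_tensor_vec: "degree_proj q (tensor_vec x v) = tensor_vec (degree_proj q x) v"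
  by (rule hsum_eqI) (simp add: degree_proj.rep_eq tensor_vec.rep_eq scaleC_zero_left)

lemma infsum_single:
  assumes supp: "\<And>i. i \<notin> A \<Longrightarrow> coord x i = 0"
  shows "(\<Sum>\<^sub>\<infinity>i\<in>A. single i (coord x i)) = x"
proof (rule infsumI)
  show "((\<lambda>i. single i (coord x i)) has_sum x) A"
    unfolding has_sum_def
  proof (rule tendstoI)
    fix \<epsilon> :: real assume \<epsilon>: "0 < \<epsilon>"
    obtain F where F: "finite F"
      "\<And>B. B \<inter> F = {} \<Longrightarrow> (\<Sum>\<^sub>\<infinity>i\<in>B. (norm (coord x i))\<^sup>2) < \<epsilon>\<^sup>2"
      using summable_tail[OF summable_coord[of x], of "\<epsilon>\<^sup>2"] \<epsilon> by auto
    have "dist (\<Sum>i\<in>G. single i (coord x i)) x < \<epsilon>" if G: "finite G" "F \<inter> A \<subseteq> G" "G \<subseteq> A" for G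
    proof -
      have c: "coord (x - (\<Sum>i\<in>G. single i (coord x i))) j = (if j \<in> G then 0 else coord x j)" for j
        using G(1) by (simp add: minus_hsum.rep_eq coord_sum single.rep_eq)
      have "(norm (x - (\<Sum>i\<in>G. single i (coord x i))))\<^sup>2 = (\<Sum>\<^sub>\<infinity>j\<in>A - G. (norm (coord x j))\<^sup>2)"
        unfolding norm_hsum_sq c by (rule infsum_cong_neutral) (auto simp: supp)
      also have "\<dots> < \<epsilon>\<^sup>2" by (rule F(2)) (use G in auto)
      finally show ?thesis using \<epsilon> by (simp add: dist_norm norm_minus_commute power_less_imp_less_base)
    qed
    then show "\<forall>\<^sub>F G in finite_subsets_at_top A. dist (\<Sum>i\<in>G. single i (coord x i)) x < \<epsilon>"
      unfolding eventually_finite_subsets_at_top using F(1) by (intro exI[of _ "F \<inter> A"]) auto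
  qed
qed

lemma degree_proj_fock:
  assumes x: "x \<in> fock ns"
  shows "degree_proj q x = (\<Sum>\<alpha>\<in>multiwords_deg ns q. coord x \<alpha> *\<^sub>C basis_vec \<alpha>)"
proof (rule hsum_eqI)
  fix \<beta>
  have "coord (\<Sum>\<alpha>\<in>multiwords_deg ns q. coord x \<alpha> *\<^sub>C basis_vec \<alpha>) \<beta> =
      (\<Sum>\<alpha>\<in>multiwords_deg ns q. if \<alpha> = \<beta> then coord x \<alpha> else 0)"
    unfolding coord_sum by (rule sum.cong) (auto simp: scaleC_hsum.rep_eq scaleC_complex_def single.rep_eq)
  also have "\<dots> = coord (degree_proj q x) \<beta>"
    using finite_multiwords_deg[of ns q] fock_coord_zero[OF x, of \<beta>]
    by (auto simp: degree_proj.rep_eq multiwords_deg_def)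
  finally show "coord (degree_proj q x) \<beta> = coord (\<Sum>\<alpha>\<in>multiwords_deg ns q. coord x \<alpha> *\<^sub>C basis_vec \<alpha>) \<beta>" ..
qed

lemma trace_degree_proj: "trace_op (fock ns) (degree_proj q) = of_nat (card (multiwords_deg ns q))"
proof -
  have "trace_op (fock ns) (degree_proj q) = of_real (\<Sum>\<alpha>\<in>multiwords_deg ns q. (norm (basis_vec \<alpha>))\<^sup>2)"
    by (rule trace_op_finite_rank[OF closed_csubspace_fock])
      (auto simp: degree_proj_fock cinner_basis_vec multiwords_deg_def basis_vec_in_fock)
  then show ?thesis by (simp add: norm_single)
qed

context invariant_fock_subspace
begin

text \<open>For proper \<open>M\<close> this is the quotient of the two traces at degree
  \<open>q\<close> in the curvature of the compression.\<close>

definition coinv_weight :: "nat list \<Rightarrow> real" where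
  "coinv_weight q = (\<Sum>\<alpha>\<in>multiwords_deg ns q. (norm (coinv_vec \<alpha>))\<^sup>2) / real (card (multiwords_deg ns q))"

lemma norm_coinv_vec_le_1: "norm (coinv_vec \<alpha>) \<le> 1"
  using norm_proj_le[OF coinv_closed, of "basis_vec \<alpha>"] by (simp add: norm_single)

lemma coinv_weight_nonneg: "0 \<le> coinv_weight q"
  by (simp add: coinv_weight_def sum_nonneg)

lemma coinv_weight_le_1: "coinv_weight q \<le> 1"
proof -
  have "(\<Sum>\<alpha>\<in>multiwords_deg ns q. (norm (coinv_vec \<alpha>))\<^sup>2) \<le> real (card (multiwords_deg ns q)) * 1"
    by (rule sum_bounded_above) (simp add: norm_coinv_vec_le_1 power_le_one)
  then show ?thesis
    by (cases "card (multiwords_deg ns q) = 0") (simp_all add: coinv_weight_def divide_le_eq)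
qed

text \<open>Every word of degree \<open>q\<close> is a product of a prefix of degree
  \<open>q - Q\<close> and a word of degree \<open>Q\<close>, whose vector is at least as long. Each
  word of degree \<open>Q\<close> is counted once per prefix, and the number of prefixes is the
  quotient of the two cardinalities.\<close>

lemma coinv_weight_antimono:
  assumes ns: "\<forall>n\<in>set ns. 1 \<le> n" and len: "length Q = length ns" and q: "list_all2 (\<le>) Q q"
  shows "coinv_weight q \<le> coinv_weight Q"
proof -
  let ?f = "\<lambda>\<alpha>. (norm (coinv_vec \<alpha>))\<^sup>2"
  let ?r = "map2 (-) q Q"
  let ?W = "multiwords_deg ns"
  have lenq: "length q = length ns" using list_all2_lengthD[OF q] len by simp
  have card_pos: "0 < card (?W p)" if "length p = length ns" for p
  proof -
    have "0 < ns ! i" if "i < length ns" for i using ns that by (simp add: Suc_le_eq)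
    then show ?thesis using that by (simp add: finite_card_multiwords_deg prod_pos)
  qed
  have "(\<Sum>\<beta>\<in>?W q. ?f \<beta>) \<le> (\<Sum>\<beta>\<in>(\<lambda>(\<gamma>, \<alpha>). mult_words \<gamma> \<alpha>) ` (?W ?r \<times> ?W Q). ?f \<beta>)"
  proof (rule sum_mono2)
    show "?W q \<subseteq> (\<lambda>(\<gamma>, \<alpha>). mult_words \<gamma> \<alpha>) ` (?W ?r \<times> ?W Q)"
      using multiwords_deg_split[OF q, of _ ns] by force
  qed (simp_all add: finite_multiwords_deg)
  also have "\<dots> \<le> (\<Sum>(\<gamma>, \<alpha>)\<in>?W ?r \<times> ?W Q. ?f (mult_words \<gamma> \<alpha>))"
    using sum_image_le[of "?W ?r \<times> ?W Q" ?f "\<lambda>(\<gamma>, \<alpha>). mult_words \<gamma> \<alpha>"]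
    by (simp add: finite_multiwords_deg o_def case_prod_unfold)
  also have "\<dots> \<le> (\<Sum>(\<gamma>, \<alpha>)\<in>?W ?r \<times> ?W Q. ?f \<alpha>)"
    by (rule sum_mono) (auto simp: multiwords_deg_def intro!: power_mono norm_coinv_vec_mult_le)
  also have "\<dots> = real (card (?W ?r)) * (\<Sum>\<alpha>\<in>?W Q. ?f \<alpha>)"
    by (simp flip: sum.cartesian_product)
  finally have le: "(\<Sum>\<beta>\<in>?W q. ?f \<beta>) \<le> real (card (?W ?r)) * (\<Sum>\<alpha>\<in>?W Q. ?f \<alpha>)" .
  have "card (?W q) = card (?W ?r) * card (?W Q)"
  proof -
    have "(\<Prod>i<length ns. ns ! i ^ (q ! i)) = (\<Prod>i<length ns. ns ! i ^ (?r ! i) * ns ! i ^ (Q ! i))"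
      using q by (intro prod.cong) (auto simp: list_all2_conv_all_nth len lenq simp flip: power_add)
    then show ?thesis by (simp add: finite_card_multiwords_deg len lenq prod.distrib)
  qed
  then show ?thesis
    using le card_pos[OF len] card_pos[of ?r] len lenq
    by (simp add: coinv_weight_def field_simps)
qed

text \<open>The root of the defect maps \<open>backshift \<beta> h\<close> to a multiple of the
  normalized \<open>vac_vec\<close>; the factor is its inner product with \<open>vac_vec\<close>,
  which is the coordinate of \<open>h\<close> at \<beta>. So the kernel is an isometric
  embedding.\<close>

lemma berezin_kernel_compr:
  assumes "M \<noteq> fock ns" and h: "h \<in> coinv"
  shows "berezin_kernel coinv ns compr h = tensor_vec h ((1 / norm vac_vec) *\<^sub>R vac_vec)"
proof -
  let ?u = "vac_vec"
  let ?x = "tensor_vec h ((1 / norm ?u) *\<^sub>R ?u)"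
  have hf: "h \<in> fock ns" using h coinv_subset by blast
  have sq: "sqrt_op coinv (Delta coinv ns compr) =
      (\<lambda>h. if h \<in> coinv then (cinner h ?u / of_real (norm ?u)) *\<^sub>C ?u else 0)"
    using vac_vec_nonzero[OF assms(1)]
    by (intro sqrt_op_rank_one coinv_closed proj_in Delta_compr)
  have "single \<beta> (sqrt_op coinv (Delta coinv ns compr)
      (foldr (\<lambda>i. adj coinv (word_op (compr i) (\<beta> ! i))) [0..<length ns] h)) = single \<beta> (coord ?x \<beta>)"
    if \<beta>: "\<beta> \<in> multiwords ns" for \<beta>
  proof -
    have "cinner (backshift \<beta> h) ?u = coord h \<beta>"
      using foldr_adj_word_op_compr(2)[OF \<beta> h] length_multiwords[OF \<beta>]
      by (simp add: cinner_coinv_vec backshift.rep_eq mult_words_replicate_right)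
    then show ?thesis
      using foldr_adj_word_op_compr[OF \<beta> h]
      by (simp add: sq tensor_vec.rep_eq scaleC_scaleC flip: scaleC_of_real)
  qed
  then have "berezin_kernel coinv ns compr h = (\<Sum>\<^sub>\<infinity>\<beta>\<in>multiwords ns. single \<beta> (coord ?x \<beta>))"
    unfolding berezin_kernel_def by (rule infsum_cong)
  also have "\<dots> = ?x"
    by (rule infsum_single) (simp add: tensor_vec.rep_eq fock_coord_zero[OF hf] scaleC_zero_left)
  finally show ?thesis .
qed

text \<open>As the second tensor factor is a unit vector, the operator is the compression of
  \<open>degree_proj q\<close> to \<open>coinv\<close>, a sum of rank one operators of the projected
  basis vectors.\<close>

lemma trace_berezin:
  assumes "M \<noteq> fock ns"
  shows "trace_op coinv (\<lambda>h. adj coinv (berezin_kernel coinv ns compr)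
      (degree_proj q (berezin_kernel coinv ns compr h))) =
    of_real (\<Sum>\<alpha>\<in>multiwords_deg ns q. (norm (coinv_vec \<alpha>))\<^sup>2)"
proof (rule trace_op_finite_rank[OF coinv_closed])
  show "coinv_vec \<alpha> \<in> coinv" for \<alpha> by (rule proj_in[OF coinv_closed])
  fix h assume h: "h \<in> coinv"
  then have hf: "h \<in> fock ns" using coinv_subset by blast
  let ?v = "(1 / norm vac_vec) *\<^sub>R vac_vec"
  have v: "cinner ?v ?v = 1" using vac_vec_nonzero[OF assms] by (simp add: cinner_same)
  show "adj coinv (berezin_kernel coinv ns compr) (degree_proj q (berezin_kernel coinv ns compr h)) =
      (\<Sum>\<alpha>\<in>multiwords_deg ns q. cinner h (coinv_vec \<alpha>) *\<^sub>C coinv_vec \<alpha>)"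
  proof (rule adj_eqI[OF coinv_closed])
    show "(\<Sum>\<alpha>\<in>multiwords_deg ns q. cinner h (coinv_vec \<alpha>) *\<^sub>C coinv_vec \<alpha>) \<in> coinv"
      by (intro closed_csubspaceD(8,3)[OF coinv_closed] proj_in[OF coinv_closed])
    fix z assume z: "z \<in> coinv"
    have "cinner (berezin_kernel coinv ns compr z) (degree_proj q (berezin_kernel coinv ns compr h)) =
        cinner z (degree_proj q h)"
      unfolding berezin_kernel_compr[OF assms z] berezin_kernel_compr[OF assms h] degree_proj_tensor_vec
        cinner_tensor_vec v by simp
    also have "\<dots> = cinner z (\<Sum>\<alpha>\<in>multiwords_deg ns q. cinner h (coinv_vec \<alpha>) *\<^sub>C coinv_vec \<alpha>)"
      by (simp add: degree_proj_fock[OF hf] cinner_sum_right cinner_scaleC_right cinner_basis_vec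
          cinner_coinv_vec h z)
    finally show "cinner (berezin_kernel coinv ns compr z)
        (degree_proj q (berezin_kernel coinv ns compr h)) = \<dots>" .
  qed
qed

text \<open>Monotonicity provides a limit of the net, the means over simplices share it, and so the
  curvature is that limit.\<close>

lemma curv_compr_eq_0_iff:
  assumes "\<forall>n\<in>set ns. 1 \<le> n" and "M \<noteq> fock ns"
  shows "curv coinv ns compr = 0 \<longleftrightarrow> (coinv_weight \<longlongrightarrow> 0) (multi_at_top (length ns))"
proof -
  have "\<exists>L. (coinv_weight \<longlongrightarrow> L) (multi_at_top (length ns))"
    by (rule antimono_tendsto_multi_at_top[OF coinv_weight_nonneg coinv_weight_antimono[OF assms(1)]])
  then obtain L where L: "(coinv_weight \<longlongrightarrow> L) (multi_at_top (length ns))" ..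
  let ?c = "\<lambda>m. (\<Sum>q | length q = length ns \<and> sum_list q \<le> m. coinv_weight q) /
      real ((m + length ns) choose length ns)"
  have "?c \<longlonglongrightarrow> L"
    using L by (rule simplex_mean_tendsto[where B = 1]) (simp add: coinv_weight_nonneg coinv_weight_le_1)
  then have "(\<lambda>m. complex_of_real (?c m)) \<longlonglongrightarrow> of_real L" by (rule tendsto_of_real)
  moreover have "complex_of_real (?c m) = 1 / of_nat ((m + length ns) choose length ns) *
     (\<Sum>q | length q = length ns \<and> sum_list q \<le> m.
        trace_op coinv (\<lambda>h. adj coinv (berezin_kernel coinv ns compr)
          (degree_proj q (berezin_kernel coinv ns compr h)))
        / trace_op (fock ns) (degree_proj q))" for m
    unfolding trace_berezin[OF assms(2)] trace_degree_proj by (simp add: coinv_weight_def)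
  ultimately have curv: "curv coinv ns compr = of_real L"
    unfolding curv_def by (simp add: limI)
  show ?thesis
  proof
    assume "curv coinv ns compr = 0"
    then have "L = 0" using curv by simp
    then show "(coinv_weight \<longlongrightarrow> 0) (multi_at_top (length ns))" using L by simp
  next
    assume "(coinv_weight \<longlongrightarrow> 0) (multi_at_top (length ns))"
    then have "L = 0" by (rule tendsto_unique[OF multi_at_top_neq_bot L])
    then show "curv coinv ns compr = 0" using curv by simp
  qed
qed

end

section \<open>Inner sequences\<close>

context invariant_fock_subspace
begin

lemma proj_invariant_diff: "proj M (x - proj M x) = 0"
  by (rule proj_eqI[OF invariant_closed])
    (simp_all add: closed_csubspaceD(1)[OF invariant_closed] proj_orth[OF invariant_closed])

lemma proj_invariant_in_fock: "proj M x \<in> fock ns"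
  using proj_in[OF invariant_closed] invariant_subset by blast

lemma diff_proj_in_coinv: "x \<in> fock ns \<Longrightarrow> x - proj M x \<in> coinv"
  unfolding proj_ortho_compl[OF closed_csubspace_fock invariant_closed invariant_subset, symmetric]
  by (rule proj_in[OF coinv_closed])

lemma norm_proj_invariant_basis:
  assumes "\<alpha> \<in> multiwords ns"
  shows "(norm (proj M (basis_vec \<alpha>)))\<^sup>2 = 1 - (norm (coinv_vec \<alpha>))\<^sup>2"
  using norm_proj_pythagoras[OF invariant_closed, of "basis_vec \<alpha>"]
    proj_ortho_compl[OF closed_csubspace_fock invariant_closed invariant_subset basis_vec_in_fock[OF assms]]
  by (simp add: norm_single)

section \<open>From an inner sequence to positive defects and the limit of the averages\<close>

context
  fixes \<psi> :: "nat \<Rightarrow> (nat list list, complex) hsum \<Rightarrow> (nat list list, complex) hsum"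
  assumes \<psi>: "\<And>s. multi_analytic ns (\<psi> s)"
    and sums: "\<And>x. x \<in> fock ns \<Longrightarrow> (\<lambda>s. \<psi> s (adj (fock ns) (\<psi> s) x)) sums proj M x"
begin

lemma inner_seq_bounded: "bounded_op (fock ns) (fock ns) (\<psi> s)"
  using \<psi>[of s] by (simp add: multi_analytic_def)

lemmas inner_seq_adj_in = adj_in[OF closed_csubspace_fock inner_seq_bounded]

lemma inner_seq_adj_bounded: "bounded_op (fock ns) (fock ns) (adj (fock ns) (\<psi> s))"
  by (rule bounded_op_adj[OF closed_csubspace_fock inner_seq_bounded bounded_opD(1)[OF inner_seq_bounded]])

lemma inner_seq_sums_cinner:
  assumes x: "x \<in> fock ns"
  shows "(\<lambda>s. cinner (adj (fock ns) (\<psi> s) x) (adj (fock ns) (\<psi> s) y)) sums cinner (proj M x) y"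
  using bounded_linear.sums[OF bounded_bilinear.bounded_linear_left[OF bounded_bilinear_cinner] sums[OF x], of y]
  by (simp add: cinner_adj_right[OF closed_csubspace_fock inner_seq_bounded inner_seq_adj_in])

lemma inner_seq_sums_norm:
  assumes x: "x \<in> fock ns"
  shows "(\<lambda>s. (norm (adj (fock ns) (\<psi> s) x))\<^sup>2) sums (norm (proj M x))\<^sup>2"
  using bounded_linear.sums[OF bounded_linear_Re inner_seq_sums_cinner[OF x, of x]]
  by (simp add: Re_cinner_same norm_proj_sq[OF invariant_closed])

text \<open>The squared norms of the images of \<open>x - proj M x\<close> under all adjoints sum to
  the squared norm of its projection, which is 0. So each adjoint kills the complement of
  \<open>M\<close>.\<close>

lemma inner_seq_adj_proj:
  assumes x: "x \<in> fock ns"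
  shows "adj (fock ns) (\<psi> s) (proj M x) = adj (fock ns) (\<psi> s) x"
proof -
  have d: "x - proj M x \<in> fock ns"
    by (rule closed_csubspaceD(6)[OF closed_csubspace_fock x proj_invariant_in_fock])
  have s0: "(\<lambda>s. (norm (adj (fock ns) (\<psi> s) (x - proj M x)))\<^sup>2) sums 0"
    using inner_seq_sums_norm[OF d] by (simp add: proj_invariant_diff)
  then have "suminf (\<lambda>s. (norm (adj (fock ns) (\<psi> s) (x - proj M x)))\<^sup>2) = 0"
    and "summable (\<lambda>s. (norm (adj (fock ns) (\<psi> s) (x - proj M x)))\<^sup>2)"
    by (simp_all add: sums_iff)
  then have "(norm (adj (fock ns) (\<psi> s) (x - proj M x)))\<^sup>2 = 0"
    by (subst (asm) suminf_eq_zero_iff) auto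
  then have "adj (fock ns) (\<psi> s) (x - proj M x) = 0" by simp
  then show ?thesis
    using bounded_op_diff_arg[OF closed_csubspace_fock inner_seq_adj_bounded x proj_invariant_in_fock, of s x]
    by simp
qed

lemma inner_seq_adj_backshift:
  assumes x: "x \<in> fock ns" and ij: "i < length ns" "j < ns ! i"
  shows "adj (fock ns) (\<psi> s) (backshift (word_at i [j]) x) = backshift (word_at i [j]) (adj (fock ns) (\<psi> s) x)"
proof (rule adj_eqI[OF closed_csubspace_fock])
  show "backshift (word_at i [j]) (adj (fock ns) (\<psi> s) x) \<in> fock ns"
    by (rule backshift_in_fock[OF inner_seq_adj_in])
  fix z assume z: "z \<in> fock ns"
  have "cinner (\<psi> s z) (backshift (word_at i [j]) x) = cinner (shift i j (\<psi> s z)) x"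
    by (simp add: cinner_shift)
  also have "shift i j (\<psi> s z) = \<psi> s (shift i j z)"
    using \<psi>[of s] ij z by (simp add: multi_analytic_def)
  also have "cinner \<dots> x = cinner (shift i j z) (adj (fock ns) (\<psi> s) x)"
    by (rule cinner_adj_right[OF closed_csubspace_fock inner_seq_bounded shift_in_fock[OF z ij], symmetric])
  finally show "cinner (\<psi> s z) (backshift (word_at i [j]) x) =
      cinner z (backshift (word_at i [j]) (adj (fock ns) (\<psi> s) x))"
    by (simp add: cinner_shift)
qed

text \<open>The series of the forms \<open>vac_form\<close>, pulled back along the adjoints, starts
  at the inner product of \<open>M\<close> and obeys the recursion of the defects, so it computes
  them; on the diagonal its terms are nonnegative.\<close>

lemma polyball_of_inner_seq: "shift \<in> polyball ns M"
proof -
  let ?R = "\<lambda>s. adj (fock ns) (\<psi> s)"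
  define B where "B L h g = (\<Sum>s. vac_form ns L (?R s h) (?R s g))" for L h g
  have fock: "h \<in> fock ns" if "h \<in> M" for h using that invariant_subset by blast
  have summ: "summable (\<lambda>s. vac_form ns L (?R s h) (?R s g))" if "h \<in> fock ns" "g \<in> fock ns" for L h g
  proof (rule summable_comparison_test')
    show "summable (\<lambda>s. (norm (?R s h))\<^sup>2 + (norm (?R s g))\<^sup>2)"
      by (intro summable_add sums_summable[OF inner_seq_sums_norm] that)
    show "norm (vac_form ns L (?R s h) (?R s g)) \<le> (norm (?R s h))\<^sup>2 + (norm (?R s g))\<^sup>2" for s
      by (rule cmod_vac_form_le)
  qed
  have X: "bounded_op M M (shift i j)" if "i < length ns" "j < ns ! i" for i j
    using that by (rule bounded_op_shift_invariant)
  have B0: "B {} h g = cinner h g" if "h \<in> M" "g \<in> M" for h g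
    using inner_seq_sums_cinner[OF fock[OF that(1)], of g]
    by (simp add: B_def vac_form_empty inner_seq_adj_in sums_iff proj_fixed[OF invariant_closed that(1)])
  have B: "B (insert i L) h g = B L h g - (\<Sum>j<ns ! i. B L (adj M (shift i j) h) (adj M (shift i j) g))"
    if i: "i < length ns" "i \<notin> L" and hg: "h \<in> M" "g \<in> M" for i L h g
  proof -
    \<comment> \<open>The adjoint absorbs the projection in the adjoint of the restricted shift and
      then commutes with the backward shift.\<close>
    have R: "?R s (adj M (shift i j) x) = backshift (word_at i [j]) (?R s x)" if "j < ns ! i" "x \<in> M" for s j x
      unfolding adj_shift_invariant
      by (simp only: inner_seq_adj_proj[OF backshift_in_fock[OF fock[OF that(2)]]]
          inner_seq_adj_backshift[OF fock[OF that(2)] i(1) that(1)])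
    have bb: "summable (\<lambda>s. vac_form ns L (backshift (word_at i [j]) (?R s h)) (backshift (word_at i [j]) (?R s g)))"
      if "j < ns ! i" for j
      using summ[OF backshift_in_fock[OF fock[OF hg(1)]] backshift_in_fock[OF fock[OF hg(2)]], of L "word_at i [j]" "word_at i [j]"]
      by (simp only: inner_seq_adj_backshift[OF fock[OF hg(1)] i(1) that] inner_seq_adj_backshift[OF fock[OF hg(2)] i(1) that])
    have "B (insert i L) h g = (\<Sum>s. vac_form ns L (?R s h) (?R s g) -
        (\<Sum>j<ns ! i. vac_form ns L (backshift (word_at i [j]) (?R s h)) (backshift (word_at i [j]) (?R s g))))"
      by (simp add: B_def vac_form_insert[OF i])
    also have "\<dots> = B L h g - (\<Sum>j<ns ! i. \<Sum>s. vac_form ns L (backshift (word_at i [j]) (?R s h)) (backshift (word_at i [j]) (?R s g)))"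
    proof -
      have "(\<Sum>s. \<Sum>j<ns ! i. vac_form ns L (backshift (word_at i [j]) (?R s h)) (backshift (word_at i [j]) (?R s g))) =
          (\<Sum>j<ns ! i. \<Sum>s. vac_form ns L (backshift (word_at i [j]) (?R s h)) (backshift (word_at i [j]) (?R s g)))"
        by (rule suminf_sum) (use bb in simp)
      then show ?thesis
        unfolding B_def by (subst suminf_diff[symmetric]) (auto intro!: summ fock hg summable_sum bb)
    qed
    also have "(\<Sum>j<ns ! i. \<Sum>s. vac_form ns L (backshift (word_at i [j]) (?R s h)) (backshift (word_at i [j]) (?R s g)))
        = (\<Sum>j<ns ! i. B L (adj M (shift i j) h) (adj M (shift i j) g))"
      unfolding B_def by (intro sum.cong refl suminf_cong) (simp add: R hg)
    finally show ?thesis .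
  qed
  have pos: "positive_op M (Defect M ns shift p (\<lambda>h. h))" if p: "\<And>i. i < length ns \<Longrightarrow> p i \<in> {0, 1}" for p
    unfolding positive_op_def
  proof (intro conjI ballI)
    show "bounded_op M M (Defect M ns shift p (\<lambda>h. h))"
      by (rule Defect_form(1)[OF invariant_closed X p B0 B])
    fix h assume h: "h \<in> M"
    let ?L = "{i. i < length ns \<and> p i = 1}"
    have "\<forall>s. \<exists>r\<ge>0. vac_form ns ?L (?R s h) (?R s h) = of_real r" using vac_form_same by blast
    then obtain r where r: "\<And>s. r s \<ge> 0" "\<And>s. vac_form ns ?L (?R s h) (?R s h) = of_real (r s)" by metis
    have "summable (\<lambda>s. complex_of_real (r s))" using summ[OF fock[OF h] fock[OF h], of ?L] unfolding r(2) .
    then have sr: "summable r" by (simp add: summable_complex_of_real)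
    have "cinner (Defect M ns shift p (\<lambda>h. h) h) h = B ?L h h"
      by (rule Defect_form(2)[OF invariant_closed X p B0 B h h])
    also have "\<dots> = of_real (suminf r)"
      unfolding B_def r(2) by (rule bounded_linear.suminf[OF bounded_linear_of_real sr, symmetric])
    finally show "Im (cinner (Defect M ns shift p (\<lambda>h. h) h) h) = 0" "0 \<le> Re (cinner (Defect M ns shift p (\<lambda>h. h) h) h)"
      using suminf_nonneg[OF sr r(1)] by simp_all
  qed
  show ?thesis
    unfolding polyball_def
  proof (intro CollectI conjI allI impI ballI)
    show "positive_op M (Defect M ns shift p (\<lambda>h. h))" if "\<forall>i<length ns. p i \<in> {0, 1}" for p
      by (rule pos) (use that in blast)
  qed (rule X shift_commute; assumption)+
qed

lemma inner_seq_weight: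
  assumes ns: "\<forall>n\<in>set ns. 1 \<le> n" and q: "length q = length ns"
  shows "1 / (\<Prod>i<length ns. real (ns ! i) ^ (q ! i)) *
    (\<Sum>\<alpha> | \<alpha> \<in> multiwords ns \<and> map length \<alpha> = q. \<Sum>s. (norm (adj (fock ns) (\<psi> s) (basis_vec \<alpha>)))\<^sup>2) =
    1 - coinv_weight q"
proof -
  let ?c = "real (card (multiwords_deg ns q))"
  have c: "(\<Prod>i<length ns. real (ns ! i) ^ (q ! i)) = ?c"
    using finite_card_multiwords_deg[OF q] by simp
  have "0 < ?c" unfolding c[symmetric] using ns by (intro prod_pos) (force simp: Suc_le_eq)
  have "(\<Sum>\<alpha> | \<alpha> \<in> multiwords ns \<and> map length \<alpha> = q. \<Sum>s. (norm (adj (fock ns) (\<psi> s) (basis_vec \<alpha>)))\<^sup>2) =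
      (\<Sum>\<alpha>\<in>multiwords_deg ns q. 1 - (norm (coinv_vec \<alpha>))\<^sup>2)"
    unfolding multiwords_deg_def
  proof (rule sum.cong[OF refl])
    fix \<alpha> assume "\<alpha> \<in> {\<alpha>. \<alpha> \<in> multiwords ns \<and> map length \<alpha> = q}"
    then have \<alpha>: "\<alpha> \<in> multiwords ns" by simp
    show "(\<Sum>s. (norm (adj (fock ns) (\<psi> s) (basis_vec \<alpha>)))\<^sup>2) = 1 - (norm (coinv_vec \<alpha>))\<^sup>2"
      using inner_seq_sums_norm[OF basis_vec_in_fock[OF \<alpha>]] norm_proj_invariant_basis[OF \<alpha>]
      by (simp add: sums_iff)
  qed
  also have "\<dots> = ?c - (\<Sum>\<alpha>\<in>multiwords_deg ns q. (norm (coinv_vec \<alpha>))\<^sup>2)"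
    by (simp add: sum_subtractf)
  finally show ?thesis using \<open>0 < ?c\<close> unfolding c coinv_weight_def by (simp add: field_simps)
qed

lemma inner_seq_limit_iff:
  assumes ns: "\<forall>n\<in>set ns. 1 \<le> n"
  shows "((\<lambda>q. 1 / (\<Prod>i<length ns. real (ns ! i) ^ (q ! i)) *
      (\<Sum>\<alpha> | \<alpha> \<in> multiwords ns \<and> map length \<alpha> = q.
        \<Sum>s. (norm (adj (fock ns) (\<psi> s) (basis_vec \<alpha>)))\<^sup>2)) \<longlongrightarrow> 1) (multi_at_top (length ns)) \<longleftrightarrow>
    (coinv_weight \<longlongrightarrow> 0) (multi_at_top (length ns))" (is "(?f \<longlongrightarrow> 1) ?F \<longleftrightarrow> _")
proof -
  have "\<forall>\<^sub>F q in ?F. ?f q = 1 - coinv_weight q"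
    unfolding eventually_multi_at_top
  \<comment> \<open>The tail above 0 consists of the lists of the right length, where the two
    functions agree.\<close>
  proof (intro exI[of _ "replicate (length ns) 0"] conjI allI impI)
    fix q :: "nat list" assume "list_all2 (\<le>) (replicate (length ns) 0) q"
    then have "length q = length ns" by (auto dest: list_all2_lengthD)
    then show "?f q = 1 - coinv_weight q" by (rule inner_seq_weight[OF ns])
  qed simp
  then have "(?f \<longlongrightarrow> 1) ?F \<longleftrightarrow> ((\<lambda>q. 1 - coinv_weight q) \<longlongrightarrow> 1) ?F"
    by (rule tendsto_cong)
  also have "\<dots> \<longleftrightarrow> (coinv_weight \<longlongrightarrow> 0) ?F"
  proof
    assume "((\<lambda>q. 1 - coinv_weight q) \<longlongrightarrow> 1) ?F"
    from tendsto_diff[OF tendsto_const[of 1] this] show "(coinv_weight \<longlongrightarrow> 0) ?F" by simp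
  next
    assume "(coinv_weight \<longlongrightarrow> 0) ?F"
    from tendsto_diff[OF tendsto_const[of 1] this] show "((\<lambda>q. 1 - coinv_weight q) \<longlongrightarrow> 1) ?F" by simp
  qed
  finally show ?thesis .
qed

end

section \<open>From positive defects to an expansion of the projection onto \<open>M\<close>\<close>

lemma mult_words_word_at_snoc: "length \<beta> = i \<Longrightarrow> mult_words (word_at i w) \<beta> = \<beta> @ [w]"
  unfolding word_at_def by (induction \<beta> arbitrary: i) auto

text \<open>The last word is the first component of the pair because the outer summation will run
  over it.\<close>

lemma multiwords_take_Suc:
  assumes "i < length ns"
  shows "multiwords (take (Suc i) ns) =
    (\<lambda>(w, \<beta>). \<beta> @ [w]) ` ({w. set w \<subseteq> {..<ns ! i}} \<times> multiwords (take i ns))"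
proof (intro equalityI subsetI)
  fix \<alpha> assume "\<alpha> \<in> multiwords (take (Suc i) ns)"
  then show "\<alpha> \<in> (\<lambda>(w, \<beta>). \<beta> @ [w]) ` ({w. set w \<subseteq> {..<ns ! i}} \<times> multiwords (take i ns))"
    by (cases \<alpha> rule: rev_cases)
      (auto simp: multiwords_def take_Suc_conv_app_nth[OF assms] list_all2_append2 list_all2_Cons2)
qed (auto simp: multiwords_def take_Suc_conv_app_nth[OF assms] intro!: list_all2_appendI)

text \<open>The quadratic forms of the defects taken in the variables \<open>i, \<dots>, k - 1\<close> only; they interpolate
  between the full defect (\<open>i = 0\<close>) and the projection onto \<open>M\<close> (\<open>i = k\<close>).\<close>

definition partial_defect :: "nat \<Rightarrow> (nat list list, complex) hsum \<Rightarrow> (nat list list, complex) hsum" where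
  "partial_defect i = foldr (\<lambda>i. defect_step M ns shift i) [i..<length ns] (\<lambda>h. h)"

text \<open>Composing with the projection extends the forms to the whole Fock space, where their
  recursion involves plain backward shifts although these need not preserve
  \<open>M\<close>.\<close>

definition partial_form :: "nat \<Rightarrow> (nat list list, complex) hsum \<Rightarrow> real" where
  "partial_form i x = Re (cinner (partial_defect i (proj M x)) (proj M x))"

lemma partial_defect_step: "i < length ns \<Longrightarrow> partial_defect i = defect_step M ns shift i (partial_defect (Suc i))"
  by (simp add: partial_defect_def upt_conv_Cons)

lemma bounded_op_partial_defect: "i \<le> length ns \<Longrightarrow> bounded_op M M (partial_defect i)"
proof (induction i rule: inc_induct)
  case base
  show ?case by (rule bounded_opI[where B = 1]) (simp_all add: partial_defect_def)
next
  case (step i)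
  then show ?case
    unfolding partial_defect_step[OF step.hyps(2)]
    by (intro bounded_op_defect_step invariant_closed bounded_op_shift_invariant)
qed

text \<open>Backward shifts preserve the complement of \<open>M\<close>, so the part of
  \<open>x\<close> lying there contributes nothing after the outer projection.\<close>

lemma proj_backshift_proj:
  assumes ij: "i < length ns" "j < ns ! i" and x: "x \<in> fock ns"
  shows "proj M (backshift (word_at i [j]) (proj M x)) = proj M (backshift (word_at i [j]) x)"
proof (rule proj_eqI[OF invariant_closed proj_in[OF invariant_closed]])
  fix z assume z: "z \<in> M"
  let ?b = "backshift (word_at i [j])"
  have "?b (x - proj M x) \<in> coinv"
    by (rule backshift_letter_in_coinv[OF ij diff_proj_in_coinv[OF x]])
  then have "cinner (?b (x - proj M x)) z = 0" using z by (simp add: ortho_compl_def)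
  moreover have "?b (proj M x) + ?b (x - proj M x) = ?b x" by (simp flip: backshift_add)
  ultimately have "cinner (?b (proj M x)) z = cinner (?b x) z" by (metis cinner_add_left add_0_right)
  then show "cinner (?b (proj M x) - proj M (?b x)) z = 0"
    by (simp add: cinner_diff_left cinner_proj_left[OF invariant_closed z])
qed

lemma partial_form_step:
  assumes i: "i < length ns" and x: "x \<in> fock ns"
  shows "partial_form i x = partial_form (Suc i) x -
    (\<Sum>j<ns ! i. partial_form (Suc i) (backshift (word_at i [j]) x))"
proof -
  have "cinner (partial_defect i (proj M x)) (proj M x) =
      cinner (partial_defect (Suc i) (proj M x)) (proj M x) -
      (\<Sum>j<ns ! i. cinner (partial_defect (Suc i) (adj M (shift i j) (proj M x))) (adj M (shift i j) (proj M x)))"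
    unfolding partial_defect_step[OF i] using i
    by (intro cinner_defect_step invariant_closed bounded_op_shift_invariant bounded_op_partial_defect
        proj_in[OF invariant_closed]) auto
  then show ?thesis
    unfolding partial_form_def adj_shift_invariant
    by (simp add: proj_backshift_proj[OF i _ x])
qed

text \<open>The quadratic bound under which the remainder in \<open>has_sum_telescope_words\<close>
  vanishes.\<close>

lemma partial_form_bounded:
  assumes "i \<le> length ns"
  obtains C where "\<And>x. \<bar>partial_form i x\<bar> \<le> C * (norm x)\<^sup>2"
proof -
  obtain C where C: "C > 0" "\<And>x. x \<in> M \<Longrightarrow> norm (partial_defect i x) \<le> C * norm x"
    using bounded_op_bound[OF invariant_closed bounded_op_partial_defect[OF assms]] by metis
  have "\<bar>partial_form i x\<bar> \<le> C * (norm x)\<^sup>2" for x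
  proof -
    have p: "proj M x \<in> M" by (rule proj_in[OF invariant_closed])
    have "\<bar>partial_form i x\<bar> \<le> norm (partial_defect i (proj M x)) * norm (proj M x)"
      unfolding partial_form_def using norm_cinner_le abs_Re_le_cmod order_trans by blast
    also have "\<dots> \<le> (C * norm (proj M x)) * norm (proj M x)"
      by (intro mult_right_mono C(2) p) simp
    also have "\<dots> \<le> C * (norm x)\<^sup>2"
      using C(1) norm_proj_le[OF invariant_closed, of x] by (simp add: power2_eq_square mult_mono')
    finally show ?thesis .
  qed
  then show ?thesis by (rule that)
qed

lemma partial_form_top: "partial_form (length ns) x = (norm (proj M x))\<^sup>2"
  by (simp add: partial_form_def partial_defect_def Re_cinner_same)

text \<open>Each induction step inverts one \<open>id - Phi\<close>: the word in place
  \<open>i\<close> is summed outside, and the induction hypothesis expands the form at the shifted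
  vector over the earlier places.\<close>

lemma partial_form_has_sum:
  assumes pos: "\<And>x. x \<in> fock ns \<Longrightarrow> 0 \<le> partial_form 0 x" and "i \<le> length ns" "x \<in> fock ns"
  shows "((\<lambda>\<beta>. partial_form 0 (backshift \<beta> x)) has_sum partial_form i x) (multiwords (take i ns))"
  using assms(2,3)
proof (induction i arbitrary: x)
  case 0
  have "backshift [] x = x" by (rule hsum_eqI) (simp add: backshift.rep_eq)
  moreover have "multiwords [] = {[]}" by (auto simp: multiwords_def)
  ultimately show ?case by (intro has_sum_finiteI) simp_all
next
  case (Suc i)
  then have i: "i < length ns" by simp
  let ?W = "{w. set w \<subseteq> {..<ns ! i}}" and ?V = "multiwords (take i ns)"
  let ?g = "\<lambda>\<beta>. partial_form 0 (backshift \<beta> x)"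
  \<comment> \<open>The telescoping lemma needs nonnegativity of this partial form; the induction
    hypothesis writes it as a sum of values of the full form.\<close>
  have nonneg: "0 \<le> partial_form i y" if y: "y \<in> fock ns" for y
    by (rule has_sum_nonneg[OF Suc.IH[OF _ y]]) (use i y in \<open>auto intro: pos backshift_in_fock\<close>)
  obtain C where C: "\<And>x. \<bar>partial_form (Suc i) x\<bar> \<le> C * (norm x)\<^sup>2"
    using partial_form_bounded[OF Suc.prems(1)] by blast
  have outer: "((\<lambda>w. partial_form i (backshift (word_at i w) x)) has_sum partial_form (Suc i) x) ?W"
    by (rule has_sum_telescope_words[where ns = ns, OF partial_form_step[OF i] nonneg C i Suc.prems(2)])
  have inner: "((\<lambda>\<beta>. ?g (\<beta> @ [w])) has_sum partial_form i (backshift (word_at i w) x)) ?V" for w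
  proof -
    have "((\<lambda>\<beta>. partial_form 0 (backshift \<beta> (backshift (word_at i w) x))) has_sum
        partial_form i (backshift (word_at i w) x)) ?V"
      using i by (intro Suc.IH backshift_in_fock Suc.prems(2)) simp
    moreover have "backshift \<beta> (backshift (word_at i w) x) = backshift (\<beta> @ [w]) x" if "\<beta> \<in> ?V" for \<beta>
    proof -
      have "length \<beta> = i" using length_multiwords[OF that] i by simp
      then show ?thesis by (simp add: backshift_backshift mult_words_word_at_snoc)
    qed
    ultimately show ?thesis by (simp cong: has_sum_cong)
  qed
  have "((\<lambda>(w, \<beta>). ?g (\<beta> @ [w])) has_sum partial_form (Suc i) x) (?W \<times> ?V)"
  proof (rule has_sum_SigmaI[where g = "\<lambda>w. partial_form i (backshift (word_at i w) x)"])
    show "(\<lambda>(w, \<beta>). ?g (\<beta> @ [w])) summable_on (?W \<times> ?V)"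
      by (rule summable_on_SigmaI[where g = "\<lambda>w. partial_form i (backshift (word_at i w) x)"])
        (use inner has_sum_imp_summable[OF outer] in \<open>auto intro: pos backshift_in_fock Suc.prems(2)\<close>)
  qed (use inner outer in auto)
  moreover have "inj_on (\<lambda>(w, \<beta>). \<beta> @ [w]) (?W \<times> ?V)" by (auto simp: inj_on_def)
  ultimately have "(?g has_sum partial_form (Suc i) x) ((\<lambda>(w, \<beta>). \<beta> @ [w]) ` (?W \<times> ?V))"
    by (subst has_sum_reindex) (auto simp: o_def case_prod_unfold)
  then show ?case by (simp only: multiwords_take_Suc[OF i])
qed

section \<open>The multi-analytic operators obtained from the full defect\<close>

context
  assumes poly: "shift \<in> polyball ns M"
begin

text \<open>The full defect is extended by 0 to the complement of \<open>M\<close>, because the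
  pivots are basis vectors of the Fock space and these need not lie in \<open>M\<close>.\<close>

definition inner_vec :: "nat \<Rightarrow> (nat list list, complex) hsum" where
  "inner_vec = cholesky_vec (\<lambda>x. partial_defect 0 (proj M x))
     (\<lambda>s. if from_nat s \<in> multiwords ns then basis_vec (from_nat s) else 0)"

lemma positive_op_partial_defect: "positive_op M (partial_defect 0)"
proof -
  have "positive_op M (Defect M ns shift (\<lambda>_. 1) (\<lambda>h. h))"
    using poly by (simp add: polyball_def)
  then show ?thesis by (simp add: Defect_eq_foldr partial_defect_def)
qed

lemma partial_form_0_nonneg: "0 \<le> partial_form 0 x"
  unfolding partial_form_def
  by (rule positive_op_nonneg[OF positive_op_partial_defect proj_in[OF invariant_closed]])

lemma bounded_op_proj: "bounded_op (fock ns) M (proj M)"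
  by (rule bounded_opI[where B = 1])
    (simp_all add: invariant_closed proj_in proj_add proj_scaleC norm_proj_le)

lemma inner_vec_sums:
  shows "inner_vec s \<in> fock ns"
    and "x \<in> fock ns \<Longrightarrow> (\<lambda>s. (cmod (cinner x (inner_vec s)))\<^sup>2) sums partial_form 0 x"
proof -
  let ?A = "\<lambda>x. partial_defect 0 (proj M x)"
  have mem: "?A x \<in> M" for x
    by (rule bounded_opD(1)[OF bounded_op_partial_defect proj_in[OF invariant_closed]]) simp
  \<comment> \<open>The defect takes values in \<open>M\<close>, so the projection in the second
    argument changes nothing.\<close>
  have same: "cinner (?A x) x = cinner (?A x) (proj M x)" for x
    by (rule cinner_proj_right[OF invariant_closed mem, symmetric])
  have "bounded_op (fock ns) M ?A"
    by (rule bounded_op_compose[OF bounded_op_proj bounded_op_partial_defect]) simp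
  then have "bounded_op (fock ns) (fock ns) ?A"
    unfolding bounded_op_def using invariant_subset by blast
  then have A: "positive_op (fock ns) ?A"
    unfolding positive_op_def same
    using positive_op_partial_defect proj_in[OF invariant_closed] by (simp add: positive_op_def)
  have e: "(if from_nat s \<in> multiwords ns then basis_vec (from_nat s) else 0) \<in> fock ns" for s
    by (simp add: basis_vec_in_fock closed_csubspaceD(1)[OF closed_csubspace_fock])
  show "inner_vec s \<in> fock ns"
    unfolding inner_vec_def by (rule cholesky_vec_in[OF closed_csubspace_fock A e])
  show "(\<lambda>s. (cmod (cinner x (inner_vec s)))\<^sup>2) sums partial_form 0 x" if x: "x \<in> fock ns"
    using cholesky_sums[OF closed_csubspace_fock A e fock_total[OF x] x]
    unfolding inner_vec_def partial_form_def same .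
qed

text \<open>\<open>inner_adj s\<close> is \<open>\<psi>\<^sub>s\<^sup>*\<close> for the multi-analytic operator \<open>\<psi>\<^sub>s\<close> with symbol \<open>inner_vec s\<close>.\<close>

definition inner_adj :: "nat \<Rightarrow> (nat list list, complex) hsum \<Rightarrow> (nat list list, complex) hsum" where
  "inner_adj s x = Abs_hsum (\<lambda>\<beta>. if \<beta> \<in> multiwords ns then cinner (backshift \<beta> x) (inner_vec s) else 0)"

text \<open>Summed over s first, the terms give the full defect form, whose sum over the words is
  known. Exchanging the order will show that each \<open>inner_adj s x\<close> has square summable
  coordinates and that their squared norms add up correctly.\<close>

lemma inner_adj_double_has_sum:
  assumes x: "x \<in> fock ns"
  shows "((\<lambda>(\<beta>, s). (cmod (cinner (backshift \<beta> x) (inner_vec s)))\<^sup>2) has_sum (norm (proj M x))\<^sup>2)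
    (multiwords ns \<times> UNIV)"
proof -
  have outer: "((\<lambda>\<beta>. partial_form 0 (backshift \<beta> x)) has_sum (norm (proj M x))\<^sup>2) (multiwords ns)"
    using partial_form_has_sum[OF partial_form_0_nonneg order_refl x] by (simp add: partial_form_top)
  have inner: "((\<lambda>s. (cmod (cinner (backshift \<beta> x) (inner_vec s)))\<^sup>2) has_sum partial_form 0 (backshift \<beta> x)) UNIV" for \<beta>
    by (rule sums_nonneg_imp_has_sum[OF inner_vec_sums(2)[OF backshift_in_fock[OF x]]]) simp
  show ?thesis
  proof (rule has_sum_SigmaI[where g = "\<lambda>\<beta>. partial_form 0 (backshift \<beta> x)"])
    show "(\<lambda>(\<beta>, s). (cmod (cinner (backshift \<beta> x) (inner_vec s)))\<^sup>2) summable_on (multiwords ns \<times> UNIV)"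
      by (rule summable_on_SigmaI[where g = "\<lambda>\<beta>. partial_form 0 (backshift \<beta> x)"])
        (use inner has_sum_imp_summable[OF outer] in auto)
  qed (use inner outer in auto)
qed

lemma inner_adj_summable:
  assumes x: "x \<in> fock ns"
  shows "(\<lambda>\<beta>. (cmod (cinner (backshift \<beta> x) (inner_vec s)))\<^sup>2) summable_on multiwords ns"
proof -
  have "(\<lambda>(s, \<beta>). (cmod (cinner (backshift \<beta> x) (inner_vec s)))\<^sup>2) summable_on (UNIV \<times> multiwords ns)"
    using has_sum_imp_summable[OF inner_adj_double_has_sum[OF x]]
    by (subst (asm) summable_on_swap) (simp add: case_prod_unfold)
  then show ?thesis by (rule summable_on_SigmaD1) simp
qed

lemma coord_inner_adj:
  assumes x: "x \<in> fock ns"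
  shows "coord (inner_adj s x) = (\<lambda>\<beta>. if \<beta> \<in> multiwords ns then cinner (backshift \<beta> x) (inner_vec s) else 0)"
  unfolding inner_adj_def
proof (rule Abs_hsum_inverse, rule CollectI)
  have "(\<lambda>\<beta>. (cmod (cinner (backshift \<beta> x) (inner_vec s)))\<^sup>2) summable_on multiwords ns \<longleftrightarrow>
      (\<lambda>\<beta>. (norm (if \<beta> \<in> multiwords ns then cinner (backshift \<beta> x) (inner_vec s) else 0))\<^sup>2) summable_on UNIV"
    by (rule summable_on_cong_neutral) auto
  then show "(\<lambda>\<beta>. (norm (if \<beta> \<in> multiwords ns then cinner (backshift \<beta> x) (inner_vec s) else 0))\<^sup>2) summable_on UNIV"
    using inner_adj_summable[OF x] by simp
qed

lemma inner_adj_norm_sums: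
  assumes x: "x \<in> fock ns"
  shows "(\<lambda>s. (norm (inner_adj s x))\<^sup>2) sums (norm (proj M x))\<^sup>2"
proof -
  have 1: "((\<lambda>\<beta>. (cmod (cinner (backshift \<beta> x) (inner_vec s)))\<^sup>2) has_sum (norm (inner_adj s x))\<^sup>2) (multiwords ns)" for s
  proof -
    have "(norm (inner_adj s x))\<^sup>2 = (\<Sum>\<^sub>\<infinity>\<beta>\<in>multiwords ns. (cmod (cinner (backshift \<beta> x) (inner_vec s)))\<^sup>2)"
      unfolding norm_hsum_sq coord_inner_adj[OF x] by (rule infsum_cong_neutral) auto
    then show ?thesis using has_sum_infsum[OF inner_adj_summable[OF x]] by simp
  qed
  have "((\<lambda>(s, \<beta>). (cmod (cinner (backshift \<beta> x) (inner_vec s)))\<^sup>2) has_sum (norm (proj M x))\<^sup>2) (UNIV \<times> multiwords ns)"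
    using inner_adj_double_has_sum[OF x] by (subst (asm) has_sum_swap) (simp add: case_prod_unfold)
  then have "((\<lambda>s. (norm (inner_adj s x))\<^sup>2) has_sum (norm (proj M x))\<^sup>2) UNIV"
    by (rule has_sum_SigmaD) (use 1 in simp)
  then show ?thesis by (rule has_sum_imp_sums)
qed

lemma bounded_op_inner_adj: "bounded_op (fock ns) (fock ns) (inner_adj s)"
proof (rule bounded_opI[where B = 1])
  fix x y c assume x: "x \<in> fock ns"
  show "inner_adj s x \<in> fock ns" by (simp add: fock_def coord_inner_adj[OF x])
  show "inner_adj s (c *\<^sub>C x) = c *\<^sub>C inner_adj s x"
    by (rule hsum_eqI) (simp add: coord_inner_adj x closed_csubspaceD(3)[OF closed_csubspace_fock]
        scaleC_hsum.rep_eq scaleC_complex_def backshift_scaleC cinner_scaleC_left)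
  have "(norm (inner_adj s x))\<^sup>2 = (\<Sum>t\<in>{s}. (norm (inner_adj t x))\<^sup>2)" by simp
  also have "\<dots> \<le> (norm (proj M x))\<^sup>2"
    using inner_adj_norm_sums[OF x] sum_le_suminf[of "\<lambda>t. (norm (inner_adj t x))\<^sup>2" "{s}"]
    by (simp add: sums_iff)
  finally have "norm (inner_adj s x) \<le> norm (proj M x)" by (rule power2_le_imp_le) simp
  then show "norm (inner_adj s x) \<le> 1 * norm x"
    using norm_proj_le[OF invariant_closed, of x] by simp
  show "inner_adj s (x + y) = inner_adj s x + inner_adj s y" if y: "y \<in> fock ns"
    by (rule hsum_eqI) (simp add: coord_inner_adj x y closed_csubspaceD(2)[OF closed_csubspace_fock]
        plus_hsum.rep_eq backshift_add cinner_add_left)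
qed

lemma inner_adj_backshift:
  assumes ij: "i < length ns" "j < ns ! i" and x: "x \<in> fock ns"
  shows "inner_adj s (backshift (word_at i [j]) x) = backshift (word_at i [j]) (inner_adj s x)"
proof (rule hsum_eqI)
  fix \<gamma>
  show "coord (inner_adj s (backshift (word_at i [j]) x)) \<gamma> = coord (backshift (word_at i [j]) (inner_adj s x)) \<gamma>"
  proof (cases "\<gamma> \<in> multiwords ns")
    case True
    then have "mult_words (word_at i [j]) \<gamma> \<in> multiwords ns"
      using ij by (intro word_at_multiwords) auto
    then show ?thesis
      using True ij length_multiwords[OF True]
      by (simp add: coord_inner_adj x backshift_in_fock backshift.rep_eq backshift_backshift)
  next
    case False
    then show ?thesis
      using mult_words_in_multiwordsD[of "word_at i [j]" \<gamma> ns]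
      by (auto simp: coord_inner_adj x backshift_in_fock backshift.rep_eq)
  qed
qed

text \<open>Boundedness is visible on the adjoint side, from \<open>inner_adj_norm_sums\<close>, so
  the multiplier is defined as the adjoint of \<open>inner_adj s\<close>.\<close>

definition inner_op :: "nat \<Rightarrow> (nat list list, complex) hsum \<Rightarrow> (nat list list, complex) hsum" where
  "inner_op s = adj (fock ns) (inner_adj s)"

lemma bounded_op_inner_op: "bounded_op (fock ns) (fock ns) (inner_op s)"
  unfolding inner_op_def
  by (rule bounded_op_adj[OF closed_csubspace_fock bounded_op_inner_adj bounded_opD(1)[OF bounded_op_inner_adj]])

lemma adj_inner_op:
  assumes x: "x \<in> fock ns" shows "adj (fock ns) (inner_op s) x = inner_adj s x"
  by (rule adj_eqI[OF closed_csubspace_fock bounded_opD(1)[OF bounded_op_inner_adj x]])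
    (simp add: inner_op_def cinner_adj_left[OF closed_csubspace_fock bounded_op_inner_adj x])

lemma cinner_backshift_left: "cinner (backshift (word_at i [j]) y) x = cinner y (shift i j x)"
  for x y :: "(nat list list, complex) hsum"
  by (metis cinner_commute cinner_shift)

lemma multi_analytic_inner_op: "multi_analytic ns (inner_op s)"
  unfolding multi_analytic_def
proof (intro conjI allI impI ballI bounded_op_inner_op)
  fix i j x assume ij: "i < length ns" "j < ns ! i" and x: "x \<in> fock ns"
  note adjoint = cinner_adj_right[OF closed_csubspace_fock bounded_op_inner_adj]
  show "inner_op s (shift i j x) = shift i j (inner_op s x)"
    unfolding inner_op_def
  proof (rule adj_eqI[OF closed_csubspace_fock])
    show "shift i j (adj (fock ns) (inner_adj s) x) \<in> fock ns"
      by (intro shift_in_fock adj_in[OF closed_csubspace_fock bounded_op_inner_adj] ij)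
    fix z assume z: "z \<in> fock ns"
    have "cinner (inner_adj s z) (shift i j x) = cinner (inner_adj s (backshift (word_at i [j]) z)) x"
      by (simp add: inner_adj_backshift[OF ij z] cinner_backshift_left)
    also have "\<dots> = cinner z (shift i j (adj (fock ns) (inner_adj s) x))"
      by (simp add: adjoint[OF backshift_in_fock[OF z], symmetric] cinner_backshift_left)
    finally show "cinner (inner_adj s z) (shift i j x) = cinner z (shift i j (adj (fock ns) (inner_adj s) x))" .
  qed
qed

text \<open>The remainders \<open>Z n\<close> lie between 0 and the identity and their forms at
  \<open>x\<close> tend to 0. By \<open>positive_op_norm_sq_le\<close> the squared norm of
  \<open>Z n x\<close> is at most the form, which gives strong convergence.\<close>

lemma inner_op_sums:
  assumes x: "x \<in> fock ns"
  shows "(\<lambda>s. inner_op s (adj (fock ns) (inner_op s) x)) sums proj M x"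
proof -
  define Z where "Z n x = proj M x - (\<Sum>s<n. inner_op s (inner_adj s x))" for n x
  have Zxx: "cinner (Z n x) x = of_real ((norm (proj M x))\<^sup>2 - (\<Sum>s<n. (norm (inner_adj s x))\<^sup>2))"
    if x: "x \<in> fock ns" for n x
  proof -
    have "cinner (inner_op s (inner_adj s x)) x = of_real ((norm (inner_adj s x))\<^sup>2)" for s
      unfolding inner_op_def
      by (simp add: cinner_adj_left[OF closed_csubspace_fock bounded_op_inner_adj x] cinner_same)
    moreover have "cinner (proj M x) x = of_real ((norm (proj M x))\<^sup>2)"
      using cinner_proj_right[OF invariant_closed proj_in[OF invariant_closed], of x x] by (simp add: cinner_same)
    ultimately show ?thesis by (simp add: Z_def cinner_diff_left cinner_sum_left)
  qed
  have pos: "positive_op (fock ns) (Z n)" for n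
    unfolding positive_op_def
  proof (intro conjI ballI)
    have "bounded_op (fock ns) (fock ns) (proj M)"
      using bounded_op_proj invariant_subset unfolding bounded_op_def by blast
    then show "bounded_op (fock ns) (fock ns) (Z n)"
      unfolding Z_def
      by (intro bounded_op_diff bounded_op_sum closed_csubspace_fock
          bounded_op_compose[OF bounded_op_inner_adj bounded_op_inner_op])
    fix x assume x: "x \<in> fock ns"
    have "(\<Sum>s<n. (norm (inner_adj s x))\<^sup>2) \<le> (norm (proj M x))\<^sup>2"
      using inner_adj_norm_sums[OF x] sum_le_suminf[of "\<lambda>t. (norm (inner_adj t x))\<^sup>2" "{..<n}"]
      by (simp add: sums_iff)
    then show "Im (cinner (Z n x) x) = 0" "0 \<le> Re (cinner (Z n x) x)" by (simp_all only: Zxx[OF x]) simp_all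
  qed
  have "Re (cinner (Z n y) y) \<le> (norm y)\<^sup>2" if y: "y \<in> fock ns" for n y
  proof -
    have "Re (cinner (Z n y) y) \<le> (norm (proj M y))\<^sup>2" unfolding Zxx[OF y] by (simp add: sum_nonneg)
    also have "\<dots> \<le> (norm y)\<^sup>2" by (simp add: power_mono norm_proj_le[OF invariant_closed])
    finally show ?thesis .
  qed
  from positive_op_norm_sq_le[OF closed_csubspace_fock pos this x]
  have le: "(norm (Z n x))\<^sup>2 \<le> (norm (proj M x))\<^sup>2 - (\<Sum>s<n. (norm (inner_adj s x))\<^sup>2)" for n
    unfolding Zxx[OF x] by simp
  have "(\<lambda>n. (norm (proj M x))\<^sup>2 - (\<Sum>s<n. (norm (inner_adj s x))\<^sup>2)) \<longlonglongrightarrow> (norm (proj M x))\<^sup>2 - (norm (proj M x))\<^sup>2"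
    using inner_adj_norm_sums[OF x] unfolding sums_def by (intro tendsto_intros)
  then have lim: "(\<lambda>n. (norm (proj M x))\<^sup>2 - (\<Sum>s<n. (norm (inner_adj s x))\<^sup>2)) \<longlonglongrightarrow> 0" by simp
  have "(\<lambda>n. (norm (Z n x))\<^sup>2) \<longlonglongrightarrow> 0"
    by (rule tendsto_sandwich[OF _ _ tendsto_const lim]) (auto simp: le)
  then have "(\<lambda>n. sqrt ((norm (Z n x))\<^sup>2)) \<longlonglongrightarrow> sqrt 0" by (rule tendsto_real_sqrt)
  then have "(\<lambda>n. Z n x) \<longlonglongrightarrow> 0" by (simp add: tendsto_norm_zero_iff)
  then have "(\<lambda>n. proj M x - Z n x) \<longlonglongrightarrow> proj M x - 0" by (intro tendsto_intros)
  then show ?thesis by (simp add: sums_def Z_def adj_inner_op[OF x])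
qed

end

end

theorem proposition3p12:
  fixes ns :: "nat list" and M :: "(nat list list, complex) hsum set"
  assumes "ns \<noteq> []" and "\<forall>n\<in>set ns. 1 \<le> n"
    and "invariant_subspace ns M" and "M \<noteq> fock ns"
  shows "shift \<in> polyball ns M \<and>
      curv (ortho_compl (fock ns) M) ns
        (\<lambda>i j x. proj (ortho_compl (fock ns) M) (shift i j x)) = 0
    \<longleftrightarrow>
    (\<exists>\<psi> :: nat \<Rightarrow> (nat list list, complex) hsum \<Rightarrow> (nat list list, complex) hsum.
      (\<forall>s. multi_analytic ns (\<psi> s)) \<and>
      (\<forall>x\<in>fock ns. (\<lambda>s. \<psi> s (adj (fock ns) (\<psi> s) x)) sums proj M x) \<and>
      ((\<lambda>q. 1 / (\<Prod>i<length ns. real (ns ! i) ^ (q ! i)) *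
          (\<Sum>\<alpha> | \<alpha> \<in> multiwords ns \<and> map length \<alpha> = q.
            \<Sum>s. (norm (adj (fock ns) (\<psi> s) (basis_vec \<alpha>)))\<^sup>2))
        \<longlongrightarrow> 1) (multi_at_top (length ns)))"
    (is "?P \<and> ?C = 0 \<longleftrightarrow> (\<exists>\<psi>. ?A \<psi> \<and> ?S \<psi> \<and> ?T \<psi>)")
proof -
  interpret invariant_fock_subspace ns M by unfold_locales (rule assms(3))
  note curv_iff = curv_compr_eq_0_iff[OF assms(2,4)]
  show ?thesis
  proof
    assume "?P \<and> ?C = 0"
    then have P: ?P and C: "?C = 0" by simp_all
    have A: "?A inner_op" using multi_analytic_inner_op[OF P] by blast
    moreover have S: "?S inner_op" using inner_op_sums[OF P] by blast
    moreover have "?T inner_op"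
      using inner_seq_limit_iff[OF _ _ assms(2), of inner_op] A S curv_iff C by blast
    ultimately show "\<exists>\<psi>. ?A \<psi> \<and> ?S \<psi> \<and> ?T \<psi>" by blast
  next
    assume "\<exists>\<psi>. ?A \<psi> \<and> ?S \<psi> \<and> ?T \<psi>"
    then obtain \<psi> where A: "?A \<psi>" and S: "?S \<psi>" and T: "?T \<psi>" by blast
    have ?P using polyball_of_inner_seq[of \<psi>] A S by blast
    moreover have "?C = 0" using inner_seq_limit_iff[OF _ _ assms(2), of \<psi>] A S T curv_iff by blast
    ultimately show "?P \<and> ?C = 0" ..
  qed
qed

end
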